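(* (a) Let $K_M$ be the class of all space-group pairs $(X,G)$ in which $X$ is a nonempty open subset of a metrizable locally convex topological vector space $E$, and $G\subseteq H(X)$ is a group containing all locally bi-uniformly continuous homeomorphisms of $X$. Then $K_M$ is faithful. (b) For every metric locally convex space $E$ and every nonempty open subset $X\subseteq E$, $(X,P_X)\in K_1$. (c) Let $K_P$ be the class of all space-group pairs $(X,G)$ such that $X$ is a nonempty open subset of a metric locally convex space and $P_X\subseteq G\subseteq H(X)$. Then $K_P$ is faithful.
   Context: For a topological space $X$, $H(X)$ is the group of all auto-homeomorphisms of $X$; $\mathrm{Nbr}(x)$ is the set of open neighborhoods of $x$. A space-group pair is a pair $(X,G)$ with $G$ a subgroup of $H(X)$. A class $K$ of space-group pairs is faithful if for every $(X,G),(Y,H)\in K$ and every group isomorphism $\varphi:G\to H$ there is a homeomorphism $\tau$ from $X$ onto $Y$ such that $\varphi(g)=\tau\circ g\circ\tau^{-1}$ for every $g\in G$. Class $K_1$: a set is somewhere dense if its closure has nonempty interior; $A\subseteq X$ is discrete if it has no accumulation points in $X$. For $A\subseteq X$ infinite and $V\subseteq X$ open nonempty, $V$ dissects $A$ if for every open nonempty $W\subseteq V$ there is $g\in G$ such that $\{a\in A : g(a)\in W\}$ and $\{a\in A : \exists S\in\mathrm{Nbr}(a),\ g\restriction S=\mathrm{Id}\}$ are both infinite; $A$ is dissectable if some such $V$ dissects $A$. An open $U\subseteq X$ is flexible if there is a dense subset $D\subseteq U$ such that every infinite discrete subset of $D$ is dissectable. $(X,G)\in K_1$ iff: (P1) $X$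 is regular and first countable; (P2) for every nonempty open $U\subseteq X$ there is $g\in G\setminus\{\mathrm{Id}\}$ with $g\restriction(X\setminus U)=\mathrm{Id}$; (P3) for every distinct $x,y\in X$ the set $\{g(x) : g\in G,\ \exists U\in\mathrm{Nbr}(y)\ g\restriction U=\mathrm{Id}\}$ is somewhere dense; (P4) the flexible subsets of $X$ cover $X$. Group $P_X$: a metric locally convex space $(E,d)$ is a locally convex topological vector space together with a metric $d$ inducing its topology and invariant under $+$. Boundedness is with respect to $d$. Uniform continuity is with respect to the uniformity of the topological group $(E,+)$ (the same as that of any $+$-invariant metric inducing the topology). A homeomorphism $h$ is locally bi-uniformly continuous if every point of its domain has an open neighborhood $U$ such that $h\restriction U$ and $h^{-1}\restriction h(U)$ are uniformly continuous. $[x,y]=\{tx+(1-t)y : t\in[0,1]\}$; $B_E(x,r)$ is the closed ball, $B_E(A,r)=\bigcup_{x\in A}B_E(x,r)$; $\mathrm{supp}(g)=\{x : g(x)\neq x\}$. A homeomorphism $h\in H(E)$ is basic if there are $x,v\in E$ and $r>0$ such that $\mathrm{supp}(h)\subseteq B_E([x,x+v],r)$; for every $z\in E$ there is $\lambda(z)\in\mathbb R$ with $h(z)=z+\lambda(z)v$; and $h(x)=x+v$. With these data fixed write $x^h=x$, $y^h=x+v$, $r^h=r$, $S^h=B_E([x,x+v],r)$. A homeomorphism $h\in H(E)$ is polygonal if there are $x_0,\dots,x_n\in E$, $r>0$ and basic homeomorphisms $k_1,\dots,k_n$ with $x^{k_i}=x_{i-1}$, $y^{k_i}=x_i$, $r^{k_i}=r$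 and $h=k_n\circ\dots\circ k_1$; write $S^h=\bigcup_{i=1}^n S^{k_i}$. $\widehat P_E$ is the set of all $h\in H(E)$ for which there is a set $\{h_i : i\in\mathbb N\}$ of polygonal homeomorphisms such that: (1) $h\restriction(E\setminus\bigcup_i S^{h_i})=\mathrm{Id}$ and $h\restriction S^{h_i}=h_i\restriction S^{h_i}$ for every $i$; (2) $h$ is locally bi-uniformly continuous; (3) $\mathrm{supp}(h)$ is bounded; (4) the family $\{S^{h_i} : i\in\mathbb N\}$ is discrete, i.e. every point of $E$ has a neighborhood meeting at most one member of the family. $P_E$ is the subgroup of $H(E)$ generated by $\widehat P_E$. For nonempty open $X\subseteq E$, $P_X=\{g\restriction X : g\in P_E,\ g\restriction(E\setminus X)=\mathrm{Id}\}$.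
   Formalization: In (b) the space E is assumed different from {0}: for E = X = {0} the only homeomorphism of X is the identity, so (P2) fails and the claim is false there. *)

theory Defs
  imports "HOL-Analysis.Analysis" "HOL-Algebra.Bij" "HOL-Algebra.Generated_Groups"
begin

section \<open>Space-group pairs and faithfulness\<close>

text \<open>Topological spaces are given as abstract topologies. As in
  \<^const>\<open>BijGroup\<close>, a self-map of the space is made unique as a HOL function by requiring
  it to be \<^const>\<open>extensional\<close> on the carrier; the multiplication is composition.\<close>

definition homeo_group :: "'a topology \<Rightarrow> ('a \<Rightarrow> 'a) monoid" where
  "homeo_group X = (BijGroup (topspace X))
     \<lparr>carrier := {f \<in> Bij (topspace X). homeomorphic_map X X f}\<rparr>"

definition space_group_pair :: "'a topology \<Rightarrow> ('a \<Rightarrow> 'a) set \<Rightarrow> bool" where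
  "space_group_pair X G \<longleftrightarrow> subgroup G (homeo_group X)"

abbreviation group_on :: "'a topology \<Rightarrow> ('a \<Rightarrow> 'a) set \<Rightarrow> ('a \<Rightarrow> 'a) monoid" where
  "group_on X G \<equiv> (homeo_group X)\<lparr>carrier := G\<rparr>"

text \<open>A class of space-group pairs ranges over spaces with arbitrary underlying sets and is
  therefore rendered as a polymorphic set of pairs. Faithfulness relates two of its members,
  which may live on different types; so it takes two instances of the class, one for each
  type, and a class \<open>K\<close> is faithful iff \<open>faithful K K\<close> holds at all pairs of types.
  The map \<open>\<sigma>\<close> is the inverse of \<open>\<tau>\<close>.\<close>

definition faithful ::
    "('a topology \<times> ('a \<Rightarrow> 'a) set) set \<Rightarrow> ('b topology \<times> ('b \<Rightarrow> 'b) set) set \<Rightarrow> bool" where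
  "faithful K L \<longleftrightarrow>
     (\<forall>X G Y H \<phi>. (X, G) \<in> K \<and> (Y, H) \<in> L \<and> \<phi> \<in> iso (group_on X G) (group_on Y H) \<longrightarrow>
        (\<exists>\<tau> \<sigma>. homeomorphic_maps X Y \<tau> \<sigma> \<and>
               (\<forall>g\<in>G. \<phi> g = restrict (\<tau> \<circ> g \<circ> \<sigma>) (topspace Y))))"


section \<open>The class K1\<close>

definition somewhere_dense :: "'a topology \<Rightarrow> 'a set \<Rightarrow> bool" where
  "somewhere_dense X A \<longleftrightarrow> X interior_of (X closure_of A) \<noteq> {}"

definition locally_identity :: "'a topology \<Rightarrow> ('a \<Rightarrow> 'a) \<Rightarrow> 'a \<Rightarrow> bool" where
  "locally_identity X g a \<longleftrightarrow> (\<exists>S. openin X S \<and> a \<in> S \<and> (\<forall>s\<in>S. g s = s))"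

definition dissects :: "'a topology \<Rightarrow> ('a \<Rightarrow> 'a) set \<Rightarrow> 'a set \<Rightarrow> 'a set \<Rightarrow> bool" where
  "dissects X G V A \<longleftrightarrow>
     (\<forall>W. openin X W \<and> W \<noteq> {} \<and> W \<subseteq> V \<longrightarrow>
        (\<exists>g\<in>G. infinite {a \<in> A. g a \<in> W} \<and> infinite {a \<in> A. locally_identity X g a}))"

definition dissectable :: "'a topology \<Rightarrow> ('a \<Rightarrow> 'a) set \<Rightarrow> 'a set \<Rightarrow> bool" where
  "dissectable X G A \<longleftrightarrow> (\<exists>V. openin X V \<and> V \<noteq> {} \<and> dissects X G V A)"

text \<open>Discreteness of \<open>A\<close> means absence of accumulation points in the whole space.\<close>

definition flexible :: "'a topology \<Rightarrow> ('a \<Rightarrow> 'a) set \<Rightarrow> 'a set \<Rightarrow> bool" where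
  "flexible X G U \<longleftrightarrow> openin X U \<and>
     (\<exists>D. D \<subseteq> U \<and> U \<subseteq> X closure_of D \<and>
        (\<forall>A. A \<subseteq> D \<and> infinite A \<and> X derived_set_of A = {} \<longrightarrow> dissectable X G A))"

text \<open>Regular is understood as T3. \<^const>\<open>regular_space\<close> carries no separation of points,
  so the Hausdorff property is added.\<close>

definition K1 :: "('a topology \<times> ('a \<Rightarrow> 'a) set) set" where
  "K1 = {(X, G). space_group_pair X G \<and>
     (regular_space X \<and> Hausdorff_space X \<and> first_countable X) \<and>
     (\<forall>U. openin X U \<and> U \<noteq> {} \<longrightarrow>
        (\<exists>g\<in>G. g \<noteq> \<one>\<^bsub>homeo_group X\<^esub> \<and> (\<forall>x \<in> topspace X - U. g x = x))) \<and>
     (\<forall>x\<in>topspace X. \<forall>y\<in>topspace X. x \<noteq> y \<longrightarrow>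
        somewhere_dense X {g x |g. g \<in> G \<and> locally_identity X g y}) \<and>
     topspace X \<subseteq> \<Union>{U. flexible X G U}}"


section \<open>Locally convex spaces\<close>

definition locally_convex_tvs :: "'a::real_vector topology \<Rightarrow> bool" where
  "locally_convex_tvs T \<longleftrightarrow>
     topspace T = UNIV \<and>
     continuous_map (prod_topology T T) T (\<lambda>(x, y). x + y) \<and>
     continuous_map (prod_topology euclideanreal T) T (\<lambda>(c, x). c *\<^sub>R x) \<and>
     (\<forall>U. openin T U \<and> 0 \<in> U \<longrightarrow> (\<exists>C. openin T C \<and> 0 \<in> C \<and> convex C \<and> C \<subseteq> U))"

abbreviation mtop :: "('a \<Rightarrow> 'a \<Rightarrow> real) \<Rightarrow> 'a topology" where
  "mtop d \<equiv> Metric_space.mtopology UNIV d"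

text \<open>A metric locally convex space is given by its metric, the topology being the one
  the metric induces.\<close>

definition metric_lcs :: "('a::real_vector \<Rightarrow> 'a \<Rightarrow> real) \<Rightarrow> bool" where
  "metric_lcs d \<longleftrightarrow> Metric_space UNIV d \<and> locally_convex_tvs (mtop d) \<and>
     (\<forall>x y z. d (x + z) (y + z) = d x y)"

text \<open>Uniform continuity on \<open>S\<close> for the uniformity of the topological group \<open>(E, +)\<close>, whose
  entourages are generated by \<open>{(x, y). x - y \<in> U}\<close>, \<open>U\<close> an open neighborhood of \<open>0\<close>.\<close>

definition group_uniformly_continuous_on ::
    "'a::real_vector topology \<Rightarrow> 'a set \<Rightarrow> ('a \<Rightarrow> 'a) \<Rightarrow> bool" where
  "group_uniformly_continuous_on T S f \<longleftrightarrow>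
     (\<forall>V. openin T V \<and> 0 \<in> V \<longrightarrow>
        (\<exists>U. openin T U \<and> 0 \<in> U \<and> (\<forall>x\<in>S. \<forall>y\<in>S. x - y \<in> U \<longrightarrow> f x - f y \<in> V)))"

definition locally_bi_uc :: "'a::real_vector topology \<Rightarrow> 'a set \<Rightarrow> ('a \<Rightarrow> 'a) \<Rightarrow> bool" where
  "locally_bi_uc T X h \<longleftrightarrow>
     (\<forall>x\<in>X. \<exists>U. openin (subtopology T X) U \<and> x \<in> U \<and>
        group_uniformly_continuous_on T U h \<and>
        group_uniformly_continuous_on T (h ` U) (inv_into X h))"


section \<open>The group of polygonal type\<close>

definition supp :: "('a \<Rightarrow> 'a) \<Rightarrow> 'a set" where
  "supp g = {x. g x \<noteq> x}"

definition set_cball :: "('a \<Rightarrow> 'a \<Rightarrow> real) \<Rightarrow> 'a set \<Rightarrow> real \<Rightarrow> 'a set" where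
  "set_cball d A r = (\<Union>x\<in>A. Metric_space.mcball UNIV d x r)"

text \<open>\<open>basic_homeo d h x v r\<close>: \<open>h\<close> is basic, with the data \<open>x, v, r\<close> fixed, so that
  \<open>S\<^sup>h = set_cball d (closed_segment x (x + v)) r\<close>.\<close>

definition basic_homeo ::
    "('a::real_vector \<Rightarrow> 'a \<Rightarrow> real) \<Rightarrow> ('a \<Rightarrow> 'a) \<Rightarrow> 'a \<Rightarrow> 'a \<Rightarrow> real \<Rightarrow> bool" where
  "basic_homeo d h x v r \<longleftrightarrow>
     h \<in> carrier (homeo_group (mtop d)) \<and> r > 0 \<and>
     supp h \<subseteq> set_cball d (closed_segment x (x + v)) r \<and>
     (\<forall>z. \<exists>c::real. h z = z + c *\<^sub>R v) \<and>
     h x = x + v"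

text \<open>\<open>polygonal d h S\<close>: \<open>h\<close> is polygonal and \<open>S = S\<^sup>h\<close> for some choice of the data.
  The homeomorphism \<open>ks i\<close> goes from vertex \<open>xs i\<close> to vertex \<open>xs (Suc i)\<close>, and the
  \<^const>\<open>fold\<close> is \<open>ks (n - 1) \<circ> \<dots> \<circ> ks 0\<close>.\<close>

definition polygonal ::
    "('a::real_vector \<Rightarrow> 'a \<Rightarrow> real) \<Rightarrow> ('a \<Rightarrow> 'a) \<Rightarrow> 'a set \<Rightarrow> bool" where
  "polygonal d h S \<longleftrightarrow>
     (\<exists>(n::nat) xs ks r. n \<ge> 1 \<and> r > 0 \<and>
        (\<forall>i<n. basic_homeo d (ks i) (xs i) (xs (Suc i) - xs i) r) \<and>
        h = fold (\<circ>) (map ks [0..<n]) id \<and>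
        S = (\<Union>i<n. set_cball d (closed_segment (xs i) (xs (Suc i))) r))"

text \<open>The members of the family are the sets themselves, so a set may occur under several
  indices; in particular finite families are covered.\<close>

definition discrete_family :: "'a topology \<Rightarrow> 'a set set \<Rightarrow> bool" where
  "discrete_family T \<S> \<longleftrightarrow>
     (\<forall>x\<in>topspace T. \<exists>U. openin T U \<and> x \<in> U \<and>
        (\<forall>A\<in>\<S>. \<forall>B\<in>\<S>. A \<inter> U \<noteq> {} \<and> B \<inter> U \<noteq> {} \<longrightarrow> A = B))"

definition P_hat :: "('a::real_vector \<Rightarrow> 'a \<Rightarrow> real) \<Rightarrow> ('a \<Rightarrow> 'a) set" where
  "P_hat d = {h \<in> carrier (homeo_group (mtop d)).
     \<exists>(hs :: nat \<Rightarrow> 'a \<Rightarrow> 'a) (S :: nat \<Rightarrow> 'a set).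
        (\<forall>i. polygonal d (hs i) (S i)) \<and>
        (\<forall>x. x \<notin> (\<Union>i. S i) \<longrightarrow> h x = x) \<and>
        (\<forall>i. \<forall>x\<in>S i. h x = hs i x) \<and>
        locally_bi_uc (mtop d) UNIV h \<and>
        Metric_space.mbounded UNIV d (supp h) \<and>
        discrete_family (mtop d) (range S)}"

definition P_space :: "('a::real_vector \<Rightarrow> 'a \<Rightarrow> real) \<Rightarrow> ('a \<Rightarrow> 'a) set" where
  "P_space d = generate (homeo_group (mtop d)) (P_hat d)"

definition P_open :: "('a::real_vector \<Rightarrow> 'a \<Rightarrow> real) \<Rightarrow> 'a set \<Rightarrow> ('a \<Rightarrow> 'a) set" where
  "P_open d X = {restrict g X |g. g \<in> P_space d \<and> (\<forall>x. x \<notin> X \<longrightarrow> g x = x)}"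


section \<open>The classes KM and KP\<close>

definition KM :: "('a::real_vector topology \<times> ('a \<Rightarrow> 'a) set) set" where
  "KM = {(subtopology T X, G) |T X G.
     locally_convex_tvs T \<and> metrizable_space T \<and> openin T X \<and> X \<noteq> {} \<and>
     space_group_pair (subtopology T X) G \<and>
     {h \<in> carrier (homeo_group (subtopology T X)). locally_bi_uc T X h} \<subseteq> G}"

definition KP :: "('a::real_vector topology \<times> ('a \<Rightarrow> 'a) set) set" where
  "KP = {(subtopology (mtop d) X, G) |d X G.
     metric_lcs d \<and> openin (mtop d) X \<and> X \<noteq> {} \<and>
     space_group_pair (subtopology (mtop d) X) G \<and> P_open d X \<subseteq> G}"

end

theory Submission
  imports Defs
begin

text \<open>The proof reconstructs the space from the group in two steps. First, supports: by the
  commutator argument of Belk, Elliott and Matucci, the relation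
  ``the support of \<open>f\<close> lies in the closure of the support of \<open>g\<close>'' is definable from the group
  operations alone. Secondly, points: a sequence of group elements whose supports shrink to
  a point cannot be divided into a part that is fixed and a part that is moved into an arbitrarily
  prescribed open set. A sequence without a convergent subsequence can be so divided, by dissectability,
  and so can a sequence with two limits, by (P3). An isomorphism between two groups
  of the class \<open>K1\<close> is thus regarded as two actions of one group, and two points correspond
  if a single sequence of group elements shrinks to both.

  In a locally convex space, points are pushed along segments by the maps
  \<open>z \<mapsto> z + \<lambda>(z) v\<close> with \<open>\<lambda>\<close> a small multiple of a cut-off of a continuous seminorm. An
  infinite closed discrete set is dissected by a product of such maps along a locally finite family
  of polygons.\<close>

text \<open>The group sees a support only through commutation, hence only up to closure; the closure
  is absorbed by regularity where supports shrink to a point and by openness where supports meet.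
  Disjointness is recovered only for \<open>g^12\<close>: 12 = lcm(1,2,3,4), and four translates of
  a small set cover the support of a double commutator. No local compactness is available to make
  sequences converge; dissectability inside one flexible open set takes its place, and this is why
  \<open>good\<close> includes \<open>movable\<close>: a single group element must carry infinitely
  many members of a sequence into such a set. On the analytic side the obstacle is (P4) in spaces
  that are not normable: the points of a closed discrete set may be unbounded in the seminorm that
  describes the target, and contracting them by factors tending to 0 could make the paths
  accumulate. A detour by a vector that is small in this seminorm and huge in another one prevents
  this. Metrizable spaces are reduced to metric ones by an invariant metric built from countably
  many seminorms.\<close>

no_notation eq_closure_of ("closure'_of\<index>")

section \<open>Recovering supports from the group structure\<close>

context group
begin

definition commutator :: "'a \<Rightarrow> 'a \<Rightarrow> 'a" where
  "commutator a b = a \<otimes> b \<otimes> inv a \<otimes> inv b"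

definition conjugate :: "'a \<Rightarrow> 'a \<Rightarrow> 'a" where
  "conjugate g k = g \<otimes> k \<otimes> inv g"

text \<open>An algebraic substitute for disjoint supports: whatever fails to commute with
  \<open>f\<close> can be localised, inside the centraliser of \<open>g\<close>, to a nontrivial
  element commuting with \<open>g\<close>. Two nested commutators are taken so that, for disjoint
  supports, the outcome can be made independent of \<open>h\<close>.\<close>

definition alg_disjoint :: "'a \<Rightarrow> 'a \<Rightarrow> bool" where
  "alg_disjoint f g \<longleftrightarrow> (\<forall>h\<in>carrier G. f \<otimes> h \<noteq> h \<otimes> f \<longrightarrow>
     (\<exists>f1\<in>carrier G. \<exists>f2\<in>carrier G. f1 \<otimes> g = g \<otimes> f1 \<and> f2 \<otimes> g = g \<otimes> f2 \<and>
        commutator f1 (commutator f2 h) \<noteq> \<one> \<and>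
        commutator f1 (commutator f2 h) \<otimes> g = g \<otimes> commutator f1 (commutator f2 h)))"

text \<open>Read on supports: whatever is disjoint from \<open>f'\<close> is disjoint from
  \<open>f\<close>. The test uses \<open>g^12\<close> because algebraic disjointness is shown to
  separate supports only away from the points fixed by \<open>g^12\<close>.\<close>

definition below :: "'a \<Rightarrow> 'a \<Rightarrow> bool" where
  "below f f' \<longleftrightarrow> (\<forall>g\<in>carrier G. alg_disjoint f' g \<longrightarrow>
      f \<otimes> g [^] (12::nat) = g [^] (12::nat) \<otimes> f)"

definition nontriv :: "'a set" where "nontriv = carrier G - {\<one>}"

definition separate :: "'a \<Rightarrow> 'a \<Rightarrow> bool" where
  "separate k g \<longleftrightarrow> \<not> (\<exists>j\<in>nontriv. below j k \<and> below j g)"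

text \<open>In an action: the images under \<open>g\<close> of infinitely many supports meet the
  support of \<open>w\<close>.\<close>

definition visits :: "(nat \<Rightarrow> 'a) \<Rightarrow> 'a \<Rightarrow> 'a \<Rightarrow> bool" where
  "visits F g w \<longleftrightarrow> infinite {n. \<not> separate (conjugate g (F n)) w}"

text \<open>The algebraic trace of dissectability: \<open>w\<close> ranges over the elements inside
  a fixed \<open>v\<close> as \<open>W\<close> ranges over the open subsets of \<open>V\<close>, and
  being the identity near a point of the support of \<open>F n\<close> is weakened to
  \<open>F n\<close> not lying below \<open>g\<close>.\<close>

definition divisible :: "(nat \<Rightarrow> 'a) \<Rightarrow> bool" where
  "divisible F \<longleftrightarrow> (\<exists>v\<in>nontriv. \<forall>w\<in>nontriv. below w v \<longrightarrow>
     (\<exists>g\<in>carrier G. visits F g w \<and> infinite {n. \<not> below (F n) g}))"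

definition movable :: "(nat \<Rightarrow> 'a) \<Rightarrow> bool" where
  "movable F \<longleftrightarrow> (\<exists>v\<in>nontriv. \<forall>w\<in>nontriv. below w v \<longrightarrow> (\<exists>g\<in>carrier G. visits F g w))"

text \<open>Passing to subsequences is not enough, since the supports may stay large; members may
  also be replaced by elements of smaller support.\<close>

definition shrinking :: "(nat \<Rightarrow> 'a) \<Rightarrow> (nat \<Rightarrow> 'a) \<Rightarrow> bool" where
  "shrinking F' F \<longleftrightarrow> range F' \<subseteq> nontriv \<and> (\<exists>r. strict_mono r \<and> (\<forall>n. below (F' n) (F (r n))))"

text \<open>Convergence to a point as seen by the group: a nontrivial sequence shrinking to a point
  is good, and a good nontrivial sequence has a \<open>shrinking\<close> that converges.\<close>

definition good :: "(nat \<Rightarrow> 'a) \<Rightarrow> bool" where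
  "good F \<longleftrightarrow> movable F \<and> (\<forall>F'. shrinking F' F \<longrightarrow> \<not> divisible F')"

lemma commutator_closed [simp]:
  "\<lbrakk>a \<in> carrier G; b \<in> carrier G\<rbrakk> \<Longrightarrow> commutator a b \<in> carrier G"
  by (simp add: commutator_def)

lemma conjugate_closed [simp]: "\<lbrakk>a \<in> carrier G; b \<in> carrier G\<rbrakk> \<Longrightarrow> conjugate a b \<in> carrier G"
  by (simp add: conjugate_def)

lemma commutator_eq_one_iff:
  assumes "a \<in> carrier G" "b \<in> carrier G"
  shows "commutator a b = \<one> \<longleftrightarrow> a \<otimes> b = b \<otimes> a"
proof -
  have "commutator a b = (a \<otimes> b) \<otimes> inv (b \<otimes> a)"
    using assms by (simp add: commutator_def inv_mult_group m_assoc)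
  then show ?thesis
    using assms by (metis inv_closed inv_equality inv_inv m_closed r_inv)
qed

text \<open>Used to erase from an inner commutator a factor that commutes with the outer
  element.\<close>

lemma commutator_mult_right:
  assumes "a \<in> carrier G" "b \<in> carrier G" "m \<in> carrier G" "a \<otimes> m = m \<otimes> a"
  shows "commutator a (b \<otimes> m) = commutator a b"
proof -
  have "m \<otimes> inv a = inv a \<otimes> m"
    using assms by (metis inv_closed inv_solve_left inv_solve_right m_assoc m_closed)
  then have "commutator a (b \<otimes> m) = a \<otimes> b \<otimes> (inv a \<otimes> m) \<otimes> (inv m \<otimes> inv b)"
    using assms by (simp add: commutator_def inv_mult_group m_assoc)
  also have "\<dots> = commutator a b"
    using assms by (simp add: commutator_def m_assoc) (simp flip: m_assoc)
  finally show ?thesis .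
qed

lemma commutator_split:
  assumes "a \<in> carrier G" "b \<in> carrier G"
  shows "commutator a b = a \<otimes> conjugate b (inv a)" "commutator a b = conjugate a b \<otimes> inv b"
  using assms by (simp_all add: commutator_def conjugate_def m_assoc)

lemma mult_commutes_with:
  assumes "a \<in> carrier G" "b \<in> carrier G" "g \<in> carrier G" "a \<otimes> g = g \<otimes> a" "b \<otimes> g = g \<otimes> b"
  shows "(a \<otimes> b) \<otimes> g = g \<otimes> (a \<otimes> b)"
  using assms by (metis m_assoc)

lemma inv_commutes_with:
  assumes "a \<in> carrier G" "g \<in> carrier G" "a \<otimes> g = g \<otimes> a"
  shows "inv a \<otimes> g = g \<otimes> inv a"
  using assms by (metis inv_closed inv_solve_left inv_solve_right m_assoc m_closed)

lemma commutator_commutes_with: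
  assumes "a \<in> carrier G" "b \<in> carrier G" "g \<in> carrier G" "a \<otimes> g = g \<otimes> a" "b \<otimes> g = g \<otimes> b"
  shows "commutator a b \<otimes> g = g \<otimes> commutator a b"
  unfolding commutator_def using assms by (intro mult_commutes_with inv_commutes_with) auto

lemma pow_commutes_with:
  assumes "a \<in> carrier G" "g \<in> carrier G" "a \<otimes> g = g \<otimes> a"
  shows "a \<otimes> g [^] (n::nat) = g [^] n \<otimes> a"
  using assms by (metis nat_pow_closed group_commutes_pow)

end

section \<open>Faithful actions with elements supported in every nonempty open set\<close>

locale moving_action = group G for G :: "('g, 'm) monoid_scheme" (structure) +
  fixes X :: "'x topology" and act :: "'g \<Rightarrow> 'x \<Rightarrow> 'x"
  assumes act_cont: "g \<in> carrier G \<Longrightarrow> continuous_map X X (act g)"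
    and act_mult: "\<lbrakk>g \<in> carrier G; h \<in> carrier G; x \<in> topspace X\<rbrakk> \<Longrightarrow> act (g \<otimes> h) x = act g (act h x)"
    and act_one: "x \<in> topspace X \<Longrightarrow> act \<one> x = x"
    and act_faithful: "\<lbrakk>g \<in> carrier G; \<And>x. x \<in> topspace X \<Longrightarrow> act g x = x\<rbrakk> \<Longrightarrow> g = \<one>"
    and hausdorff: "Hausdorff_space X"
    and moving: "\<lbrakk>openin X U; U \<noteq> {}\<rbrakk> \<Longrightarrow>
      \<exists>g\<in>carrier G. g \<noteq> \<one> \<and> (\<forall>x\<in>topspace X - U. act g x = x)"
begin

definition mv :: "'g \<Rightarrow> 'x set" where
  "mv g = {x \<in> topspace X. act g x \<noteq> x}"

lemma act_in [simp]: "\<lbrakk>g \<in> carrier G; x \<in> topspace X\<rbrakk> \<Longrightarrow> act g x \<in> topspace X"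
  using act_cont by (metis continuous_map_image_subset_topspace image_subset_iff)

lemma mv_sub: "mv g \<subseteq> topspace X"
  by (auto simp: mv_def)

lemma act_inv [simp]:
  assumes "g \<in> carrier G" "x \<in> topspace X"
  shows "act (inv g) (act g x) = x" "act g (act (inv g) x) = x"
  using assms by (metis act_mult act_one inv_closed l_inv r_inv)+

lemma act_inj: "\<lbrakk>g \<in> carrier G; x \<in> topspace X; y \<in> topspace X; act g x = act g y\<rbrakk> \<Longrightarrow> x = y"
  by (metis act_inv(1))

lemma act_eqI:
  assumes "g \<in> carrier G" "h \<in> carrier G" "\<And>x. x \<in> topspace X \<Longrightarrow> act g x = act h x"
  shows "g = h"
proof -
  have "inv h \<otimes> g = \<one>"
    using assms by (intro act_faithful) (auto simp: act_mult)
  then show ?thesis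
    using assms by (metis inv_equality inv_inv inv_closed)
qed

lemma mv_nonempty: "\<lbrakk>g \<in> carrier G; g \<noteq> \<one>\<rbrakk> \<Longrightarrow> mv g \<noteq> {}"
  using act_faithful by (auto simp: mv_def)

lemma mv_one [simp]: "mv \<one> = {}"
  by (auto simp: mv_def act_one)

lemma act_vimage_open:
  assumes "g \<in> carrier G" "openin X V"
  shows "openin X {x \<in> topspace X. act g x \<in> V}"
  using act_cont assms continuous_map_def by (metis openin_continuous_map_preimage)

lemma act_image_eq:
  assumes "g \<in> carrier G" "V \<subseteq> topspace X"
  shows "act g ` V = {x \<in> topspace X. act (inv g) x \<in> V}"
proof -
  have "x \<in> act g ` V" if "x \<in> topspace X" "act (inv g) x \<in> V" for x
    using that assms by (metis act_inv(2) image_eqI)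
  then show ?thesis using assms by auto
qed

lemma act_image_open: "\<lbrakk>g \<in> carrier G; openin X V\<rbrakk> \<Longrightarrow> openin X (act g ` V)"
  by (simp add: act_image_eq act_vimage_open openin_subset)

lemma mv_open: 
  assumes "g \<in> carrier G" shows "openin X (mv g)"
proof -
  have "closedin X {x \<in> topspace X. act g x = id x}"
    using assms by (intro closedin_continuous_maps_eq [OF hausdorff]) (auto simp: act_cont)
  moreover have "mv g = topspace X - {x \<in> topspace X. act g x = id x}"
    by (auto simp: mv_def)
  ultimately show ?thesis by auto
qed

lemma mv_inv [simp]: "g \<in> carrier G \<Longrightarrow> mv (inv g) = mv g"
  by (auto simp: mv_def) (metis act_inv)+

lemma mv_mult: "\<lbrakk>g \<in> carrier G; h \<in> carrier G\<rbrakk> \<Longrightarrow> mv (g \<otimes> h) \<subseteq> mv g \<union> mv h"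
  by (auto simp: mv_def act_mult)

lemma mv_conjugate: 
  assumes "g \<in> carrier G" "k \<in> carrier G" shows "mv (conjugate g k) = act g ` mv k"
proof -
  have "act g (act k (act (inv g) x)) \<noteq> x \<longleftrightarrow> act k (act (inv g) x) \<noteq> act (inv g) x"
    if "x \<in> topspace X" for x
    using assms that by (metis act_in act_inv inv_closed)
  then show ?thesis
    using assms by (subst act_image_eq) (auto simp: mv_def conjugate_def act_mult)
qed

lemma mv_invariant: 
  assumes "g \<in> carrier G" "x \<in> mv g" shows "act g x \<in> mv g"
  using assms act_inj by (fastforce simp: mv_def)

lemma commute_if_disjoint:
  assumes "f \<in> carrier G" "g \<in> carrier G" "mv f \<inter> mv g = {}"
  shows "f \<otimes> g = g \<otimes> f"
proof (rule act_eqI)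
  fix x assume x: "x \<in> topspace X"
  consider "x \<in> mv f" | "x \<in> mv g" | "act f x = x" "act g x = x"
    using x by (auto simp: mv_def)
  then have "act f (act g x) = act g (act f x)"
  proof cases
    case 1
    then have "act f x \<in> mv f" using assms mv_invariant by blast
    with 1 have "x \<notin> mv g" "act f x \<notin> mv g" using assms by blast+
    then show ?thesis using assms x by (simp add: mv_def)
  next
    case 2
    then have "act g x \<in> mv g" using assms mv_invariant by blast
    with 2 have "x \<notin> mv f" "act g x \<notin> mv f" using assms by blast+
    then show ?thesis using assms x by (simp add: mv_def)
  qed auto
  then show "act (f \<otimes> g) x = act (g \<otimes> f) x" using assms x by (simp add: act_mult)
qed (use assms in auto)

lemma mv_commute:
  assumes "f \<in> carrier G" "g \<in> carrier G" "f \<otimes> g = g \<otimes> f" "x \<in> mv f"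
  shows "act g x \<in> mv f"
proof -
  have "act f (act g x) = act g (act f x)"
    using assms by (metis act_mult mv_sub subsetD)
  then show ?thesis using assms act_inj [of g] by (auto simp: mv_def)
qed

lemma moving': 
  assumes "openin X U" "U \<noteq> {}" obtains g where "g \<in> nontriv" "mv g \<subseteq> U"
  using moving [OF assms] that unfolding nontriv_def mv_def by blast

lemma displacing_neighbourhood:
  assumes "finite I" "\<And>i. i \<in> I \<Longrightarrow> h i \<in> carrier G \<and> act (h i) x \<noteq> x" "openin X U" "x \<in> U"
  obtains V where "openin X V" "x \<in> V" "V \<subseteq> U" "\<And>i. i \<in> I \<Longrightarrow> act (h i) ` V \<inter> V = {}"
proof -
  have x: "x \<in> topspace X" using assms openin_subset by blast
  have "\<exists>V. openin X V \<and> x \<in> V \<and> V \<subseteq> U \<and> (\<forall>i\<in>I. act (h i) ` V \<inter> V = {})"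
    using assms(1,2)
  proof (induction I)
    case empty
    then show ?case using assms by auto
  next
    case (insert i I)
    then obtain V where V: "openin X V" "x \<in> V" "V \<subseteq> U" "\<forall>i\<in>I. act (h i) ` V \<inter> V = {}"
      by auto
    have hi: "h i \<in> carrier G" "act (h i) x \<noteq> x" using insert by auto
    then obtain A B where AB: "openin X A" "openin X B" "act (h i) x \<in> A" "x \<in> B" "A \<inter> B = {}"
      using hausdorff x unfolding Hausdorff_space_def disjnt_def by (metis act_in)
    let ?W = "V \<inter> B \<inter> {x \<in> topspace X. act (h i) x \<in> A}"
    have "openin X ?W" using V AB act_vimage_open hi by blast
    moreover have "act (h i) ` ?W \<inter> ?W = {}" using AB by auto
    moreover have "act (h j) ` ?W \<inter> ?W = {}" if "j \<in> I" for j
      using V(4) that by blast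
    ultimately show ?case using V AB x by (intro exI [of _ ?W]) blast
  qed
  then show ?thesis using that by blast
qed

lemma displacing_neighbourhood1:
  assumes "h \<in> carrier G" "act h x \<noteq> x" "openin X U" "x \<in> U"
  obtains V where "openin X V" "x \<in> V" "V \<subseteq> U" "act h ` V \<inter> V = {}"
  using displacing_neighbourhood [of "{()}" "\<lambda>_. h" x U] assms by (metis finite.intros singletonI)

text \<open>If \<open>h\<close> does not commute with \<open>f\<close>, it displaces a small open
  \<open>V\<close> inside \<open>mv f\<close>. Take \<open>f2\<close> supported in \<open>V\<close>
  and \<open>f1\<close> supported in a set displaced by \<open>f2\<close>. Both commute with
  \<open>g\<close> because \<open>V\<close> misses \<open>mv g\<close>, and the double commutator
  collapses to \<open>[f1, f2]\<close>, which is nontrivial since \<open>f2\<close> moves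
  \<open>mv f1\<close> off itself.\<close>

lemma alg_disjoint_if_disjoint:
  assumes f: "f \<in> carrier G" and g: "g \<in> carrier G" and dj: "mv f \<inter> mv g = {}"
  shows "alg_disjoint f g"
  unfolding alg_disjoint_def
proof (intro ballI impI)
  fix h assume h: "h \<in> carrier G" "f \<otimes> h \<noteq> h \<otimes> f"
  then obtain x where x: "x \<in> mv f" "x \<in> mv h"
    using commute_if_disjoint f by blast
  obtain V where V: "openin X V" "x \<in> V" "V \<subseteq> mv f" "act h ` V \<inter> V = {}"
    using displacing_neighbourhood1 [of h x "mv f"] h x mv_open f by (auto simp: mv_def)
  obtain f2 where f2: "f2 \<in> nontriv" "mv f2 \<subseteq> V" using moving' V by blast
  then have f2c: "f2 \<in> carrier G" by (simp add: nontriv_def)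
  obtain y where y: "y \<in> mv f2" using f2 mv_nonempty by (auto simp: nontriv_def)
  obtain W where W: "openin X W" "y \<in> W" "W \<subseteq> mv f2" "act f2 ` W \<inter> W = {}"
    using displacing_neighbourhood1 [of f2 y "mv f2"] f2c y mv_open by (auto simp: mv_def)
  obtain f1 where f1: "f1 \<in> nontriv" "mv f1 \<subseteq> W" using moving' W by blast
  then have f1c: "f1 \<in> carrier G" by (simp add: nontriv_def)
  \<comment> \<open>\<open>commutator f2 h\<close> equals \<open>f2 \<otimes> m\<close>, and
    \<open>m\<close> is supported in the \<open>h\<close>-image of \<open>V\<close>, away from
    \<open>f1\<close>; so \<open>m\<close> drops out of the outer commutator.\<close>
  define m where "m = conjugate h (inv f2)"
  have mc: "m \<in> carrier G" using h f2c by (simp add: m_def)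
  have "mv m = act h ` mv f2" using h f2c by (simp add: m_def mv_conjugate)
  then have "mv m \<subseteq> act h ` V" using f2 by blast
  moreover have "mv f1 \<subseteq> V" using f1 W f2 by blast
  ultimately have "mv f1 \<inter> mv m = {}" using V by blast
  then have "f1 \<otimes> m = m \<otimes> f1" using f1c mc commute_if_disjoint by blast
  then have eq: "commutator f1 (commutator f2 h) = commutator f1 f2"
    using f1c f2c h mc by (simp add: commutator_split(1)[of f2 h] commutator_mult_right flip: m_def)
  have c1: "f1 \<otimes> g = g \<otimes> f1" "f2 \<otimes> g = g \<otimes> f2"
    using f1 f2 W V dj f1c f2c g by (blast intro: commute_if_disjoint)+
  have "f1 \<otimes> f2 \<noteq> f2 \<otimes> f1"
  proof
    assume e: "f1 \<otimes> f2 = f2 \<otimes> f1"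
    obtain z where z: "z \<in> mv f1" using f1 mv_nonempty by (auto simp: nontriv_def)
    then have "act f2 z \<in> mv f1" using mv_commute e f1c f2c by auto
    then show False using z f1 W by blast
  qed
  then have "commutator f1 f2 \<noteq> \<one>" using f1c f2c commutator_eq_one_iff by blast
  then show "\<exists>f1\<in>carrier G. \<exists>f2\<in>carrier G. f1 \<otimes> g = g \<otimes> f1 \<and> f2 \<otimes> g = g \<otimes> f2 \<and>
        commutator f1 (commutator f2 h) \<noteq> \<one> \<and>
        commutator f1 (commutator f2 h) \<otimes> g = g \<otimes> commutator f1 (commutator f2 h)"
    using eq c1 f1c f2c g commutator_commutes_with by metis
qed

lemma act_pow_fixed:
  assumes "g \<in> carrier G" "x \<in> topspace X" "act g x = x"
  shows "act (g [^] (n::nat)) x = x"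
  using assms by (induction n) (auto simp: act_one act_mult)

lemma act_pow_dvd:
  assumes "g \<in> carrier G" "x \<in> topspace X" "act (g [^] (m::nat)) x = x" "m dvd n"
  shows "act (g [^] n) x = x"
proof -
  obtain k where "n = m * k" using assms by auto
  then have "g [^] n = (g [^] m) [^] k" using assms by (simp add: nat_pow_pow)
  then show ?thesis using act_pow_fixed [of "g [^] m"] assms by simp
qed

lemma mv_commutator:
  assumes "a \<in> carrier G" "b \<in> carrier G"
  shows "mv (commutator a b) \<subseteq> mv b \<union> act a ` mv b"
  using mv_mult [of "conjugate a b" "inv b"] mv_conjugate [of a b] assms
  by (auto simp: commutator_split(2))

text \<open>At a point moved by both \<open>f\<close> and \<open>g^12\<close>, the powers
  \<open>g\<close>, ..., \<open>g^4\<close> displace a neighbourhood, as 1, 2, 3 and 4 divide 12. An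
  \<open>h\<close> supported in it yields a double commutator \<open>k\<close> commuting with
  \<open>g\<close>: its support is \<open>g\<close>-invariant, yet lies in four translates of the
  neighbourhood, too few for five points of one orbit.\<close>

lemma disjoint_if_alg_disjoint:
  assumes f: "f \<in> carrier G" and g: "g \<in> carrier G" and ad: "alg_disjoint f g"
  shows "mv f \<inter> mv (g [^] (12::nat)) = {}"
proof (rule ccontr)
  assume "mv f \<inter> mv (g [^] (12::nat)) \<noteq> {}"
  then obtain p where p: "p \<in> mv f" "p \<in> mv (g [^] (12::nat))" by blast
  then have pt: "p \<in> topspace X" using mv_sub by auto
  have gi: "act (g [^] i) p \<noteq> p" if "i \<in> {1..4::nat}" for i
  proof -
    have "i = 1 \<or> i = 2 \<or> i = 3 \<or> i = 4" using that by auto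
    then have "i dvd 12" by auto
    then show ?thesis using act_pow_dvd [OF g pt] p by (auto simp: mv_def)
  qed
  obtain V1 where V1: "openin X V1" "p \<in> V1" "V1 \<subseteq> topspace X"
    "\<And>i. i \<in> {1..4::nat} \<Longrightarrow> act (g [^] i) ` V1 \<inter> V1 = {}"
    using displacing_neighbourhood [of "{1..4::nat}" "\<lambda>i. g [^] i" p "topspace X"] gi g pt by auto
  obtain V where V: "openin X V" "p \<in> V" "V \<subseteq> V1" "act f ` V \<inter> V = {}"
    using displacing_neighbourhood1 [of f p V1] V1 p f by (auto simp: mv_def)
  obtain h where h: "h \<in> nontriv" "mv h \<subseteq> V" using moving' V by blast
  then have hc: "h \<in> carrier G" by (simp add: nontriv_def)
  have "f \<otimes> h \<noteq> h \<otimes> f"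
  proof
    assume "f \<otimes> h = h \<otimes> f"
    moreover obtain z where "z \<in> mv h" using h mv_nonempty by (auto simp: nontriv_def)
    ultimately have "z \<in> mv h" "act f z \<in> mv h" using mv_commute hc f by metis+
    then show False using h V by blast
  qed
  then obtain f1 f2 where ff: "f1 \<in> carrier G" "f2 \<in> carrier G" "f1 \<otimes> g = g \<otimes> f1" "f2 \<otimes> g = g \<otimes> f2"
    "commutator f1 (commutator f2 h) \<noteq> \<one>"
    "commutator f1 (commutator f2 h) \<otimes> g = g \<otimes> commutator f1 (commutator f2 h)"
    using ad hc unfolding alg_disjoint_def by blast
  define k where "k = commutator f1 (commutator f2 h)"
  have kc: "k \<in> carrier G" using ff hc by (simp add: k_def)
  have "mv k \<subseteq> mv (commutator f2 h) \<union> act f1 ` mv (commutator f2 h)"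
    using ff hc by (simp add: k_def mv_commutator)
  moreover have "mv (commutator f2 h) \<subseteq> V \<union> act f2 ` V" 
    using mv_commutator [of f2 h] ff hc h by blast
  ultimately have "mv k \<subseteq> (V \<union> act f2 ` V) \<union> act f1 ` (V \<union> act f2 ` V)"
    by (meson Un_mono image_mono order_trans)
  then have "mv k \<subseteq> V \<union> act f2 ` V \<union> act f1 ` V \<union> act f1 ` act f2 ` V"
    by (simp add: image_Un Un_assoc)
  moreover have "act f1 ` act f2 ` V = act (f1 \<otimes> f2) ` V"
    using V V1 ff by (force simp: image_image act_mult intro!: image_cong)
  moreover have "act \<one> ` V = id ` V"
    using V V1 act_one by (intro image_cong) auto
  ultimately have mvk: "mv k \<subseteq> (\<Union>e\<in>{\<one>, f1, f2, f1 \<otimes> f2}. act e ` V)"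
    by (simp add: ac_simps)
  \<comment> \<open>The four translating elements centralise \<open>g\<close>. Hence two orbit
    points in the same translate, pulled back, show a point of \<open>V\<close> returning to
    \<open>V\<close> under \<open>g^(j - i)\<close> with
    \<open>1 \<le> j - i \<le> 4\<close>.\<close>
  define E where "E = {\<one>, f1, f2, f1 \<otimes> f2}"
  have E: "e \<in> carrier G \<and> e \<otimes> g = g \<otimes> e" if "e \<in> E" for e
    using that ff g mult_commutes_with by (auto simp: E_def)
  have cE: "card E \<le> 4" using card_length [of "[\<one>, f1, f2, f1 \<otimes> f2]"] by (simp add: E_def)
  obtain x where x: "x \<in> mv k" using ff mv_nonempty kc k_def by auto
  have xt: "x \<in> topspace X" using x mv_sub by auto
  have "act (g [^] i) x \<in> mv k" for i :: nat
    using x mv_commute [OF kc _ pow_commutes_with [OF kc g]] ff g by (simp add: k_def)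
  then have "\<forall>i. \<exists>e\<in>E. act (g [^] (i::nat)) x \<in> act e ` V"
    using mvk unfolding E_def by blast
  then obtain e where e: "\<And>i. e i \<in> E" "\<And>i::nat. act (g [^] i) x \<in> act (e i) ` V" by metis
  have "\<not> inj_on e {0..4::nat}"
  proof
    assume "inj_on e {0..4::nat}"
    then have "card (e ` {0..4::nat}) = 5" by (simp add: card_image)
    moreover have "card (e ` {0..4::nat}) \<le> card E" using e by (intro card_mono) (auto simp: E_def)
    ultimately show False using cE by simp
  qed
  then obtain i' j' where "i' \<noteq> j'" "i' \<le> 4" "j' \<le> (4::nat)" "e i' = e j'" by (auto simp: inj_on_def)
  then obtain i j where ij: "i < j" "j \<le> (4::nat)" "e i = e j" by (metis linorder_neqE_nat)
  obtain u u' where u: "u \<in> V" "act (g [^] i) x = act (e i) u" "u' \<in> V" "act (g [^] j) x = act (e i) u'"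
    using e [of i] e [of j] ij by auto
  have ut: "u \<in> topspace X" "u' \<in> topspace X" using u V V1 by auto
  have ei: "e i \<in> carrier G" "e i \<otimes> g = g \<otimes> e i" using E e by auto
  have "act (e i) u' = act (g [^] (j - i)) (act (g [^] i) x)"
    using u ij g xt by (metis act_mult nat_pow_closed nat_pow_mult le_add_diff_inverse2 less_imp_le)
  also have "\<dots> = act (g [^] (j - i)) (act (e i) u)" by (simp add: u)
  also have "\<dots> = act (e i) (act (g [^] (j - i)) u)"
    using act_mult ut ei g pow_commutes_with by (metis nat_pow_closed)
  finally have "u' = act (g [^] (j - i)) u" using act_inj ei ut g by (metis act_in nat_pow_closed)
  then show False using V1(4) [of "j - i"] ij u V by fastforce
qed

text \<open>If \<open>g\<close> has period exactly \<open>n + 1\<close> on a neighbourhood, composing it with an element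
  supported in a tiny neighbourhood produces longer orbits.\<close>

lemma long_orbit:
  assumes "openin X U" "U \<noteq> {}"
  shows "\<exists>g\<in>carrier G. \<exists>x\<in>topspace X. mv g \<subseteq> U \<and> (\<forall>i\<in>{1..Suc n}. act (g [^] i) x \<noteq> x)"
proof (induction n)
  case 0
  obtain g where "g \<in> nontriv" "mv g \<subseteq> U" using moving' assms by blast
  moreover then obtain x where "x \<in> mv g" using mv_nonempty by (auto simp: nontriv_def)
  ultimately show ?case by (force simp: mv_def nontriv_def)
next
  case (Suc n)
  then obtain g x where g: "g \<in> carrier G" and x: "x \<in> topspace X" and gU: "mv g \<subseteq> U"
    and gx: "\<And>i. i \<in> {1..Suc n} \<Longrightarrow> act (g [^] i) x \<noteq> x" by blast
  have "act g x \<noteq> x" using gx [of 1] g by simp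
  then have xU: "x \<in> U" using gU x by (auto simp: mv_def)
  obtain W where W: "openin X W" "x \<in> W" "W \<subseteq> U" "\<And>i. i \<in> {1..Suc n} \<Longrightarrow> act (g [^] i) ` W \<inter> W = {}"
    using displacing_neighbourhood [of "{1..Suc n}" "\<lambda>i. g [^] i" x U] gx g xU assms by auto
  have Wt: "W \<subseteq> topspace X" using W(1) by (rule openin_subset)
  show ?case
  proof (cases "\<exists>y\<in>W. act (g [^] Suc (Suc n)) y \<noteq> y")
    case True
    then obtain y where y: "y \<in> W" "act (g [^] Suc (Suc n)) y \<noteq> y" by blast
    have "act (g [^] i) y \<noteq> y" if "i \<in> {1..Suc (Suc n)}" for i
    proof (cases "i = Suc (Suc n)")
      case False
      then have "act (g [^] i) ` W \<inter> W = {}" using that by (intro W(4)) auto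
      then show ?thesis using y by (metis IntI empty_iff image_eqI)
    qed (use y in simp)
    then show ?thesis using g gU y Wt by blast
  next
    case False
    obtain k where k: "k \<in> nontriv" "mv k \<subseteq> W" using moving' W by blast
    then have kc: "k \<in> carrier G" by (simp add: nontriv_def)
    obtain q where q: "q \<in> mv k" using k mv_nonempty by (auto simp: nontriv_def)
    have qt: "q \<in> topspace X" using q mv_sub by auto
    have kq: "act k q \<in> W" "act k q \<in> topspace X" "act k q \<noteq> q"
      using mv_invariant [OF kc q] k Wt q by (auto simp: mv_def)
    define g' where "g' = g \<otimes> k"
    have g'c: "g' \<in> carrier G" using g kc by (simp add: g'_def)
    \<comment> \<open>Up to exponent \<open>n + 1\<close> the power of \<open>g\<close> keeps
      \<open>W\<close> off itself, so after the first step the orbit of \<open>q\<close> escapes the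
      influence of \<open>k\<close>. After \<open>n + 2\<close> steps it is at
      \<open>g^(n+2) (k q) = k q\<close>, which differs from \<open>q\<close>.\<close>
    have pow: "act (g' [^] Suc i) q = act (g [^] Suc i) (act k q)" if "i \<le> Suc n" for i
      using that
    proof (induction i)
      case 0
      then show ?case using g kc qt by (simp add: g'_def act_mult)
    next
      case (Suc i)
      define z where "z = act (g [^] Suc i) (act k q)"
      have zt: "z \<in> topspace X" using kq g unfolding z_def by (meson act_in nat_pow_closed)
      have "act (g [^] Suc i) ` W \<inter> W = {}" by (rule W(4)) (use Suc.prems in simp)
      then have "z \<notin> W" using kq by (auto simp: z_def)
      then have kz: "act k z = z" using k zt by (auto simp: mv_def)
      have "act (g' [^] Suc (Suc i)) q = act (g' \<otimes> g' [^] Suc i) q"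
        using g'c by (metis nat_pow_Suc2)
      also have "\<dots> = act g' z"
        using g'c qt Suc by (subst act_mult) (auto simp: z_def)
      also have "\<dots> = act g z" using kz zt g kc by (simp add: g'_def act_mult)
      also have "\<dots> = act (g \<otimes> g [^] Suc i) (act k q)"
        using g kq by (subst act_mult) (auto simp: z_def)
      also have "\<dots> = act (g [^] Suc (Suc i)) (act k q)" using g by (metis nat_pow_Suc2)
      finally show ?case .
    qed
    have "act (g' [^] i) q \<noteq> q" if i: "i \<in> {1..Suc (Suc n)}" for i
    proof -
      obtain j where j: "i = Suc j" "j \<le> Suc n" using i by (cases i) auto
      then have e: "act (g' [^] i) q = act (g [^] i) (act k q)" using pow by blast
      show ?thesis
      proof (cases "i = Suc (Suc n)")
        case True
        then show ?thesis using e False kq by auto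
      next
        case ne: False
        then have "act (g [^] i) ` W \<inter> W = {}" using i by (intro W(4)) auto
        then show ?thesis using e kq q k by (metis IntI empty_iff image_eqI subsetD)
      qed
    qed
    moreover have "mv g' \<subseteq> mv g \<union> mv k" using mv_mult g kc by (simp add: g'_def)
    then have "mv g' \<subseteq> U" using gU k W by blast
    ultimately show ?thesis using g'c qt by blast
  qed
qed

text \<open>A support disjoint from \<open>mv f'\<close> is open and so misses its closure as well;
  this gives one direction. Conversely, near a point of \<open>mv f\<close> outside the closure
  there is a truly disjoint \<open>g\<close> whose support \<open>f\<close> displaces, so that
  \<open>f\<close> cannot commute with \<open>g^12\<close>.\<close>

lemma below_iff:
  assumes f: "f \<in> carrier G" and f': "f' \<in> carrier G"
  shows "below f f' \<longleftrightarrow> mv f \<subseteq> X closure_of mv f'"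
proof
  assume L: "mv f \<subseteq> X closure_of mv f'"
  show "below f f'"
    unfolding below_def
  proof (intro ballI impI)
    fix g assume g: "g \<in> carrier G" "alg_disjoint f' g"
    then have "mv f' \<inter> mv (g [^] (12::nat)) = {}" using disjoint_if_alg_disjoint f' by blast
    then have "X closure_of mv f' \<inter> mv (g [^] (12::nat)) = {}"
      using mv_open [of "g [^] (12::nat)"] g by (metis inf_commute openin_Int_closure_of_eq_empty nat_pow_closed)
    then show "f \<otimes> g [^] (12::nat) = g [^] (12::nat) \<otimes> f"
      using L f g by (intro commute_if_disjoint) auto
  qed
next
  assume R: "below f f'"
  show "mv f \<subseteq> X closure_of mv f'"
  proof (rule ccontr)
    assume "\<not> mv f \<subseteq> X closure_of mv f'"
    then obtain x where x: "x \<in> mv f" "x \<notin> X closure_of mv f'" by blast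
    let ?U = "topspace X - X closure_of mv f'"
    have "openin X ?U" "x \<in> ?U" using x mv_sub by auto
    then obtain V where V: "openin X V" "x \<in> V" "V \<subseteq> ?U" "act f ` V \<inter> V = {}"
      using displacing_neighbourhood1 [of f x ?U] f x by (auto simp: mv_def)
    \<comment> \<open>The value 11 makes the orbit long enough for \<open>g^12\<close> to move
      \<open>q\<close>; with \<open>g^12\<close> trivial the commutation test would say
      nothing.\<close>
    obtain g q where g: "g \<in> carrier G" "q \<in> topspace X" "mv g \<subseteq> V"
      "\<forall>i\<in>{1..Suc 11}. act (g [^] i) q \<noteq> q"
      using long_orbit [OF V(1), of 11] V(2) by blast
    then have g12: "act (g [^] (12::nat)) q \<noteq> q" by simp
    have "mv f' \<inter> mv g = {}" using g V closure_of_subset [OF mv_sub] by blast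
    then have comm: "f \<otimes> g [^] (12::nat) = g [^] (12::nat) \<otimes> f" 
      using R alg_disjoint_if_disjoint f' g by (auto simp: below_def)
    have "mv (g [^] (12::nat)) \<subseteq> mv g" using act_pow_fixed g by (auto simp: mv_def)
    then have "mv (g [^] (12::nat)) \<subseteq> V" using g by blast
    moreover have "q \<in> mv (g [^] (12::nat))" using g g12 by (simp add: mv_def)
    moreover have "act f q \<in> mv (g [^] (12::nat))" 
      using mv_commute [of "g [^] (12::nat)" f q] g f comm \<open>q \<in> mv _\<close> by simp
    ultimately show False using V by blast
  qed
qed

text \<open>The closures in \<open>below\<close> do no harm: the open set \<open>mv j\<close>, lying
  in the closure of \<open>mv k\<close>, meets \<open>mv k\<close>, and this open part, lying in the
  closure of \<open>mv g\<close>, meets \<open>mv g\<close>. Conversely (P2) puts a nontrivial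
  \<open>j\<close> into any overlap.\<close>

lemma separate_iff:
  assumes k: "k \<in> carrier G" and g: "g \<in> carrier G"
  shows "separate k g \<longleftrightarrow> mv k \<inter> mv g = {}"
proof
  assume "separate k g"
  show "mv k \<inter> mv g = {}"
  proof (rule ccontr)
    assume "mv k \<inter> mv g \<noteq> {}"
    moreover have "openin X (mv k \<inter> mv g)" using mv_open k g by blast
    ultimately obtain j where j: "j \<in> nontriv" "mv j \<subseteq> mv k \<inter> mv g" using moving' by blast
    then have "below j k \<and> below j g"
      using k g closure_of_subset [OF mv_sub, of k] closure_of_subset [OF mv_sub, of g] below_iff[of j]
      unfolding nontriv_def by blast
    then show False using j \<open>separate k g\<close> by (auto simp: separate_def)
  qed
next
  assume dj: "mv k \<inter> mv g = {}"
  show "separate k g"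
    unfolding separate_def
  proof (clarify)
    fix j assume j: "j \<in> nontriv" "below j k" "below j g"
    then have jc: "j \<in> carrier G" by (simp add: nontriv_def)
    have "mv j \<inter> X closure_of mv k = {} \<longleftrightarrow> mv j \<inter> mv k = {}"
      using openin_Int_closure_of_eq_empty mv_open jc by blast
    then have ne: "mv j \<inter> mv k \<noteq> {}"
      using j jc k below_iff [of j k] mv_nonempty [of j] by (auto simp: nontriv_def)
    have "(mv j \<inter> mv k) \<inter> X closure_of mv g = {} \<longleftrightarrow> (mv j \<inter> mv k) \<inter> mv g = {}"
      by (intro openin_Int_closure_of_eq_empty openin_Int mv_open jc k)
    moreover have "mv j \<subseteq> X closure_of mv g" using below_iff [of j g] j jc g by simp
    ultimately show False using ne dj by blast
  qed
qed

end

section \<open>Recovering points\<close>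

lemma strict_mono_choice:
  assumes "\<And>k::nat. infinite {n::nat. Q k n}"
  obtains \<nu> where "strict_mono \<nu>" "\<And>k. Q k (\<nu> k)"
proof -
  have inf: "\<exists>m>n. Q k m" for k n
    using assms [of k] unfolding infinite_nat_iff_unbounded by blast
  obtain \<nu> where "\<And>k. Q k (\<nu> k) \<and> \<nu> k < \<nu> (Suc k)"
    using dependent_nat_choice [of "\<lambda>k n. Q k n" "\<lambda>k n m. n < m"] inf by metis
  moreover then have "strict_mono \<nu>" by (simp add: strict_mono_Suc_iff)
  ultimately show ?thesis using that by blast
qed

locale K1_action = moving_action +
  assumes regular: "regular_space X" and first_countable: "first_countable X"
    and dense_orbits: "\<lbrakk>x \<in> topspace X; y \<in> topspace X; x \<noteq> y\<rbrakk> \<Longrightarrow>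
      somewhere_dense X {g x |g. g \<in> act ` carrier G \<and> locally_identity X g y}"
    and flexible_cover: "topspace X \<subseteq> \<Union>{U. flexible X (act ` carrier G) U}"
begin

definition tends :: "(nat \<Rightarrow> 'a) \<Rightarrow> 'c \<Rightarrow> bool" where
  "tends F x \<longleftrightarrow> x \<in> topspace X \<and>
     (\<forall>N. openin X N \<and> x \<in> N \<longrightarrow> (\<forall>\<^sub>F n in sequentially. mv (F n) \<subseteq> N))"

lemma nontriv_carrier: "g \<in> nontriv \<Longrightarrow> g \<in> carrier G"
  by (simp add: nontriv_def)

lemma nontriv_mv: "g \<in> nontriv \<Longrightarrow> mv g \<noteq> {}"
  by (simp add: nontriv_def mv_nonempty)

lemma nontriv_iff: "g \<in> carrier G \<Longrightarrow> g \<in> nontriv \<longleftrightarrow> mv g \<noteq> {}"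
  using mv_nonempty mv_one by (auto simp: nontriv_def)

lemma below_if_subset: "\<lbrakk>f \<in> carrier G; f' \<in> carrier G; mv f \<subseteq> mv f'\<rbrakk> \<Longrightarrow> below f f'"
  using below_iff closure_of_subset [OF mv_sub] by blast

text \<open>\<open>below w v\<close> places \<open>mv w\<close> only in the closure of
  \<open>mv v\<close>; the overlap is the open part on which topological choices are made.\<close>

lemma below_meets:
  assumes "w \<in> nontriv" "v \<in> nontriv" "below w v"
  shows "openin X (mv w \<inter> mv v)" "mv w \<inter> mv v \<noteq> {}"
proof -
  show "openin X (mv w \<inter> mv v)" using assms by (simp add: mv_open nontriv_carrier openin_Int)
  have "mv w \<inter> X closure_of mv v \<noteq> {}"
    using assms nontriv_mv below_iff nontriv_carrier by blast
  then show "mv w \<inter> mv v \<noteq> {}"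
    using assms openin_Int_closure_of_eq_empty mv_open nontriv_carrier by metis
qed

lemma visits_iff:
  assumes "g \<in> carrier G" "range F \<subseteq> carrier G" "w \<in> carrier G"
  shows "visits F g w \<longleftrightarrow> infinite {n. act g ` mv (F n) \<inter> mv w \<noteq> {}}"
proof -
  have "F n \<in> carrier G" for n using assms by auto
  then show ?thesis using assms by (simp add: visits_def separate_iff mv_conjugate)
qed

lemma neighbourhood_sequence:
  assumes "x \<in> topspace X"
  obtains N where "\<And>n::nat. openin X (N n)" "\<And>n. x \<in> N n" "\<And>m n. m \<le> n \<Longrightarrow> N n \<subseteq> N m"
    "\<And>U. \<lbrakk>openin X U; x \<in> U\<rbrakk> \<Longrightarrow> \<exists>n. N n \<subseteq> U"
proof -
  obtain B where B: "countable B" "\<And>V. V \<in> B \<Longrightarrow> openin X V"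
    "\<And>U. openin X U \<and> x \<in> U \<longrightarrow> (\<exists>V\<in>B. x \<in> V \<and> V \<subseteq> U)"
    using first_countable assms unfolding first_countable_def by metis
  define C where "C = insert (topspace X) {V \<in> B. x \<in> V}"
  have C: "countable C" "C \<noteq> {}" using B by (auto simp: C_def)
  define N where "N n = (\<Inter>i\<le>n. from_nat_into C i)" for n
  have fC: "from_nat_into C i \<in> C" for i using C(2) by (rule from_nat_into)
  have CV: "openin X V \<and> x \<in> V" if "V \<in> C" for V using that B assms by (auto simp: C_def)
  show ?thesis
  proof
    show "openin X (N n)" for n
      unfolding N_def by (rule openin_INT2) (use CV fC in auto)
    show "x \<in> N n" for n unfolding N_def using CV fC by auto
    show "N n \<subseteq> N m" if "m \<le> n" for m n unfolding N_def using that by auto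
    show "\<exists>n. N n \<subseteq> U" if "openin X U" "x \<in> U" for U
    proof -
      obtain V where "V \<in> B" "x \<in> V" and VU: "V \<subseteq> U"
        using B(3) [of U] \<open>openin X U\<close> \<open>x \<in> U\<close> by metis
      then have V: "V \<in> C" by (simp add: C_def)
      then obtain n where "V = from_nat_into C n" using C from_nat_into_surj by metis
      then have "N n \<subseteq> V" by (auto simp: N_def)
      then show ?thesis using VU by blast
    qed
  qed
qed

lemma closed_neighbourhood:
  assumes "openin X N" "x \<in> N"
  obtains M where "openin X M" "x \<in> M" "X closure_of M \<subseteq> N"
proof -
  obtain U V where "openin X U" "closedin X V" "x \<in> U" "U \<subseteq> V" "V \<subseteq> N"
    using regular assms unfolding neighbourhood_base_of_closedin [symmetric] neighbourhood_base_of
    by meson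
  then show ?thesis using that closure_of_minimal by (metis order_trans)
qed

text \<open>(P2) excludes isolated points: a moved point and its image both lie in the support, so
  the support contains a point other than \<open>x\<close>.\<close>

lemma avoiding:
  assumes U: "openin X U" "U \<noteq> {}" and x: "x \<in> topspace X"
  obtains w where "w \<in> nontriv" "mv w \<subseteq> U" "x \<notin> X closure_of mv w"
proof -
  obtain g where g: "g \<in> nontriv" "mv g \<subseteq> U" using moving' U by blast
  then obtain y where y: "y \<in> mv g" using nontriv_mv by blast
  then have "act g y \<in> mv g" "act g y \<noteq> y" using g mv_invariant nontriv_carrier by (auto simp: mv_def)
  then obtain z where z: "z \<in> mv g" "z \<noteq> x" using y by metis
  then have "z \<in> topspace X" using mv_sub by auto
  then obtain A B where AB: "openin X A" "openin X B" "z \<in> A" "x \<in> B" "disjnt A B"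
    using hausdorff z x unfolding Hausdorff_space_def by metis
  obtain w where w: "w \<in> nontriv" "mv w \<subseteq> U \<inter> A"
    using moving' [of "U \<inter> A"] U AB z g by blast
  then have "x \<notin> X closure_of mv w" using AB unfolding in_closure_of disjnt_def by blast
  then show ?thesis using that w by blast
qed

lemma exists_tends:
  assumes "x \<in> topspace X"
  obtains F where "range F \<subseteq> nontriv" "tends F x"
proof -
  obtain N where N: "\<And>n::nat. openin X (N n)" "\<And>n. x \<in> N n" "\<And>m n. m \<le> n \<Longrightarrow> N n \<subseteq> N m"
    "\<And>U. \<lbrakk>openin X U; x \<in> U\<rbrakk> \<Longrightarrow> \<exists>n. N n \<subseteq> U"
    using neighbourhood_sequence assms by blast
  have "\<exists>g. g \<in> nontriv \<and> mv g \<subseteq> N n" for n using moving' N(1,2) by (metis empty_iff)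
  then obtain F where F: "\<And>n. F n \<in> nontriv \<and> mv (F n) \<subseteq> N n" by metis
  have "\<forall>\<^sub>F n in sequentially. mv (F n) \<subseteq> U" if "openin X U" "x \<in> U" for U
    using N(4) [OF that] N(3) F unfolding eventually_sequentially by (meson order_trans)
  then have "tends F x" using assms by (auto simp: tends_def)
  then show ?thesis using that F by blast
qed

text \<open>Regularity pays for the closure in \<open>below\<close>: supports inside
  \<open>M\<close> have closures inside \<open>N\<close>.\<close>

lemma tends_shrinking:
  assumes "tends F x" "range F \<subseteq> carrier G" "shrinking F' F"
  shows "tends F' x"
  unfolding tends_def
proof (intro conjI allI impI)
  show "x \<in> topspace X" using assms by (simp add: tends_def)
  fix N assume "openin X N \<and> x \<in> N"
  then obtain M where M: "openin X M" "x \<in> M" "X closure_of M \<subseteq> N" using closed_neighbourhood by blast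
  obtain r where r: "strict_mono r" "\<And>n. below (F' n) (F (r n))" "range F' \<subseteq> nontriv"
    using assms by (auto simp: shrinking_def)
  have "\<forall>\<^sub>F n in sequentially. mv (F n) \<subseteq> M" using assms M by (simp add: tends_def)
  then have "\<forall>\<^sub>F n in sequentially. mv (F (r n)) \<subseteq> M" using r eventually_subseq by blast
  then show "\<forall>\<^sub>F n in sequentially. mv (F' n) \<subseteq> N"
  proof (rule eventually_mono)
    fix n assume "mv (F (r n)) \<subseteq> M"
    then have "X closure_of mv (F (r n)) \<subseteq> N" using M closure_of_mono by blast
    moreover have "mv (F' n) \<subseteq> X closure_of mv (F (r n))"
      using r assms below_iff nontriv_carrier by blast
    ultimately show "mv (F' n) \<subseteq> N" by blast
  qed
qed

text \<open>Choose the target \<open>w\<close> with \<open>x\<close> outside the closure of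
  \<open>mv w\<close>. Visiting \<open>w\<close> forces \<open>act g x\<close> into that closure. If
  \<open>g\<close> moved \<open>x\<close>, the supports would eventually lie in the open set
  \<open>mv g\<close>, hence below \<open>g\<close>; so \<open>act g x = x\<close>, a
  contradiction.\<close>

lemma not_divisible_if_tends:
  assumes F: "tends F x" "range F \<subseteq> nontriv"
  shows "\<not> divisible F"
proof
  assume "divisible F"
  then obtain v where v: "v \<in> nontriv" and dv: "\<And>w. \<lbrakk>w \<in> nontriv; below w v\<rbrakk> \<Longrightarrow>
     \<exists>g\<in>carrier G. visits F g w \<and> infinite {n. \<not> below (F n) g}"
    unfolding divisible_def by blast
  have Fc: "range F \<subseteq> carrier G" using F nontriv_carrier by blast
  have xt: "x \<in> topspace X" using F by (simp add: tends_def)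
  obtain w where w: "w \<in> nontriv" "mv w \<subseteq> mv v" "x \<notin> X closure_of mv w"
    using avoiding [of "mv v" x] v nontriv_mv nontriv_carrier mv_open xt by metis
  then have "below w v" using v nontriv_carrier below_if_subset by blast
  then obtain g where g: "g \<in> carrier G" "visits F g w" "infinite {n. \<not> below (F n) g}"
    using dv w by blast
  have "act g x \<in> X closure_of mv w"
  proof (rule ccontr)
    assume n: "act g x \<notin> X closure_of mv w"
    define N where "N = {z \<in> topspace X. act g z \<in> topspace X - X closure_of mv w}"
    have "openin X N" unfolding N_def using g by (intro act_vimage_open) auto
    moreover have "x \<in> N" using n g xt by (simp add: N_def)
    ultimately have "\<forall>\<^sub>F n in sequentially. mv (F n) \<subseteq> N" using F by (simp add: tends_def)
    then have "\<forall>\<^sub>F n in sequentially. act g ` mv (F n) \<inter> mv w = {}"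
      by (rule eventually_mono) (use closure_of_subset [OF mv_sub, of w] in \<open>auto simp: N_def\<close>)
    then show False using g visits_iff Fc nontriv_carrier w
      unfolding eventually_cofinite [symmetric] cofinite_eq_sequentially [symmetric]
      by (simp add: eventually_cofinite)
  qed
  moreover have "act g x = x"
  proof (rule ccontr)
    assume "act g x \<noteq> x"
    then have "x \<in> mv g" using xt by (simp add: mv_def)
    then have "\<forall>\<^sub>F n in sequentially. mv (F n) \<subseteq> mv g" using F g mv_open by (simp add: tends_def)
    then have "\<forall>\<^sub>F n in sequentially. below (F n) g"
      by (rule eventually_mono) (use Fc g below_if_subset in auto)
    then show False using g by (simp add: eventually_cofinite flip: cofinite_eq_sequentially)
  qed
  ultimately show False using w by simp
qed

lemma infinite_if_eventually:
  assumes "\<forall>\<^sub>F n in sequentially. P (n::nat)" shows "infinite {n. P n}"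
  using assms by (metis (no_types, lifting) INFM_iff_infinite eventually_frequently frequently_cofinite cofinite_eq_sequentially trivial_limit_sequentially)

lemma eventually_hits:
  assumes F: "tends F x" "range F \<subseteq> nontriv" and g: "g \<in> carrier G" and w: "w \<in> carrier G" "act g x \<in> mv w"
  shows "\<forall>\<^sub>F n in sequentially. act g ` mv (F n) \<inter> mv w \<noteq> {}"
proof -
  define N where "N = {z \<in> topspace X. act g z \<in> mv w}"
  have "openin X N" unfolding N_def using g w mv_open by (intro act_vimage_open) auto
  moreover have "x \<in> N" using w F by (simp add: N_def tends_def)
  ultimately have "\<forall>\<^sub>F n in sequentially. mv (F n) \<subseteq> N" using F by (simp add: tends_def)
  then show ?thesis
  proof (rule eventually_mono)
    fix n assume "mv (F n) \<subseteq> N"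
    moreover have "mv (F n) \<noteq> {}" using F(2) nontriv_mv by blast
    ultimately show "act g ` mv (F n) \<inter> mv w \<noteq> {}" by (auto simp: N_def)
  qed
qed

text \<open>(P3) prepared for use in the group: \<open>v\<close> is supported where the orbit set is
  dense, so the support of every \<open>w\<close> below \<open>v\<close> still contains an orbit
  point.\<close>

lemma prescribed_moves:
  assumes "x \<in> topspace X" "y \<in> topspace X" "x \<noteq> y"
  obtains v where "v \<in> nontriv" "\<And>w. \<lbrakk>w \<in> nontriv; below w v\<rbrakk> \<Longrightarrow>
    \<exists>g\<in>carrier G. act g x \<in> mv w \<and> locally_identity X (act g) y"
proof -
  define S where "S = {g x |g. g \<in> act ` carrier G \<and> locally_identity X g y}"
  have "X interior_of (X closure_of S) \<noteq> {}"
    using dense_orbits [OF assms] by (simp add: somewhere_dense_def S_def)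
  then obtain v where v: "v \<in> nontriv" "mv v \<subseteq> X interior_of (X closure_of S)"
    using moving' [of "X interior_of (X closure_of S)"] by auto
  have "\<exists>g\<in>carrier G. act g x \<in> mv w \<and> locally_identity X (act g) y"
    if w: "w \<in> nontriv" "below w v" for w
  proof -
    have "mv w \<inter> mv v \<inter> X closure_of S \<noteq> {}"
      using below_meets(2) [OF w(1) v(1) w(2)] v interior_of_subset by fast
    then have "mv w \<inter> mv v \<inter> S \<noteq> {}"
      using openin_Int_closure_of_eq_empty below_meets(1) [OF w(1) v(1) w(2)] by metis
    then show ?thesis by (auto simp: S_def)
  qed
  then show ?thesis using that v(1) by blast
qed

lemma movable_if_tends:
  assumes F: "tends F x" "range F \<subseteq> nontriv"
  shows "movable F"
proof -
  have Fc: "range F \<subseteq> carrier G" using F nontriv_carrier by blast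
  have xt: "x \<in> topspace X" using F by (simp add: tends_def)
  \<comment> \<open>(P3) concerns two points; the support of an element avoiding \<open>x\<close>
    supplies the second.\<close>
  obtain z where z: "z \<in> nontriv" "mv z \<subseteq> topspace X" "x \<notin> X closure_of mv z"
    using avoiding [of "topspace X" x] xt by blast
  then obtain y where y: "y \<in> mv z" using nontriv_mv by blast
  then have "y \<noteq> x" "y \<in> topspace X" using z closure_of_subset [OF mv_sub, of z] by auto
  then obtain v where v: "v \<in> nontriv" "\<And>w. \<lbrakk>w \<in> nontriv; below w v\<rbrakk> \<Longrightarrow>
    \<exists>g\<in>carrier G. act g x \<in> mv w \<and> locally_identity X (act g) y"
    using prescribed_moves [OF xt] by metis
  have "\<exists>g\<in>carrier G. visits F g w" if w: "w \<in> nontriv" "below w v" for w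
  proof -
    obtain g where g: "g \<in> carrier G" "act g x \<in> mv w" using v(2) [OF w] by blast
    have "visits F g w"
      using visits_iff [OF g(1) Fc] infinite_if_eventually [OF eventually_hits [OF F g(1) _ g(2)]]
        nontriv_carrier [OF w(1)] by simp
    then show ?thesis using g(1) by blast
  qed
  then show ?thesis using v(1) unfolding movable_def by blast
qed

lemma good_if_tends:
  assumes F: "tends F x" "range F \<subseteq> nontriv"
  shows "good F"
proof -
  have Fc: "range F \<subseteq> carrier G" using F nontriv_carrier by blast
  have "\<not> divisible F'" if "shrinking F' F" for F'
    using tends_shrinking [OF F(1) Fc that] that not_divisible_if_tends by (simp add: shrinking_def)
  then show ?thesis using movable_if_tends F by (simp add: good_def)
qed

lemma locally_identity_not_below:
  assumes "f \<in> carrier G" "g \<in> carrier G" "a \<in> mv f" "locally_identity X (act g) a"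
  shows "\<not> below f g"
proof -
  obtain S where "openin X S" "a \<in> S" "\<forall>s\<in>S. act g s = s"
    using assms by (auto simp: locally_identity_def)
  then have "a \<notin> X closure_of mv g" unfolding in_closure_of by (auto simp: mv_def)
  then show ?thesis using assms below_iff by auto
qed

text \<open>One accumulating point in each support is enough: elements supported near these points,
  inside the given supports, converge even if the original supports stay large.\<close>

lemma shrinking_converges:
  assumes x: "x \<in> topspace X" and F: "range F \<subseteq> nontriv" and r: "strict_mono (r :: nat \<Rightarrow> nat)"
    and b: "\<And>n. b n \<in> mv (F (r n))"
    and acc: "\<And>N. \<lbrakk>openin X N; x \<in> N\<rbrakk> \<Longrightarrow> infinite {n. b n \<in> N}"
  obtains F' where "shrinking F' F" "tends F' x"
proof -
  obtain N where N: "\<And>n::nat. openin X (N n)" "\<And>n. x \<in> N n" "\<And>m n. m \<le> n \<Longrightarrow> N n \<subseteq> N m"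
    "\<And>U. \<lbrakk>openin X U; x \<in> U\<rbrakk> \<Longrightarrow> \<exists>n. N n \<subseteq> U"
    using neighbourhood_sequence x by blast
  obtain s where sm: "strict_mono s" and bs: "\<And>n. b (s n) \<in> N n"
    using strict_mono_choice [of "\<lambda>n m. b m \<in> N n"] acc [OF N(1,2)] by blast
  have "\<exists>f. f \<in> nontriv \<and> mv f \<subseteq> mv (F (r (s n))) \<inter> N n" for n
  proof -
    have "openin X (mv (F (r (s n))) \<inter> N n)" using F mv_open nontriv_carrier N by blast
    then show ?thesis using moving' bs b by (metis IntI empty_iff)
  qed
  then obtain F' where F': "\<And>n. F' n \<in> nontriv \<and> mv (F' n) \<subseteq> mv (F (r (s n))) \<inter> N n" by metis
  have "below (F' n) (F ((r \<circ> s) n))" for n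
    using F' [of n] F nontriv_carrier by (intro below_if_subset) auto
  then have "shrinking F' F"
    using F' strict_mono_o [OF r sm] unfolding shrinking_def by blast
  moreover have "\<forall>\<^sub>F n in sequentially. mv (F' n) \<subseteq> U" if "openin X U" "x \<in> U" for U
    using N(4) [OF that] N(3) F' unfolding eventually_sequentially by (meson order_trans Int_subset_iff)
  then have "tends F' x" using x by (auto simp: tends_def)
  ultimately show ?thesis using that by blast
qed

text \<open>Movability brings infinitely many supports into one flexible set by a single
  \<open>g\<close>, where points \<open>a n\<close> of the dense set \<open>D\<close> are picked in
  them. If these accumulate, shrinking to the limit and going back along \<open>g\<close> gives
  convergence. Otherwise they form an infinite closed discrete set, whose dissection makes a
  subsequence of \<open>F\<close> divisible, against \<open>good F\<close>.\<close>

lemma good_converges: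
  assumes good: "good F" and F: "range F \<subseteq> nontriv"
  obtains F' x where "shrinking F' F" "tends F' x"
proof -
  have Fc: "F n \<in> carrier G" for n using F nontriv_carrier by auto
  obtain v where v: "v \<in> nontriv" "\<And>w. \<lbrakk>w \<in> nontriv; below w v\<rbrakk> \<Longrightarrow> \<exists>g\<in>carrier G. visits F g w"
    using good unfolding good_def movable_def by blast
  obtain p where p: "p \<in> mv v" using v nontriv_mv by blast
  then obtain U where U: "flexible X (act ` carrier G) U" "p \<in> U"
    using flexible_cover mv_sub by blast
  obtain D where D: "openin X U" "D \<subseteq> U" "U \<subseteq> X closure_of D"
    "\<And>A. \<lbrakk>A \<subseteq> D; infinite A; X derived_set_of A = {}\<rbrakk> \<Longrightarrow> dissectable X (act ` carrier G) A"
    using U unfolding flexible_def by metis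
  obtain w where w: "w \<in> nontriv" "mv w \<subseteq> U \<inter> mv v"
    using moving' [of "U \<inter> mv v"] D v mv_open nontriv_carrier p U by blast
  then have "below w v" using v below_if_subset nontriv_carrier by blast
  then obtain g where g: "g \<in> carrier G" "visits F g w" using v w by blast
  define I where "I = {n. act g ` mv (F n) \<inter> mv w \<noteq> {}}"
  have I: "infinite I" using g visits_iff [OF g(1) _ nontriv_carrier [OF w(1)]] Fc by (auto simp: I_def)
  define r where "r = enumerate I"
  have r: "strict_mono r" "\<And>n. r n \<in> I"
    using I strict_mono_enumerate enumerate_in_set by (auto simp: r_def)
  have "\<exists>a. a \<in> D \<and> a \<in> act g ` mv (F (r n))" for n
  proof -
    let ?O = "act g ` mv (F (r n)) \<inter> mv w"
    have "openin X ?O"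
      by (intro openin_Int act_image_open mv_open nontriv_carrier w g(1) Fc)
    moreover have "?O \<noteq> {}" "?O \<subseteq> X closure_of D" using r(2) [of n] w(2) D(3) by (auto simp: I_def)
    then have "?O \<inter> X closure_of D \<noteq> {}" by blast
    ultimately have "?O \<inter> D \<noteq> {}" using openin_Int_closure_of_eq_empty by metis
    then show ?thesis by blast
  qed
  then obtain a where a: "\<And>n. a n \<in> D" "\<And>n. a n \<in> act g ` mv (F (r n))" by metis
  define h where "h = inv g"
  have h: "h \<in> carrier G" using g by (simp add: h_def)
  have at: "a n \<in> topspace X" for n using a D openin_subset by blast
  define b where "b n = act h (a n)" for n
  have b: "b n \<in> mv (F (r n))" for n
    using a(2) [of n] g mv_sub unfolding b_def h_def by (metis act_inv(1) imageE subsetD)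
  have bt: "b n \<in> topspace X" for n using b mv_sub by blast
  have gb: "act g (b n) = a n" for n using at g by (simp add: b_def h_def)
  show ?thesis
  \<comment> \<open>Accumulation is counted by indices and not by values, so a value repeated
    infinitely often is a limit too; in the other case the range of \<open>a\<close> is therefore
    infinite.\<close>
  proof (cases "\<exists>y\<in>topspace X. \<forall>N. openin X N \<and> y \<in> N \<longrightarrow> infinite {n. a n \<in> N}")
    case True
    then obtain y where y: "y \<in> topspace X" "\<And>N. \<lbrakk>openin X N; y \<in> N\<rbrakk> \<Longrightarrow> infinite {n. a n \<in> N}" by blast
    have "infinite {n. b n \<in> N}" if N: "openin X N" "act h y \<in> N" for N
    proof -
      have "infinite {n. a n \<in> {z \<in> topspace X. act h z \<in> N}}"
        by (intro y act_vimage_open h N) (use N y in auto)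
      then show ?thesis by (rule contrapos_nn) (erule rev_finite_subset, auto simp: b_def)
    qed
    then show ?thesis using shrinking_converges [OF _ F r(1), of "act h y" b] b that y h by (metis act_in)
  next
    case False
    have fin: "finite {n. a n = y}" for y
    proof (cases "y \<in> topspace X")
      case True
      then obtain N where "openin X N" "y \<in> N" "finite {n. a n \<in> N}" using False by blast
      then show ?thesis by (elim rev_finite_subset) auto
    next
      case ne: False
      then have "{n. a n = y} = {}" using at by auto
      then show ?thesis by simp
    qed
    define A where "A = range a"
    have finf: "infinite {n. a n \<in> B}" if "infinite B" "B \<subseteq> A" for B
    proof
      assume "finite {n. a n \<in> B}"
      then have "finite (a ` {n. a n \<in> B})" by simp
      moreover have "B \<subseteq> a ` {n. a n \<in> B}" using that by (auto simp: A_def)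
      ultimately show False using that finite_subset by blast
    qed
    have "infinite A"
    proof
      assume "finite A"
      then have "finite (\<Union>y\<in>A. {n. a n = y})" using fin by auto
      moreover have "(\<Union>y\<in>A. {n. a n = y}) = UNIV" by (auto simp: A_def)
      ultimately show False by simp
    qed
    moreover have "y \<notin> X derived_set_of A" for y
    proof
      assume y: "y \<in> X derived_set_of A"
      then have yt: "y \<in> topspace X" by (simp add: in_derived_set_of)
      obtain N where N: "openin X N" "y \<in> N" "finite {n. a n \<in> N}" using False yt by blast
      have t1: "t1_space X" using hausdorff by (rule Hausdorff_imp_t1_space)
      \<comment> \<open>Only finitely many values lie in \<open>N\<close>; by T1 those other than
        \<open>y\<close> can be removed from the neighbourhood.\<close>
      define C where "C = a ` {n. a n \<in> N} - {y}"
      have "finite C" "C \<subseteq> topspace X" using N at by (auto simp: C_def)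
      then have "closedin X C" using t1 t1_space_closedin_finite by blast
      then have "openin X (N - C)" using N by blast
      moreover have "y \<in> N - C" using N by (auto simp: C_def)
      ultimately obtain z where "z \<noteq> y" "z \<in> A" "z \<in> N - C"
        using y unfolding in_derived_set_of by blast
      then show False by (auto simp: A_def C_def)
    qed
    ultimately obtain V where V: "openin X V" "V \<noteq> {}" "dissects X (act ` carrier G) V A"
      using D(4) [of A] a unfolding dissectable_def A_def by blast
    \<comment> \<open>The dissection concerns the transported points \<open>a n\<close>,
      divisibility the original supports; \<open>V'\<close> and the conjugate \<open>g'\<close>
      below carry the dissection back along \<open>g\<close>.\<close>
    define V' where "V' = {z \<in> topspace X. act g z \<in> V}"
    have V'o: "openin X V'" unfolding V'_def using g V act_vimage_open by blast
    obtain q where q: "q \<in> V" using V by blast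
    then have "q \<in> topspace X" using V openin_subset by blast
    then have "act h q \<in> V'" using q g by (auto simp: V'_def h_def)
    then obtain v' where v': "v' \<in> nontriv" "mv v' \<subseteq> V'" using moving' V'o by blast
    have "\<exists>g'\<in>carrier G. visits (F \<circ> r) g' u \<and> infinite {n. \<not> below ((F \<circ> r) n) g'}"
      if u: "u \<in> nontriv" "below u v'" for u
    proof -
      note ou = below_meets [OF u(1) v'(1) u(2)]
      define W where "W = act g ` (mv u \<inter> mv v')"
      have "openin X W" unfolding W_def using act_image_open g ou by blast
      moreover have "W \<noteq> {}" "W \<subseteq> V" using ou v' by (auto simp: W_def V'_def)
      ultimately obtain k where k: "k \<in> carrier G" "infinite {c \<in> A. act k c \<in> W}"
        "infinite {c \<in> A. locally_identity X (act k) c}"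
        using V(3) unfolding dissects_def by blast
      define g' where "g' = h \<otimes> k \<otimes> g"
      have g': "g' \<in> carrier G" using h k g by (simp add: g'_def)
      have g'z: "act g' z = act h (act k (act g z))" if "z \<in> topspace X" for z
        using that h k g by (simp add: g'_def act_mult)
      have "infinite {n. a n \<in> {c \<in> A. act k c \<in> W}}" by (rule finf) (use k in auto)
      moreover have "{n. a n \<in> {c \<in> A. act k c \<in> W}} \<subseteq> {n. act g' ` mv ((F \<circ> r) n) \<inter> mv u \<noteq> {}}"
      proof clarsimp
        fix n assume n: "act k (a n) \<in> W" "act g' ` mv (F (r n)) \<inter> mv u = {}"
        then obtain t where t: "t \<in> mv u" "act k (a n) = act g t" by (auto simp: W_def)
        then have "act g' (b n) = t" using g'z bt gb g mv_sub by (simp add: h_def subset_iff mv_def)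
        then show False using t n b by blast
      qed
      ultimately have "infinite {n. act g' ` mv ((F \<circ> r) n) \<inter> mv u \<noteq> {}}" using finite_subset by blast
      moreover have "range (F \<circ> r) \<subseteq> carrier G" using Fc by auto
      ultimately have "visits (F \<circ> r) g' u" using visits_iff g' u(1) nontriv_carrier by simp
      moreover have "infinite {n. a n \<in> {c \<in> A. locally_identity X (act k) c}}"
        by (rule finf) (use k in auto)
      moreover have "{n. a n \<in> {c \<in> A. locally_identity X (act k) c}} \<subseteq> {n. \<not> below ((F \<circ> r) n) g'}"
      proof (intro subsetI CollectI)
        fix n assume "n \<in> {n. a n \<in> {c \<in> A. locally_identity X (act k) c}}"
        then obtain S where S: "openin X S" "a n \<in> S" "\<And>s. s \<in> S \<Longrightarrow> act k s = s"
          unfolding locally_identity_def by auto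
        define S' where "S' = {z \<in> topspace X. act g z \<in> S}"
        have "openin X S'" unfolding S'_def using g S act_vimage_open by blast
        moreover have "b n \<in> S'" using S bt gb by (simp add: S'_def)
        moreover have "act g' s = s" if "s \<in> S'" for s
          using that S g'z g by (auto simp: S'_def h_def)
        ultimately have "locally_identity X (act g') (b n)" unfolding locally_identity_def by blast
        then show "\<not> below ((F \<circ> r) n) g'"
          using locally_identity_not_below [OF Fc g' b] by simp
      qed
      ultimately show ?thesis using g' finite_subset by blast
    qed
    then have "divisible (F \<circ> r)" using v' unfolding divisible_def by blast
    moreover have "shrinking (F \<circ> r) F"
      using F r Fc below_if_subset unfolding shrinking_def by (auto intro!: exI [of _ r])
    ultimately show ?thesis using good by (auto simp: good_def)
  qed
qed

text \<open>(P3) provides one element that sends \<open>y'\<close> into the target and is the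
  identity near \<open>y\<close>: the odd members visit \<open>w\<close>, while the even ones are
  not below \<open>g\<close>.\<close>

lemma divisible_if_two_limits:
  assumes "tends F y" "tends F' y'" "y \<noteq> y'" "range F \<subseteq> nontriv" "range F' \<subseteq> nontriv"
    and H: "\<And>n. H (2 * n) = F n" "\<And>n. H (Suc (2 * n)) = F' n"
  shows "divisible H"
proof -
  have Hn: "H n \<in> nontriv" for n
    by (cases "even n") (use assms in \<open>auto elim!: evenE oddE\<close>)
  have yt: "y \<in> topspace X" "y' \<in> topspace X" using assms by (auto simp: tends_def)
  obtain v where v: "v \<in> nontriv" "\<And>w. \<lbrakk>w \<in> nontriv; below w v\<rbrakk> \<Longrightarrow>
    \<exists>g\<in>carrier G. act g y' \<in> mv w \<and> locally_identity X (act g) y"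
    using prescribed_moves [of y' y] yt assms(3) by metis
  have "\<exists>g\<in>carrier G. visits H g w \<and> infinite {n. \<not> below (H n) g}" if w: "w \<in> nontriv" "below w v" for w
  proof -
    obtain g where g: "g \<in> carrier G" "act g y' \<in> mv w" "locally_identity X (act g) y"
      using v(2) [OF w] by blast
    have "\<forall>\<^sub>F n in sequentially. act g ` mv (F' n) \<inter> mv w \<noteq> {}"
      by (rule eventually_hits [OF assms(2,5) g(1) nontriv_carrier [OF w(1)] g(2)])
    then have "infinite ((\<lambda>n. Suc (2 * n)) ` {n. act g ` mv (F' n) \<inter> mv w \<noteq> {}})"
      by (subst finite_image_iff) (auto simp: inj_on_def infinite_if_eventually)
    then have "infinite {n. act g ` mv (H n) \<inter> mv w \<noteq> {}}"
      by (rule contrapos_nn) (erule rev_finite_subset, simp add: image_subset_iff H)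
    moreover have "range H \<subseteq> carrier G" using Hn nontriv_carrier by blast
    ultimately have 1: "visits H g w" using g(1) visits_iff w(1) nontriv_carrier by simp
    obtain T where T: "openin X T" "y \<in> T" "\<And>s. s \<in> T \<Longrightarrow> act g s = s"
      using g by (auto simp: locally_identity_def)
    then have "\<forall>\<^sub>F n in sequentially. mv (F n) \<subseteq> T" using assms by (simp add: tends_def)
    then have "\<forall>\<^sub>F n in sequentially. \<not> below (F n) g"
    proof (rule eventually_mono)
      fix n assume n: "mv (F n) \<subseteq> T"
      have Fn: "F n \<in> nontriv" using assms by auto
      then obtain c where "c \<in> mv (F n)" using nontriv_mv by blast
      then have "locally_identity X (act g) c" using T n unfolding locally_identity_def by blast
      then show "\<not> below (F n) g" 
        using locally_identity_not_below \<open>c \<in> _\<close> Fn nontriv_carrier g by blast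
    qed
    then have "infinite ((\<lambda>n. 2 * n) ` {n. \<not> below (F n) g})"
      by (subst finite_image_iff) (auto simp: inj_on_def infinite_if_eventually)
    then have "infinite {n. \<not> below (H n) g}"
      by (rule contrapos_nn) (erule rev_finite_subset, simp add: image_subset_iff H)
    then show ?thesis using 1 g by blast
  qed
  then show ?thesis using v(1) unfolding divisible_def by blast
qed

lemma tends_interleave:
  assumes "tends F x" "tends F' x" "\<And>n. H (2 * n) = F n" "\<And>n. H (Suc (2 * n)) = F' n"
  shows "tends H x"
  unfolding tends_def
proof (intro conjI allI impI)
  show "x \<in> topspace X" using assms by (simp add: tends_def)
  fix N assume N: "openin X N \<and> x \<in> N"
  then have "\<forall>\<^sub>F n in sequentially. mv (F n) \<subseteq> N \<and> mv (F' n) \<subseteq> N"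
    using assms by (auto simp: tends_def intro: eventually_conj)
  then obtain k where k: "\<And>n. n \<ge> k \<Longrightarrow> mv (F n) \<subseteq> N \<and> mv (F' n) \<subseteq> N"
    unfolding eventually_sequentially by blast
  have "mv (H n) \<subseteq> N" if "n \<ge> 2 * k" for n
  proof (cases "even n")
    case True
    then obtain m where "n = 2 * m" by blast
    then show ?thesis using k [of m] that assms by auto
  next
    case False
    then obtain m where "n = Suc (2 * m)" using oddE by fastforce
    then show ?thesis using k [of m] that assms by auto
  qed
  then show "\<forall>\<^sub>F n in sequentially. mv (H n) \<subseteq> N" unfolding eventually_sequentially by blast
qed

lemma tends_conjugate:
  assumes F: "tends F x" "range F \<subseteq> carrier G" and g: "g \<in> carrier G"
  shows "tends (\<lambda>n. conjugate g (F n)) (act g x)"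
  unfolding tends_def
proof (intro conjI allI impI)
  have xt: "x \<in> topspace X" using F by (simp add: tends_def)
  then show "act g x \<in> topspace X" using g by simp
  fix N assume N: "openin X N \<and> act g x \<in> N"
  then have "openin X {z \<in> topspace X. act g z \<in> N}" "x \<in> {z \<in> topspace X. act g z \<in> N}"
    using act_vimage_open g xt by auto
  then have "\<forall>\<^sub>F n in sequentially. mv (F n) \<subseteq> {z \<in> topspace X. act g z \<in> N}"
    using F by (simp add: tends_def)
  then show "\<forall>\<^sub>F n in sequentially. mv (conjugate g (F n)) \<subseteq> N"
  proof (rule eventually_mono)
    fix n assume "mv (F n) \<subseteq> {z \<in> topspace X. act g z \<in> N}"
    moreover have "F n \<in> carrier G" using F by auto
    ultimately show "mv (conjugate g (F n)) \<subseteq> N" using mv_conjugate g by auto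
  qed
qed

end

section \<open>Matching the points of two actions of one group\<close>

locale two_K1_actions =
  A: K1_action G X act + B: K1_action G Y act'
  for G (structure) and X :: "'x topology" and act and Y :: "'y topology" and act'
begin

definition corresponds :: "'x \<Rightarrow> 'y \<Rightarrow> bool" where
  "corresponds x y \<longleftrightarrow> (\<exists>F. range F \<subseteq> A.nontriv \<and> A.tends F x \<and> B.tends F y)"

lemma corresponds_in: "corresponds x y \<Longrightarrow> x \<in> topspace X \<and> y \<in> topspace Y"
  by (auto simp: corresponds_def A.tends_def B.tends_def)

text \<open>\<open>good\<close> mentions only the group, so it passes from the action on
  \<open>X\<close> to that on \<open>Y\<close> and produces a limit there; shrinking preserves the
  limit \<open>x\<close>.\<close>

lemma converges_in_both:
  assumes "A.tends F x" "range F \<subseteq> A.nontriv"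
  obtains F' y where "A.shrinking F' F" "A.tends F' x" "B.tends F' y" "corresponds x y"
proof -
  obtain F' y where F': "A.shrinking F' F" "B.tends F' y"
    using B.good_converges [of F] A.good_if_tends assms by blast
  moreover have "A.tends F' x"
    using A.tends_shrinking [OF assms(1) _ F'(1)] assms A.nontriv_carrier by blast
  ultimately show ?thesis
    using that unfolding corresponds_def A.shrinking_def by blast
qed

lemma corresponds_total:
  assumes "x \<in> topspace X" obtains y where "corresponds x y"
  using A.exists_tends assms converges_in_both by metis

text \<open>Interleaving two witnesses gives a sequence shrinking to \<open>x\<close>, hence not
  divisible, while distinct limits in \<open>Y\<close> would make it divisible. Divisibility is one
  and the same property on both sides.\<close>

lemma corresponds_unique:
  assumes "corresponds x y" "corresponds x y'" shows "y = y'"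
proof (rule ccontr)
  assume ne: "y \<noteq> y'"
  obtain F F' where F: "range F \<subseteq> A.nontriv" "A.tends F x" "B.tends F y"
    and F': "range F' \<subseteq> A.nontriv" "A.tends F' x" "B.tends F' y'"
    using assms by (auto simp: corresponds_def)
  define H where "H n = (if even n then F (n div 2) else F' (n div 2))" for n
  have H: "H (2 * n) = F n" "H (Suc (2 * n)) = F' n" for n by (auto simp: H_def)
  have "A.tends H x" using A.tends_interleave F F' H by blast
  moreover have "range H \<subseteq> A.nontriv" using F F' by (auto simp: H_def)
  ultimately have "\<not> A.divisible H" by (rule A.not_divisible_if_tends)
  then show False using B.divisible_if_two_limits [OF F(3) F'(3) ne F(1) F'(1) H] by blast
qed

lemma corresponds_act:
  assumes "corresponds x y" "g \<in> carrier G" shows "corresponds (act g x) (act' g y)"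
proof -
  obtain F where F: "range F \<subseteq> A.nontriv" "A.tends F x" "B.tends F y"
    using assms by (auto simp: corresponds_def)
  have Fc: "range F \<subseteq> carrier G" using F A.nontriv_carrier by blast
  have "A.conjugate g (F n) \<in> A.nontriv" for n
  proof -
    have "F n \<in> A.nontriv" "F n \<in> carrier G" using F Fc by auto
    then show ?thesis
      using A.nontriv_iff A.mv_conjugate [OF assms(2)] assms A.conjugate_closed by (metis image_is_empty)
  qed
  then have "range (\<lambda>n. A.conjugate g (F n)) \<subseteq> A.nontriv" by blast
  then show ?thesis
    using A.tends_conjugate [OF F(2) Fc assms(2)] B.tends_conjugate [OF F(3) Fc assms(2)]
    unfolding corresponds_def by (intro exI conjI)
qed

definition lim :: "'x \<Rightarrow> 'y" where "lim x = (THE y. corresponds x y)"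

lemma corresponds_iff: "x \<in> topspace X \<Longrightarrow> corresponds x y \<longleftrightarrow> y = lim x"
  unfolding lim_def using corresponds_total corresponds_unique by (metis theI)

lemma lim_in: "x \<in> topspace X \<Longrightarrow> lim x \<in> topspace Y"
  using corresponds_iff corresponds_in by blast

text \<open>If continuity fails at \<open>x\<close>, there are points \<open>z\<close> arbitrarily
  near \<open>x\<close> with \<open>lim z\<close> outside \<open>N\<close>. Elements supported near
  them have supports that shrink to \<open>x\<close> in \<open>X\<close> but avoid a neighbourhood
  \<open>M\<close> of \<open>lim x\<close> in \<open>Y\<close>. A shrinking of this sequence
  converges to \<open>lim x\<close>, so it ends up supported in \<open>M\<close> while below
  elements that avoid \<open>M\<close>.\<close>

lemma lim_continuous: "continuous_map X Y lim"
  unfolding continuous_map_def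
proof (intro conjI allI impI)
  show "lim \<in> topspace X \<rightarrow> topspace Y" using lim_in by blast
  fix N assume N: "openin Y N"
  show "openin X {x \<in> topspace X. lim x \<in> N}"
  proof (subst openin_subopen, clarify)
    fix x assume x: "x \<in> topspace X" "lim x \<in> N"
    show "\<exists>T. openin X T \<and> x \<in> T \<and> T \<subseteq> {x \<in> topspace X. lim x \<in> N}"
    proof (rule ccontr)
      assume no: "\<not> ?thesis"
      obtain U where U: "\<And>n::nat. openin X (U n)" "\<And>n. x \<in> U n" "\<And>m n. m \<le> n \<Longrightarrow> U n \<subseteq> U m"
        "\<And>W. \<lbrakk>openin X W; x \<in> W\<rbrakk> \<Longrightarrow> \<exists>n. U n \<subseteq> W"
        using A.neighbourhood_sequence x by blast
      obtain M where M: "openin Y M" "lim x \<in> M" "Y closure_of M \<subseteq> N"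
        using B.closed_neighbourhood N x by blast
      have "\<exists>f \<in> A.nontriv. A.mv f \<subseteq> U n \<and> B.mv f \<inter> M = {}" for n
      proof -
        obtain z where z: "z \<in> U n" "z \<in> topspace X" "lim z \<notin> N"
          using no U(1,2) [of n] openin_subset by blast
        then obtain F where F: "range F \<subseteq> A.nontriv" "A.tends F z" "B.tends F (lim z)"
          using corresponds_iff [of z "lim z"] by (auto simp: corresponds_def)
        have "openin Y (topspace Y - Y closure_of M)" by (simp add: openin_diff)
        moreover have "lim z \<in> topspace Y - Y closure_of M" using z M lim_in by blast
        ultimately have "\<forall>\<^sub>F n in sequentially. B.mv (F n) \<subseteq> topspace Y - Y closure_of M"
          using F by (auto simp: B.tends_def)
        moreover have "\<forall>\<^sub>F k in sequentially. A.mv (F k) \<subseteq> U n"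
          using F U(1) z by (auto simp: A.tends_def)
        ultimately have "\<forall>\<^sub>F k in sequentially. A.mv (F k) \<subseteq> U n \<and>
            B.mv (F k) \<subseteq> topspace Y - Y closure_of M"
          by (rule eventually_conj[rotated])
        then obtain k where k: "A.mv (F k) \<subseteq> U n" "B.mv (F k) \<subseteq> topspace Y - Y closure_of M"
          unfolding eventually_sequentially by blast
        have "M \<subseteq> Y closure_of M" using M(1) by (intro closure_of_subset openin_subset)
        then have "B.mv (F k) \<inter> M = {}" using k by blast
        moreover have "F k \<in> A.nontriv" using F(1) by blast
        ultimately show ?thesis using k(1) by blast
      qed
      then obtain F where F: "\<And>n. F n \<in> A.nontriv" "\<And>n. A.mv (F n) \<subseteq> U n"
        "\<And>n. B.mv (F n) \<inter> M = {}" by metis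
      have "\<forall>\<^sub>F n in sequentially. A.mv (F n) \<subseteq> W" if "openin X W" "x \<in> W" for W
        using U(4) [OF that] U(3) F(2) unfolding eventually_sequentially by (meson order_trans)
      then have "A.tends F x" using x by (auto simp: A.tends_def)
      moreover have "range F \<subseteq> A.nontriv" using F(1) by blast
      ultimately obtain F' y where F': "A.shrinking F' F" "B.tends F' y" "corresponds x y"
        by (rule converges_in_both)
      then have "B.tends F' (lim x)" using corresponds_iff [of x y] x by simp
      then have "\<forall>\<^sub>F n in sequentially. B.mv (F' n) \<subseteq> M" using M by (simp add: B.tends_def)
      then obtain n where n: "B.mv (F' n) \<subseteq> M" unfolding eventually_sequentially by blast
      obtain r where r: "F' n \<in> A.nontriv" "A.below (F' n) (F (r n))"
        using F' by (auto simp: A.shrinking_def)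
      have "B.mv (F' n) \<inter> B.mv (F (r n)) \<noteq> {}"
        by (rule B.below_meets(2) [OF r(1) F(1) r(2)])
      then show False using n F by blast
    qed
  qed
qed

end

lemma (in two_K1_actions) swap: "two_K1_actions G Y act' X act"
  by unfold_locales

lemma (in two_K1_actions) conjugating_homeomorphism:
  obtains \<tau> \<sigma> where "homeomorphic_maps X Y \<tau> \<sigma>"
    "\<And>g x. \<lbrakk>g \<in> carrier G; x \<in> topspace X\<rbrakk> \<Longrightarrow> \<tau> (act g x) = act' g (\<tau> x)"
proof -
  interpret S: two_K1_actions G Y act' X act by (rule swap)
  have sym: "S.corresponds y x \<longleftrightarrow> corresponds x y" for x y
    by (auto simp: S.corresponds_def corresponds_def)
  have "S.lim (lim x) = x" if "x \<in> topspace X" for x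
    using that sym corresponds_iff S.corresponds_iff lim_in by metis
  moreover have "lim (S.lim y) = y" if "y \<in> topspace Y" for y
    using that sym corresponds_iff S.corresponds_iff S.lim_in by metis
  ultimately have "homeomorphic_maps X Y lim S.lim"
    by (simp add: homeomorphic_maps_def lim_continuous S.lim_continuous)
  moreover have "lim (act g x) = act' g (lim x)" if "g \<in> carrier G" "x \<in> topspace X" for g x
    using that corresponds_iff corresponds_act A.act_in by metis
  ultimately show ?thesis using that by blast
qed

section \<open>Isomorphisms of homeomorphism groups as actions\<close>

lemma homeo_group_carrier:
  "f \<in> carrier (homeo_group X) \<longleftrightarrow> f \<in> Bij (topspace X) \<and> homeomorphic_map X X f"
  by (simp add: homeo_group_def BijGroup_def)

lemma homeo_group_one: "\<one>\<^bsub>homeo_group X\<^esub> = (\<lambda>x\<in>topspace X. x)"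
  by (simp add: homeo_group_def BijGroup_def)

lemma homeo_group_mult:
  "\<lbrakk>f \<in> carrier (homeo_group X); g \<in> carrier (homeo_group X)\<rbrakk> \<Longrightarrow>
    f \<otimes>\<^bsub>homeo_group X\<^esub> g = compose (topspace X) f g"
  by (simp add: homeo_group_def BijGroup_def)

lemma homeo_group_cong:
  "\<lbrakk>f \<in> carrier (homeo_group X); g \<in> carrier (homeo_group X);
    \<And>x. x \<in> topspace X \<Longrightarrow> f x = g x\<rbrakk> \<Longrightarrow> f = g"
  by (auto simp: homeo_group_carrier Bij_def intro: extensionalityI)

lemma homeo_groupI:
  assumes "homeomorphic_maps X X f g" "f \<in> extensional (topspace X)"
  shows "f \<in> carrier (homeo_group X)"
proof -
  have "homeomorphic_map X X f" using assms homeomorphic_map_maps by blast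
  then have "bij_betw f (topspace X) (topspace X)"
    by (simp add: bij_betw_def homeomorphic_imp_injective_map homeomorphic_imp_surjective_map)
  then show ?thesis using assms \<open>homeomorphic_map X X f\<close> by (simp add: homeo_group_carrier Bij_def)
qed

lemma homeo_group_inverse:
  assumes "f \<in> carrier (homeo_group X)"
  obtains g where "g \<in> carrier (homeo_group X)" "homeomorphic_maps X X f g"
proof -
  have "homeomorphic_map X X f" using assms by (simp add: homeo_group_carrier)
  then obtain g where g: "homeomorphic_maps X X f g" using homeomorphic_map_maps by blast
  then have "homeomorphic_maps X X f (restrict g (topspace X))"
    by (rule homeomorphic_maps_eq) auto
  moreover then have "restrict g (topspace X) \<in> carrier (homeo_group X)"
    by (meson homeo_groupI homeomorphic_maps_sym restrict_extensional)
  ultimately show ?thesis using that by blast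
qed

lemma group_homeo_group: "group (homeo_group X)"
proof (rule groupI)
  fix f g assume fg: "f \<in> carrier (homeo_group X)" "g \<in> carrier (homeo_group X)"
  have "homeomorphic_map X X (f \<circ> g)"
    using fg by (auto simp: homeo_group_carrier intro: homeomorphic_map_compose)
  then have "homeomorphic_map X X (compose (topspace X) f g)"
    by (rule homeomorphic_map_eq) (simp add: compose_eq)
  then show "f \<otimes>\<^bsub>homeo_group X\<^esub> g \<in> carrier (homeo_group X)"
    using fg homeo_group_mult [OF fg] compose_Bij by (auto simp: homeo_group_carrier)
next
  have "homeomorphic_map X X (\<lambda>x\<in>topspace X. x)"
    by (rule homeomorphic_map_eq [of _ _ id]) (auto simp: homeomorphic_map_id)
  then show one: "\<one>\<^bsub>homeo_group X\<^esub> \<in> carrier (homeo_group X)"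
    by (simp add: homeo_group_carrier homeo_group_one id_Bij)
  fix f assume f: "f \<in> carrier (homeo_group X)"
  have "\<one>\<^bsub>homeo_group X\<^esub> \<otimes>\<^bsub>homeo_group X\<^esub> f = compose (topspace X) (\<lambda>x\<in>topspace X. x) f"
    using homeo_group_mult [OF one f] by (simp add: homeo_group_one)
  then show "\<one>\<^bsub>homeo_group X\<^esub> \<otimes>\<^bsub>homeo_group X\<^esub> f = f"
    using f by (simp add: homeo_group_carrier Id_compose Bij_imp_funcset Bij_imp_extensional)
  obtain g where g: "g \<in> carrier (homeo_group X)" "homeomorphic_maps X X f g"
    using homeo_group_inverse f by blast
  then have "g \<otimes>\<^bsub>homeo_group X\<^esub> f = (\<lambda>x\<in>topspace X. x)"
    using homeo_group_mult [OF g(1) f] by (simp add: compose_def homeomorphic_maps_def cong: restrict_cong)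
  then show "\<exists>g\<in>carrier (homeo_group X). g \<otimes>\<^bsub>homeo_group X\<^esub> f = \<one>\<^bsub>homeo_group X\<^esub>"
    using g by (auto simp: homeo_group_one)
next
  fix f g h
  assume fgh: "f \<in> carrier (homeo_group X)" "g \<in> carrier (homeo_group X)" "h \<in> carrier (homeo_group X)"
  interpret B: group "BijGroup (topspace X)" by (rule group_BijGroup)
  show "f \<otimes>\<^bsub>homeo_group X\<^esub> g \<otimes>\<^bsub>homeo_group X\<^esub> h = f \<otimes>\<^bsub>homeo_group X\<^esub> (g \<otimes>\<^bsub>homeo_group X\<^esub> h)"
    using B.m_assoc [of f g h] fgh unfolding homeo_group_carrier
    by (simp add: homeo_group_def) (simp add: BijGroup_def)
qed

text \<open>Injectivity of \<open>\<phi>\<close> makes the action faithful; surjectivity onto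
  \<open>H\<close> transfers (P2) to (P4), which are statements about the set of maps.\<close>

lemma K1_action_of_K1:
  assumes "(X, H) \<in> K1" "\<phi> \<in> iso G (group_on X H)" "group G"
  shows "K1_action G X \<phi>"
proof -
  have K: "subgroup H (homeo_group X)" "regular_space X" "Hausdorff_space X" "first_countable X"
    "\<And>U. \<lbrakk>openin X U; U \<noteq> {}\<rbrakk> \<Longrightarrow> \<exists>g\<in>H. g \<noteq> \<one>\<^bsub>homeo_group X\<^esub> \<and> (\<forall>x \<in> topspace X - U. g x = x)"
    "\<And>x y. \<lbrakk>x \<in> topspace X; y \<in> topspace X; x \<noteq> y\<rbrakk> \<Longrightarrow>
        somewhere_dense X {g x |g. g \<in> H \<and> locally_identity X g y}"
    "topspace X \<subseteq> \<Union>{U. flexible X H U}"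
    using assms(1) unfolding K1_def space_group_pair_def by simp_all
  have im: "\<phi> ` carrier G = H" and inj: "inj_on \<phi> (carrier G)" and hom: "\<phi> \<in> hom G (group_on X H)"
    using assms(2) by (auto simp: iso_def bij_betw_def)
  have sub: "H \<subseteq> carrier (homeo_group X)" using K(1) subgroup.subset by blast
  have \<phi>H: "\<phi> g \<in> H" if "g \<in> carrier G" for g using im that by blast
  have \<phi>c: "\<phi> g \<in> carrier (homeo_group X)" if "g \<in> carrier G" for g using \<phi>H sub that by blast
  have gH: "group (group_on X H)"
    using K(1) group_homeo_group by (rule subgroup.subgroup_is_group)
  interpret G: group G by fact
  interpret h: group_hom G "group_on X H" \<phi>
    using assms(3) gH hom by (simp add: group_hom_def group_hom_axioms_def)
  have one: "\<phi> \<one>\<^bsub>G\<^esub> = (\<lambda>x\<in>topspace X. x)" using h.hom_one by (simp add: homeo_group_one)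
  show ?thesis
  proof
    fix g assume g: "g \<in> carrier G"
    show "continuous_map X X (\<phi> g)"
      using \<phi>c [OF g] by (simp add: homeo_group_carrier homeomorphic_imp_continuous_map)
    show "\<phi> (g \<otimes>\<^bsub>G\<^esub> h) x = \<phi> g (\<phi> h x)" if "h \<in> carrier G" "x \<in> topspace X" for h x
    proof -
      have "\<phi> (g \<otimes>\<^bsub>G\<^esub> h) = \<phi> g \<otimes>\<^bsub>homeo_group X\<^esub> \<phi> h" using h.hom_mult g that by simp
      then show ?thesis using homeo_group_mult [OF \<phi>c \<phi>c] g that by (simp add: compose_eq)
    qed
    show "g = \<one>\<^bsub>G\<^esub>" if "\<And>x. x \<in> topspace X \<Longrightarrow> \<phi> g x = x"
    proof -
      have "\<phi> g = \<phi> \<one>\<^bsub>G\<^esub>"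
        by (rule homeo_group_cong [OF \<phi>c [OF g] \<phi>c]) (use that one in simp_all)
      then show ?thesis using inj g by (simp add: inj_on_def)
    qed
  next
    show "\<phi> \<one>\<^bsub>G\<^esub> x = x" if "x \<in> topspace X" for x using that one by simp
  next
    fix U assume "openin X U" "U \<noteq> {}"
    then obtain g where g: "g \<in> H" "g \<noteq> \<one>\<^bsub>homeo_group X\<^esub>" "\<forall>x \<in> topspace X - U. g x = x"
      using K(5) by blast
    then obtain k where "k \<in> carrier G" "g = \<phi> k" using im by blast
    then show "\<exists>g\<in>carrier G. g \<noteq> \<one>\<^bsub>G\<^esub> \<and> (\<forall>x\<in>topspace X - U. \<phi> g x = x)"
      using g one by (intro bexI [of _ k]) (auto simp: homeo_group_one)
  qed (use K im in auto)
qed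

theorem faithful_K1: "faithful K1 K1"
  unfolding faithful_def
proof (intro allI impI, elim conjE)
  fix X :: "'a topology" and G and Y :: "'b topology" and H \<phi>
  assume X: "(X, G) \<in> K1" and Y: "(Y, H) \<in> K1" and \<phi>: "\<phi> \<in> iso (group_on X G) (group_on Y H)"
  have "subgroup G (homeo_group X)" using X by (auto simp: K1_def space_group_pair_def)
  then have gG: "group (group_on X G)" using group_homeo_group by (rule subgroup.subgroup_is_group)
  have "G \<subseteq> carrier (homeo_group X)" using \<open>subgroup G _\<close> subgroup.subset by blast
  have "K1_action (group_on X G) X id"
    by (rule K1_action_of_K1 [OF X _ gG]) (simp add: iso_def hom_def)
  moreover have "K1_action (group_on X G) Y \<phi>" by (rule K1_action_of_K1 [OF Y \<phi> gG])
  ultimately interpret two_K1_actions "group_on X G" X id Y \<phi>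
    by (simp add: two_K1_actions_def)
  obtain \<tau> \<sigma> where hm: "homeomorphic_maps X Y \<tau> \<sigma>"
    and eq: "\<And>g x. \<lbrakk>g \<in> G; x \<in> topspace X\<rbrakk> \<Longrightarrow> \<tau> (g x) = \<phi> g (\<tau> x)"
    using conjugating_homeomorphism by auto
  have "\<phi> g = restrict (\<tau> \<circ> g \<circ> \<sigma>) (topspace Y)" if g: "g \<in> G" for g
  proof -
    have "\<phi> g \<in> H" using \<phi> g by (auto simp: iso_def bij_betw_def)
    moreover have "H \<subseteq> carrier (homeo_group Y)"
      using Y subgroup.subset [of H "homeo_group Y"] by (simp add: K1_def space_group_pair_def)
    ultimately have "\<phi> g \<in> carrier (homeo_group Y)" by blast
    then have "\<phi> g \<in> extensional (topspace Y)" by (simp add: homeo_group_carrier Bij_def)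
    moreover have "\<phi> g y = \<tau> (g (\<sigma> y))" if "y \<in> topspace Y" for y
    proof -
      have "\<sigma> y \<in> topspace X" "\<tau> (\<sigma> y) = y"
        using hm that by (auto simp: homeomorphic_maps_def continuous_map_def)
      then show ?thesis using eq g by metis
    qed
    ultimately show ?thesis by (intro extensionalityI [of _ "topspace Y"]) auto
  qed
  then show "\<exists>\<tau> \<sigma>. homeomorphic_maps X Y \<tau> \<sigma> \<and> (\<forall>g\<in>G. \<phi> g = restrict (\<tau> \<circ> g \<circ> \<sigma>) (topspace Y))"
    using hm by blast
qed

section \<open>Continuous seminorms\<close>

text \<open>Continuity is encoded as openness of the \<open>p\<close>-balls of all radii about all
  centres; nonnegativity follows from the two algebraic clauses.\<close>

definition continuous_seminorm :: "'a::real_vector topology \<Rightarrow> ('a \<Rightarrow> real) \<Rightarrow> bool" where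
  "continuous_seminorm T p \<longleftrightarrow> (\<forall>x y. p (x + y) \<le> p x + p y) \<and>
     (\<forall>c x. p (c *\<^sub>R x) = \<bar>c\<bar> * p x) \<and> (\<forall>x c. openin T {y. p (y - x) < c})"

context
  fixes T :: "'a::real_vector topology" and p :: "'a \<Rightarrow> real"
  assumes p: "continuous_seminorm T p"
begin

lemma seminorm_add: "p (x + y) \<le> p x + p y"
  and seminorm_scale: "p (c *\<^sub>R x) = \<bar>c\<bar> * p x"
  and seminorm_open: "openin T {y. p (y - x) < c}"
  using p unfolding continuous_seminorm_def by blast+

lemma seminorm_zero [simp]: "p 0 = 0"
  using seminorm_scale [of 0 0] by simp

lemma seminorm_minus: "p (- x) = p x"
  using seminorm_scale [of "-1" x] by simp

lemma seminorm_nonneg: "p x \<ge> 0"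
  using seminorm_add [of x "- x"] seminorm_minus [of x] by simp

lemma seminorm_diff: "p (x - y) \<le> p x + p y"
  using seminorm_add [of x "- y"] seminorm_minus [of y] by simp

lemma seminorm_diff_commute: "p (x - y) = p (y - x)"
  using seminorm_minus [of "x - y"] by simp

lemma seminorm_triangle: "p (x - z) \<le> p (x - y) + p (y - z)"
  using seminorm_add [of "x - y" "y - z"] by simp

lemma seminorm_abs_diff: "\<bar>p x - p y\<bar> \<le> p (x - y)"
  using seminorm_add [of "x - y" y] seminorm_add [of "y - x" x] seminorm_diff_commute [of x y]
  by simp

end

lemma continuous_seminorm_add:
  assumes p: "continuous_seminorm T p" and q: "continuous_seminorm T q"
  shows "continuous_seminorm T (\<lambda>x. p x + q x)"
  unfolding continuous_seminorm_def
proof (intro conjI allI)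
  fix x y show "p (x + y) + q (x + y) \<le> p x + q x + (p y + q y)"
    using seminorm_add [OF p, of x y] seminorm_add [OF q, of x y] by simp
next
  fix c x show "p (c *\<^sub>R x) + q (c *\<^sub>R x) = \<bar>c\<bar> * (p x + q x)"
    by (simp add: seminorm_scale [OF p] seminorm_scale [OF q] algebra_simps)
next
  fix x c
  show "openin T {y. p (y - x) + q (y - x) < c}"
  proof (subst openin_subopen, clarify)
    fix y assume y: "p (y - x) + q (y - x) < c"
    define e where "e = (c - (p (y - x) + q (y - x))) / 2"
    have e: "e > 0" using y by (simp add: e_def)
    let ?U = "{z. p (z - y) < e} \<inter> {z. q (z - y) < e}"
    have "openin T ?U" using seminorm_open [OF p] seminorm_open [OF q] by blast
    moreover have "y \<in> ?U" using e by (simp add: seminorm_zero [OF p] seminorm_zero [OF q])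
    moreover have "p (z - x) + q (z - x) < c" if "z \<in> ?U" for z
    proof -
      have "p (z - x) \<le> p (z - y) + p (y - x)" "q (z - x) \<le> q (z - y) + q (y - x)"
        by (rule seminorm_triangle [OF p]) (rule seminorm_triangle [OF q])
      moreover have "p (z - y) < e" "q (z - y) < e" using that by auto
      moreover have "2 * e = c - (p (y - x) + q (y - x))" by (simp add: e_def)
      ultimately show ?thesis by linarith
    qed
    ultimately show "\<exists>U. openin T U \<and> y \<in> U \<and> U \<subseteq> {y. p (y - x) + q (y - x) < c}" by blast
  qed
qed

lemma continuous_seminorm_scale:
  assumes p: "continuous_seminorm T p" and a: "a > 0"
  shows "continuous_seminorm T (\<lambda>x. a * p x)"
  unfolding continuous_seminorm_def
proof (intro conjI allI)
  fix x y show "a * p (x + y) \<le> a * p x + a * p y"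
    using seminorm_add [OF p, of x y] a by (metis distrib_left mult_le_cancel_left_pos)
next
  fix c x show "a * p (c *\<^sub>R x) = \<bar>c\<bar> * (a * p x)"
    by (simp add: seminorm_scale [OF p])
next
  fix x c
  have "{y. a * p (y - x) < c} = {y. p (y - x) < c / a}"
    using a by (auto simp: field_simps)
  then show "openin T {y. a * p (y - x) < c}" using seminorm_open [OF p] by simp
qed

locale locally_convex =
  fixes T :: "'a::real_vector topology"
  assumes lcs: "locally_convex_tvs T"
begin

lemma topspace_UNIV [simp]: "topspace T = UNIV"
  using lcs by (simp add: locally_convex_tvs_def)

lemma continuous_scale: "continuous_map T T (\<lambda>x. c *\<^sub>R x)"
proof -
  have "continuous_map (prod_topology euclideanreal T) T (\<lambda>(c, x). c *\<^sub>R x)"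
    using lcs by (simp add: locally_convex_tvs_def)
  from continuous_map_compose [OF _ this, of T "\<lambda>x. (c, x)"] show ?thesis
    by (simp add: continuous_map_pairwise o_def)
qed

lemma continuous_scale_left: "continuous_map euclideanreal T (\<lambda>c. c *\<^sub>R x)"
proof -
  have "continuous_map (prod_topology euclideanreal T) T (\<lambda>(c, x). c *\<^sub>R x)"
    using lcs by (simp add: locally_convex_tvs_def)
  from continuous_map_compose [OF _ this, of euclideanreal "\<lambda>c. (c, x)"] show ?thesis
    by (simp add: continuous_map_pairwise o_def)
qed

lemma continuous_translate: "continuous_map T T (\<lambda>x. x + b)"
proof -
  have "continuous_map (prod_topology T T) T (\<lambda>(x, y). x + y)"
    using lcs by (simp add: locally_convex_tvs_def)
  from continuous_map_compose [OF _ this, of T "\<lambda>x. (x, b)"] show ?thesis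
    by (simp add: continuous_map_pairwise o_def)
qed

lemma open_translate: "openin T U \<Longrightarrow> openin T {x. x + b \<in> U}"
  using openin_continuous_map_preimage [OF continuous_translate] by simp

lemma open_scale: "openin T U \<Longrightarrow> openin T {x. c *\<^sub>R x \<in> U}"
  using openin_continuous_map_preimage [OF continuous_scale] by simp

lemma open_affine:
  assumes "openin T U" shows "openin T {x. c *\<^sub>R (x - b) \<in> U}"
  using open_translate [OF open_scale [OF assms, of c], of "- b"] by simp

lemma absolutely_convex_neighbourhood:
  assumes "openin T U" "0 \<in> U"
  obtains B where "openin T B" "0 \<in> B" "convex B" "B \<subseteq> U" "\<And>x. x \<in> B \<Longrightarrow> - x \<in> B"
proof -
  obtain C where C: "openin T C" "0 \<in> C" "convex C" "C \<subseteq> U"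
    using lcs assms unfolding locally_convex_tvs_def by blast
  let ?B = "C \<inter> {x. (-1) *\<^sub>R x \<in> C}"
  have "openin T ?B" using C open_scale by blast
  moreover have "convex ?B"
    using convex_linear_vimage [OF linear_scaleR C(3), of "-1"] C(3)
    by (intro convex_Int) (simp_all add: vimage_def)
  ultimately show ?thesis using that [of ?B] C by auto
qed

text \<open>The Minkowski functional of an absolutely convex neighbourhood.\<close>

lemma exists_seminorm_zero:
  assumes "openin T U" "0 \<in> U"
  obtains p where "continuous_seminorm T p" "{x. p x < 1} \<subseteq> U"
proof -
  obtain B where B: "openin T B" "0 \<in> B" "convex B" "B \<subseteq> U" "\<And>x. x \<in> B \<Longrightarrow> - x \<in> B"
    using absolutely_convex_neighbourhood assms by blast
  define S where "S x = {t. t > 0 \<and> (1 / t) *\<^sub>R x \<in> B}" for x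
  define p where "p x = Inf (S x)" for x
  have bdd: "bdd_below (S x)" for x by (rule bdd_belowI [of _ 0]) (auto simp: S_def)
  have ne: "S x \<noteq> {}" for x
  proof -
    \<comment> \<open>Continuity of scalar multiplication in the scalar makes \<open>B\<close>
      absorb \<open>x\<close>, so the infimum is over a nonempty set.\<close>
    have "openin euclideanreal {c. c *\<^sub>R x \<in> B}"
      using openin_continuous_map_preimage [OF continuous_scale_left B(1)] by simp
    then have "open {c. c *\<^sub>R x \<in> B}" by simp
    moreover have "0 \<in> {c. c *\<^sub>R x \<in> B}" using B by simp
    ultimately obtain e where e: "e > 0" "ball 0 e \<subseteq> {c. c *\<^sub>R x \<in> B}"
      unfolding open_contains_ball by blast
    then have "e / 2 \<in> {c. c *\<^sub>R x \<in> B}" by (intro subsetD [OF e(2)]) auto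
    then have "2 / e \<in> S x" using e by (simp add: S_def)
    then show ?thesis by blast
  qed
  have less: "\<exists>t\<in>S x. t < c" if "p x < c" for x c
    using cInf_lessD [OF ne] that unfolding p_def by simp
  have le: "p x \<le> t" if "t \<in> S x" for x t
    unfolding p_def by (rule cInf_lower [OF that bdd])
  have mem: "x \<in> B" if px: "p x < 1" for x
  proof -
    obtain t where t: "t > 0" "t < 1" "(1 / t) *\<^sub>R x \<in> B" using less [OF px] by (auto simp: S_def)
    have "t *\<^sub>R ((1 / t) *\<^sub>R x) + (1 - t) *\<^sub>R 0 \<in> B"
      using t B by (intro convexD) auto
    then show ?thesis using t by simp
  qed
  have add: "p (x + y) \<le> p x + p y" for x y
  proof (rule field_le_epsilon)
    fix e :: real assume e: "e > 0"
    obtain s where s: "s > 0" "(1 / s) *\<^sub>R x \<in> B" "s < p x + e / 2"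
      using less [of x "p x + e / 2"] e by (auto simp: S_def)
    obtain t where t: "t > 0" "(1 / t) *\<^sub>R y \<in> B" "t < p y + e / 2"
      using less [of y "p y + e / 2"] e by (auto simp: S_def)
    have "s / (s + t) + t / (s + t) = 1" using s t by (simp flip: add_divide_distrib)
    then have "(s / (s + t)) *\<^sub>R ((1 / s) *\<^sub>R x) + (t / (s + t)) *\<^sub>R ((1 / t) *\<^sub>R y) \<in> B"
      using s t B by (intro convexD) auto
    then have "(1 / (s + t)) *\<^sub>R (x + y) \<in> B" using s t by (simp add: scaleR_right_distrib)
    then have "s + t \<in> S (x + y)" using s t by (simp add: S_def)
    then show "p (x + y) \<le> p x + p y + e" using le s t by fastforce
  qed
  have pos: "p (c *\<^sub>R x) \<le> c * p x" if c: "c > 0" for c x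
  proof (rule field_le_epsilon)
    fix e :: real assume e: "e > 0"
    obtain s where s: "s > 0" "(1 / s) *\<^sub>R x \<in> B" "s < p x + e / c"
      using less [of x "p x + e / c"] e c by (auto simp: S_def)
    have "c * s \<in> S (c *\<^sub>R x)" using s c by (simp add: S_def)
    then have "p (c *\<^sub>R x) \<le> c * s" by (rule le)
    also have "\<dots> \<le> c * (p x + e / c)" using s c by (intro mult_left_mono) auto
    also have "\<dots> = c * p x + e" using c by (simp add: field_simps)
    finally show "p (c *\<^sub>R x) \<le> c * p x + e" .
  qed
  have pos_eq: "p (c *\<^sub>R x) = c * p x" if "c > 0" for c x
    using pos [OF that, of x] pos [of "1 / c" "c *\<^sub>R x"] that by (simp add: field_simps)
  have neg: "p (- x) = p x" for x
  proof -
    have "S (- x) = S x" unfolding S_def using B(5) by (metis scaleR_minus_right minus_minus)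
    then show ?thesis by (simp add: p_def)
  qed
  have "p 0 = 0" using pos_eq [of 2 0] by simp
  have scale: "p (c *\<^sub>R x) = \<bar>c\<bar> * p x" for c x
  proof -
    consider "c > 0" | "c = 0" | "c < 0" by linarith
    then show ?thesis
    proof cases
      case 3
      then have "p (c *\<^sub>R x) = p ((- c) *\<^sub>R x)" using neg [of "c *\<^sub>R x"] by simp
      then show ?thesis using pos_eq [of "- c" x] 3 by simp
    qed (use pos_eq \<open>p 0 = 0\<close> in auto)
  qed
  have op: "openin T {y. p (y - x) < c}" for x c
  proof (subst openin_subopen, clarify)
    fix y assume y: "p (y - x) < c"
    \<comment> \<open>Half of the slack, because membership in the scaled set yields only the weak
      inequality \<open>p (z - y) \<le> e\<close>.\<close>
    define e where "e = (c - p (y - x)) / 2"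
    have e: "e > 0" using y by (simp add: e_def)
    let ?U = "{z. (1 / e) *\<^sub>R (z - y) \<in> B}"
    have "openin T ?U" using open_affine B by blast
    moreover have "y \<in> ?U" using B by simp
    moreover have "p (z - x) < c" if "z \<in> ?U" for z
    proof -
      have "p (z - y) \<le> e" using that e by (intro le) (auto simp: S_def)
      then show ?thesis using add [of "z - y" "y - x"] e by (simp add: e_def field_simps)
    qed
    ultimately show "\<exists>U. openin T U \<and> y \<in> U \<and> U \<subseteq> {y. p (y - x) < c}" by blast
  qed
  have "continuous_seminorm T p" using add scale op by (simp add: continuous_seminorm_def)
  then show ?thesis using that mem B by blast
qed

lemma exists_seminorm:
  assumes "openin T U" "x \<in> U"
  obtains p where "continuous_seminorm T p" "{y. p (y - x) < 1} \<subseteq> U"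
proof -
  have "openin T {z. z + x \<in> U}" "0 \<in> {z. z + x \<in> U}" using open_translate assms by auto
  then obtain p where p: "continuous_seminorm T p" "{z. p z < 1} \<subseteq> {z. z + x \<in> U}"
    using exists_seminorm_zero by blast
  have "y \<in> U" if "p (y - x) < 1" for y using that subsetD [OF p(2), of "y - x"] by simp
  then show ?thesis using that p by blast
qed

text \<open>A Lipschitz condition suited to families of seminorms: it does not refer to an invariant
  metric, which need not be homogeneous, is stable under composition and implies uniform
  continuity.\<close>

definition seminorm_lipschitz :: "('a \<Rightarrow> 'a) \<Rightarrow> bool" where
  "seminorm_lipschitz f \<longleftrightarrow> (\<forall>q. continuous_seminorm T q \<longrightarrow>
     (\<exists>p. continuous_seminorm T p \<and> (\<forall>x y. q (f x - f y) \<le> p (x - y))))"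

lemma seminorm_lipschitz_comp:
  assumes "seminorm_lipschitz f" "seminorm_lipschitz g" shows "seminorm_lipschitz (f \<circ> g)"
  unfolding seminorm_lipschitz_def
proof (intro allI impI)
  fix q assume "continuous_seminorm T q"
  then obtain p where p: "continuous_seminorm T p" "\<And>x y. q (f x - f y) \<le> p (x - y)"
    using assms(1) unfolding seminorm_lipschitz_def by blast
  then obtain p' where p': "continuous_seminorm T p'" "\<And>x y. p (g x - g y) \<le> p' (x - y)"
    using assms(2) unfolding seminorm_lipschitz_def by blast
  show "\<exists>p. continuous_seminorm T p \<and> (\<forall>x y. q ((f \<circ> g) x - (f \<circ> g) y) \<le> p (x - y))"
    using p p' by (intro exI [of _ p']) (simp, meson order_trans)
qed

lemma seminorm_lipschitz_id: "seminorm_lipschitz id"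
  unfolding seminorm_lipschitz_def by auto

lemma seminorm_lipschitz_uniformly_continuous:
  assumes "seminorm_lipschitz f" shows "group_uniformly_continuous_on T S f"
  unfolding group_uniformly_continuous_on_def
proof (intro allI impI, elim conjE)
  fix V assume "openin T V" "0 \<in> V"
  then obtain q where q: "continuous_seminorm T q" "{x. q x < 1} \<subseteq> V"
    using exists_seminorm_zero by blast
  then obtain p where p: "continuous_seminorm T p" "\<And>x y. q (f x - f y) \<le> p (x - y)"
    using assms unfolding seminorm_lipschitz_def by blast
  have "openin T {x. p x < 1}" using seminorm_open [OF p(1), of 0 1] by simp
  moreover have "f x - f y \<in> V" if "p (x - y) < 1" for x y
    using that p(2) [of x y] q(2) by auto
  ultimately show "\<exists>U. openin T U \<and> 0 \<in> U \<and> (\<forall>x\<in>S. \<forall>y\<in>S. x - y \<in> U \<longrightarrow> f x - f y \<in> V)"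
    using seminorm_zero [OF p(1)] by (intro exI [of _ "{x. p x < 1}"]) auto
qed

lemma uniformly_continuous_continuous:
  assumes U: "openin T U" and f: "group_uniformly_continuous_on T U f" and V: "openin T V"
  shows "openin T {x \<in> U. f x \<in> V}"
proof (subst openin_subopen, clarify)
  fix x assume x: "x \<in> U" "f x \<in> V"
  have "openin T {z. z + f x \<in> V}" "0 \<in> {z. z + f x \<in> V}" using open_translate V x by auto
  then obtain W where W: "openin T W" "0 \<in> W"
    "\<And>y z. \<lbrakk>y \<in> U; z \<in> U; y - z \<in> W\<rbrakk> \<Longrightarrow> f y - f z \<in> {z. z + f x \<in> V}"
    using f unfolding group_uniformly_continuous_on_def by meson
  let ?N = "U \<inter> {y. y + (- x) \<in> W}"
  have "openin T ?N" using U open_translate [OF W(1)] by blast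
  moreover have "x \<in> ?N" using x W by simp
  moreover have "?N \<subseteq> {x \<in> U. f x \<in> V}" using W(3) [OF _ x(1)] by auto
  ultimately show "\<exists>N. openin T N \<and> x \<in> N \<and> N \<subseteq> {x \<in> U. f x \<in> V}" by blast
qed

lemma locally_uniformly_continuous_continuous:
  assumes "\<And>x. \<exists>U. openin T U \<and> x \<in> U \<and> group_uniformly_continuous_on T U f"
  shows "continuous_map T T f"
  unfolding continuous_map_def
proof (intro conjI allI impI)
  fix V assume V: "openin T V"
  show "openin T {x \<in> topspace T. f x \<in> V}"
  proof (subst openin_subopen, clarify)
    fix x assume x: "f x \<in> V"
    obtain U where U: "openin T U" "x \<in> U" "group_uniformly_continuous_on T U f" using assms by blast
    then have "openin T {x \<in> U. f x \<in> V}" using uniformly_continuous_continuous V by blast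
    then show "\<exists>N. openin T N \<and> x \<in> N \<and> N \<subseteq> {x \<in> topspace T. f x \<in> V}"
      using U x by (intro exI [of _ "{x \<in> U. f x \<in> V}"]) auto
  qed
qed auto

definition bilipschitz :: "('a \<Rightarrow> 'a) \<Rightarrow> ('a \<Rightarrow> 'a) \<Rightarrow> bool" where
  "bilipschitz f g \<longleftrightarrow> seminorm_lipschitz f \<and> seminorm_lipschitz g \<and>
     (\<forall>x. g (f x) = x) \<and> (\<forall>x. f (g x) = x)"

lemma bilipschitz_comp: "\<lbrakk>bilipschitz f g; bilipschitz f' g'\<rbrakk> \<Longrightarrow> bilipschitz (f \<circ> f') (g' \<circ> g)"
  by (simp add: bilipschitz_def seminorm_lipschitz_comp)

lemma bilipschitz_id: "bilipschitz id id"
  by (simp add: bilipschitz_def seminorm_lipschitz_id)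

section \<open>Pushing points along segments\<close>

text \<open>The cut-off \<open>l\<close> is \<open>\<epsilon>\<close>-Lipschitz for
  \<open>p\<close>. With \<open>\<epsilon> * p v < 1\<close> the map contracts
  \<open>p\<close>-distances at most by the factor \<open>1 - \<epsilon> * p v\<close>, whose
  reciprocal \<open>K\<close> controls the inverse.\<close>

lemma small_push:
  assumes p: "continuous_seminorm T p" and \<epsilon>: "\<epsilon> \<ge> 0" "\<epsilon> * p v < 1"
  obtains f g where "bilipschitz f g" "f x = x + \<epsilon> *\<^sub>R v"
    "\<And>z. \<exists>c. f z = z + c *\<^sub>R v" "\<And>z. f z \<noteq> z \<Longrightarrow> p (z - x) < 1"
proof -
  define l where "l z = \<epsilon> * max 0 (1 - p (z - x))" for z
  have l_lip: "\<bar>l y - l z\<bar> \<le> \<epsilon> * p (y - z)" for y z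
  proof -
    have "\<bar>max 0 (1 - p (y - x)) - max 0 (1 - p (z - x))\<bar> \<le> \<bar>p (y - x) - p (z - x)\<bar>" by auto
    also have "\<dots> \<le> p (y - z)" using seminorm_abs_diff [OF p, of "y - x" "z - x"] by simp
    finally show ?thesis using \<epsilon> by (simp add: l_def abs_mult mult_left_mono flip: right_diff_distrib)
  qed
  have l0: "0 \<le> l z" "l z \<le> \<epsilon>" for z
    using \<epsilon> seminorm_nonneg [OF p, of "z - x"] by (auto simp: l_def mult_left_le)
  define f where "f z = z + l z *\<^sub>R v" for z
  define K where "K = 1 / (1 - \<epsilon> * p v)"
  have K: "K > 0" using \<epsilon> by (simp add: K_def)
  have expand: "p (y - z) \<le> K * p (f y - f z)" for y z
  proof -
    have "y - z = (f y - f z) - (l y - l z) *\<^sub>R v" by (simp add: f_def algebra_simps)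
    then have "p (y - z) \<le> p (f y - f z) + \<bar>l y - l z\<bar> * p v"
      using seminorm_diff [OF p, of "f y - f z" "(l y - l z) *\<^sub>R v"] by (simp add: seminorm_scale [OF p])
    also have "\<dots> \<le> p (f y - f z) + (\<epsilon> * p (y - z)) * p v"
      using l_lip seminorm_nonneg [OF p, of v] by (simp add: mult_right_mono)
    finally have "(1 - \<epsilon> * p v) * p (y - z) \<le> p (f y - f z)" by (simp add: algebra_simps)
    then show ?thesis using \<epsilon> by (simp add: K_def field_simps)
  qed
  \<comment> \<open>Completeness is not assumed, so no fixed-point theorem is at hand. But a
    preimage need only be sought on the line \<open>w - s v\<close>, and the intermediate value
    theorem on \<open>[0, \<epsilon>]\<close> finds it because
    \<open>0 \<le> l \<le> \<epsilon>\<close>.\<close>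
  have "\<exists>z. f z = w" for w
  proof -
    define \<phi> where "\<phi> s = s - l (w - s *\<^sub>R v)" for s
    have "continuous_on {0..\<epsilon>} (\<lambda>s. l (w - s *\<^sub>R v))"
    proof (rule continuous_onI)
      fix s e :: real assume "e > 0"
      define C where "C = \<epsilon> * p v + 1"
      have C: "C > 0" using \<epsilon> seminorm_nonneg [OF p, of v] by (simp add: C_def add_nonneg_pos)
      have "dist (l (w - t *\<^sub>R v)) (l (w - s *\<^sub>R v)) \<le> e" if "dist t s < e / C" for t
      proof -
        have "\<bar>l (w - t *\<^sub>R v) - l (w - s *\<^sub>R v)\<bar> \<le> \<epsilon> * p ((s - t) *\<^sub>R v)"
          using l_lip [of "w - t *\<^sub>R v" "w - s *\<^sub>R v"] by (simp add: algebra_simps)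
        also have "\<dots> = \<bar>t - s\<bar> * (\<epsilon> * p v)" by (simp add: seminorm_scale [OF p] abs_minus_commute)
        also have "\<dots> \<le> \<bar>t - s\<bar> * C" by (intro mult_left_mono) (auto simp: C_def)
        also have "\<dots> \<le> e" using that C by (simp add: dist_real_def field_simps)
        finally show ?thesis by (simp add: dist_real_def)
      qed
      then show "\<exists>d>0. \<forall>t\<in>{0..\<epsilon>}. dist t s < d \<longrightarrow> dist (l (w - t *\<^sub>R v)) (l (w - s *\<^sub>R v)) \<le> e"
        using C \<open>e > 0\<close> by (intro exI [of _ "e / C"]) auto
    qed
    then have "continuous_on {0..\<epsilon>} \<phi>" unfolding \<phi>_def by (intro continuous_intros)
    moreover have "\<phi> 0 \<le> 0" "0 \<le> \<phi> \<epsilon>" using l0 by (auto simp: \<phi>_def)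
    ultimately obtain s where "\<phi> s = 0" using IVT' [of \<phi> 0 0 \<epsilon>] \<epsilon> by blast
    then have "f (w - s *\<^sub>R v) = w" by (simp add: f_def \<phi>_def)
    then show ?thesis by blast
  qed
  then obtain g where fg: "\<And>w. f (g w) = w" by metis
  \<comment> \<open>As \<open>p\<close> is only a seminorm, \<open>p (y - z) = 0\<close> does not
    identify the points; it does force \<open>l y = l z\<close>, and then equal images give equal
    points.\<close>
  have inj: "y = z" if "f y = f z" for y z
  proof -
    have "p (y - z) \<le> 0" using expand [of y z] that seminorm_zero [OF p] by simp
    then have "\<bar>l y - l z\<bar> \<le> \<epsilon> * 0" using l_lip [of y z] \<epsilon> seminorm_nonneg [OF p, of "y - z"] by simp
    then show ?thesis using that by (simp add: f_def)
  qed
  then have gf: "g (f z) = z" for z using fg by blast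
  have "seminorm_lipschitz f"
    unfolding seminorm_lipschitz_def
  proof (intro allI impI)
    fix q assume q: "continuous_seminorm T q"
    \<comment> \<open>The summand 1 keeps \<open>c\<close> positive, as
      \<open>continuous_seminorm_scale\<close> demands.\<close>
    define c where "c = \<epsilon> * q v + 1"
    have c: "c > 0" using \<epsilon> seminorm_nonneg [OF q, of v] by (simp add: c_def add_nonneg_pos)
    have "q (f y - f z) \<le> q (y - z) + c * p (y - z)" for y z
    proof -
      have "f y - f z = (y - z) + (l y - l z) *\<^sub>R v" by (simp add: f_def algebra_simps)
      then have "q (f y - f z) \<le> q (y - z) + \<bar>l y - l z\<bar> * q v"
        using seminorm_add [OF q, of "y - z" "(l y - l z) *\<^sub>R v"] by (simp add: seminorm_scale [OF q])
      also have "\<dots> \<le> q (y - z) + (\<epsilon> * p (y - z)) * q v"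
        using l_lip seminorm_nonneg [OF q, of v] by (simp add: mult_right_mono)
      also have "\<dots> \<le> q (y - z) + c * p (y - z)"
        using seminorm_nonneg [OF p, of "y - z"] by (simp add: c_def algebra_simps)
      finally show ?thesis .
    qed
    moreover have "continuous_seminorm T (\<lambda>x. q x + c * p x)"
      using continuous_seminorm_add q continuous_seminorm_scale p c by blast
    ultimately show "\<exists>p. continuous_seminorm T p \<and> (\<forall>x y. q (f x - f y) \<le> p (x - y))"
      by (intro exI [of _ "\<lambda>x. q x + c * p x"]) auto
  qed
  moreover have "seminorm_lipschitz g"
    unfolding seminorm_lipschitz_def
  proof (intro allI impI)
    fix q assume q: "continuous_seminorm T q"
    define c where "c = (\<epsilon> * q v + 1) * K"
    have c: "c > 0" using \<epsilon> K seminorm_nonneg [OF q, of v] by (simp add: c_def add_nonneg_pos)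
    have "q (g y - g z) \<le> q (y - z) + c * p (y - z)" for y z
    proof -
      have "g y - g z = (y - z) - (l (g y) - l (g z)) *\<^sub>R v"
        using fg [of y] fg [of z] by (simp add: f_def algebra_simps)
      then have "q (g y - g z) \<le> q (y - z) + \<bar>l (g y) - l (g z)\<bar> * q v"
        using seminorm_diff [OF q, of "y - z" "(l (g y) - l (g z)) *\<^sub>R v"] by (simp add: seminorm_scale [OF q])
      also have "\<dots> \<le> q (y - z) + (\<epsilon> * p (g y - g z)) * q v"
        using l_lip seminorm_nonneg [OF q, of v] by (simp add: mult_right_mono)
      also have "\<dots> \<le> q (y - z) + (\<epsilon> * (K * p (y - z))) * q v"
        using expand [of "g y" "g z"] fg \<epsilon> seminorm_nonneg [OF q, of v]
        by (intro add_left_mono mult_right_mono mult_left_mono) auto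
      also have "\<dots> \<le> q (y - z) + c * p (y - z)"
        using seminorm_nonneg [OF p, of "y - z"] K by (simp add: c_def algebra_simps)
      finally show ?thesis .
    qed
    moreover have "continuous_seminorm T (\<lambda>x. q x + c * p x)"
      using continuous_seminorm_add q continuous_seminorm_scale p c by blast
    ultimately show "\<exists>p. continuous_seminorm T p \<and> (\<forall>x y. q (g x - g y) \<le> p (x - y))"
      by (intro exI [of _ "\<lambda>x. q x + c * p x"]) auto
  qed
  ultimately have "bilipschitz f g" using fg gf by (simp add: bilipschitz_def)
  moreover have "f x = x + \<epsilon> *\<^sub>R v" by (simp add: f_def l_def seminorm_zero [OF p])
  moreover have "p (z - x) < 1" if "f z \<noteq> z" for z
    using that by (auto simp: f_def l_def max_def split: if_splits)
  ultimately show ?thesis using that f_def by blast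
qed

text \<open>A single push is invertible only for short vectors, so \<open>v\<close> is cut into
  \<open>N > p v\<close> equal pieces. Pushing successively from one division point to the next
  keeps the motion in direction \<open>v\<close> and the supports in \<open>p\<close>-balls around
  points of the segment.\<close>

lemma push:
  assumes p: "continuous_seminorm T p"
  obtains f g where "bilipschitz f g" "f x = x + v" "\<And>z. \<exists>c. f z = z + c *\<^sub>R v"
    "\<And>z. f z \<noteq> z \<Longrightarrow> \<exists>y\<in>closed_segment x (x + v). p (z - y) < 1"
proof -
  obtain N :: nat where N: "p v < real N" using reals_Archimedean2 by blast
  then have N0: "N > 0" using seminorm_nonneg [OF p, of v] by (cases N) auto
  have small: "(1 / real N) * p v < 1" using N N0 by simp
  have "\<exists>f g. bilipschitz f g \<and> f x = x + (real n / real N) *\<^sub>R v \<and> (\<forall>z. \<exists>c. f z = z + c *\<^sub>R v) \<and>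
      (\<forall>z. f z \<noteq> z \<longrightarrow> (\<exists>y\<in>closed_segment x (x + v). p (z - y) < 1))" if "n \<le> N" for n
    using that
  proof (induction n)
    case 0
    have "\<exists>c. z = z + c *\<^sub>R v" for z by (rule exI [of _ 0]) simp
    then show ?case using bilipschitz_id by (intro exI [of _ id]) (auto simp: id_def)
  next
    case (Suc n)
    then obtain f g where f: "bilipschitz f g" "f x = x + (real n / real N) *\<^sub>R v" "\<And>z. \<exists>c. f z = z + c *\<^sub>R v"
      "\<And>z. f z \<noteq> z \<Longrightarrow> \<exists>y\<in>closed_segment x (x + v). p (z - y) < 1" by auto
    let ?y = "x + (real n / real N) *\<^sub>R v"
    have y: "?y \<in> closed_segment x (x + v)"
      unfolding in_segment using Suc.prems N0
      by (intro exI [of _ "real n / real N"]) (auto simp: algebra_simps)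
    obtain f' g' where f': "bilipschitz f' g'" "f' ?y = ?y + (1 / real N) *\<^sub>R v" "\<And>z. \<exists>c. f' z = z + c *\<^sub>R v"
      "\<And>z. f' z \<noteq> z \<Longrightarrow> p (z - ?y) < 1"
      using small_push [OF p _ small, of ?y] by auto
    have "bilipschitz (f' \<circ> f) (g \<circ> g')" using f f' bilipschitz_comp by blast
    moreover have "(f' \<circ> f) x = x + (real (Suc n) / real N) *\<^sub>R v"
      using f f' by (simp add: add_divide_distrib scaleR_left_distrib add.assoc add.commute)
    moreover have "\<exists>c. (f' \<circ> f) z = z + c *\<^sub>R v" for z
    proof -
      obtain c c' where "f z = z + c *\<^sub>R v" "f' (f z) = f z + c' *\<^sub>R v" using f f' by blast
      then show ?thesis by (intro exI [of _ "c + c'"]) (simp add: scaleR_left_distrib)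
    qed
    moreover have "\<exists>y\<in>closed_segment x (x + v). p (z - y) < 1" if "(f' \<circ> f) z \<noteq> z" for z
    proof (cases "f z = z")
      case True
      then show ?thesis using that f'(4) [of z] y by auto
    qed (use f in blast)
    ultimately show ?case by blast
  qed
  from this [of N] show ?thesis using that N0 by auto
qed

end

section \<open>Metric locally convex spaces\<close>

locale metric_locally_convex =
  fixes d :: "'a::real_vector \<Rightarrow> 'a \<Rightarrow> real"
  assumes metric_lcs: "metric_lcs d"

sublocale metric_locally_convex \<subseteq> Metric_space UNIV d
  using metric_lcs by (simp add: metric_lcs_def)

sublocale metric_locally_convex \<subseteq> locally_convex "mtop d"
  using metric_lcs by unfold_locales (simp add: metric_lcs_def)

context metric_locally_convex
begin

lemma d_diff: "d x y = d 0 (y - x)"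
proof -
  have "d (x + - x) (y + - x) = d x y" using metric_lcs unfolding metric_lcs_def by blast
  then show ?thesis by simp
qed

lemma exists_seminorm_ball:
  assumes "r > 0"
  obtains p where "continuous_seminorm (mtop d) p" "\<And>x y. p (y - x) < 1 \<Longrightarrow> d x y < r"
proof -
  obtain p where p: "continuous_seminorm (mtop d) p" "{x. p x < 1} \<subseteq> mball 0 r"
    using exists_seminorm_zero [of "mball 0 r"] assms by auto
  have "d x y < r" if "p (y - x) < 1" for x y
    using that p(2) d_diff [of x y] by auto
  then show ?thesis using that p by blast
qed

lemma seminorm_ball:
  assumes "continuous_seminorm (mtop d) p" "e > 0"
  obtains r where "r > 0" "\<And>x y. d x y < r \<Longrightarrow> p (y - x) < e"
proof -
  have "openin (mtop d) {y. p (y - 0) < e}" using assms seminorm_open by blast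
  moreover have "0 \<in> {y. p (y - 0) < e}" using assms by (simp add: seminorm_zero)
  ultimately obtain r where r: "r > 0" "mball 0 r \<subseteq> {y. p (y - 0) < e}"
    unfolding openin_mtopology by blast
  have "p (y - x) < e" if "d x y < r" for x y using that r(2) d_diff [of x y] by auto
  then show ?thesis using that r by blast
qed

lemma in_set_cball: "z \<in> set_cball d A r \<longleftrightarrow> (\<exists>x\<in>A. d x z \<le> r)"
  by (simp add: set_cball_def)

lemma compactin_segment: "compactin (mtop d) (closed_segment x y)"
proof -
  have "continuous_map euclideanreal (mtop d) (\<lambda>s. s *\<^sub>R (y - x) + x)"
    using continuous_map_compose [OF continuous_scale_left continuous_translate] by (simp add: o_def)
  then have "compactin (mtop d) ((\<lambda>s. s *\<^sub>R (y - x) + x) ` {0..1})"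
    by (intro image_compactin [of euclideanreal]) (auto simp: compactin_euclidean_iff)
  moreover have "(\<lambda>s. s *\<^sub>R (y - x) + x) ` {0..1} = closed_segment x y"
    unfolding closed_segment_image_interval by (intro image_cong) (auto simp: algebra_simps)
  ultimately show ?thesis by simp
qed

text \<open>A Lebesgue number: otherwise points of \<open>K\<close> ever closer to the complement of
  \<open>Q\<close> would subconverge to a point of \<open>K\<close>, hence of the open set
  \<open>Q\<close>.\<close>

lemma tube_in_open:
  assumes K: "compactin (mtop d) K" and Q: "openin (mtop d) Q" "K \<subseteq> Q"
  obtains e where "e > 0" "\<And>x y. \<lbrakk>x \<in> K; d x y < e\<rbrakk> \<Longrightarrow> y \<in> Q"
proof (rule ccontr)
  assume "\<not> thesis"
  then have "\<exists>x y. x \<in> K \<and> d x y < 1 / real (Suc k) \<and> y \<notin> Q" for k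
    using that [of "1 / real (Suc k)"] by auto
  then obtain x y where xy: "\<And>k. x k \<in> K" "\<And>k. d (x k) (y k) < 1 / real (Suc k)" "\<And>k. y k \<notin> Q"
    by metis
  have "range x \<subseteq> K" using xy by blast
  then obtain l r where l: "l \<in> K" "strict_mono r" "limitin (mtop d) (x \<circ> r) l sequentially"
    using K unfolding compactin_sequentially by blast
  obtain e where e: "e > 0" "mball l e \<subseteq> Q" using Q l unfolding openin_mtopology by blast
  have "\<forall>\<^sub>F k in sequentially. (x \<circ> r) k \<in> UNIV \<and> d ((x \<circ> r) k) l < e / 2"
    using l(3) half_gt_zero [OF e(1)] unfolding limitin_metric by blast
  then have "\<forall>\<^sub>F k in sequentially. d ((x \<circ> r) k) l < e / 2"
    by (rule eventually_mono) blast
  moreover have "\<forall>\<^sub>F k in sequentially. 1 / real (Suc k) < e / 2"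
    using order_tendstoD(2) [OF LIMSEQ_inverse_real_of_nat, of "e / 2"] e by (simp add: inverse_eq_divide)
  then have "\<forall>\<^sub>F k in sequentially. 1 / real (Suc (r k)) < e / 2" using eventually_subseq l(2) by blast
  ultimately have "\<forall>\<^sub>F k in sequentially. d ((x \<circ> r) k) l < e / 2 \<and> 1 / real (Suc (r k)) < e / 2"
    by (rule eventually_conj)
  then obtain k where k: "d (x (r k)) l < e / 2" "1 / real (Suc (r k)) < e / 2"
    unfolding eventually_sequentially by auto
  have "d l (y (r k)) \<le> d l (x (r k)) + d (x (r k)) (y (r k))" by (rule triangle) auto
  then have "d l (y (r k)) < e" using k xy(2) [of "r k"] commute [of l "x (r k)"] by simp
  then show False using e xy(3) by auto
qed

lemma bilipschitz_continuous: "bilipschitz f g \<Longrightarrow> continuous_map (mtop d) (mtop d) f"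
  using seminorm_lipschitz_uniformly_continuous openin_topspace topspace_UNIV
  by (intro locally_uniformly_continuous_continuous exI [of _ UNIV]) (auto simp: bilipschitz_def)

lemma bilipschitz_sym: "bilipschitz f g \<Longrightarrow> bilipschitz g f"
  by (auto simp: bilipschitz_def)

lemma bilipschitz_homeo_group:
  assumes "bilipschitz f g" shows "f \<in> carrier (homeo_group (mtop d))"
proof (rule homeo_groupI [of _ _ g])
  show "homeomorphic_maps (mtop d) (mtop d) f g"
    using assms bilipschitz_continuous bilipschitz_sym [OF assms]
    by (auto simp: homeomorphic_maps_def bilipschitz_def)
qed auto

text \<open>The push is governed by a seminorm, the tube of a basic homeomorphism by the metric; a
  seminorm whose unit ball lies in the \<open>d\<close>-ball of radius \<open>r\<close> links the
  two.\<close>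

lemma exists_basic_homeo:
  assumes "r > 0"
  obtains f g where "bilipschitz f g" "basic_homeo d f x v r"
proof -
  obtain p where p: "continuous_seminorm (mtop d) p" "\<And>x y. p (y - x) < 1 \<Longrightarrow> d x y < r"
    using exists_seminorm_ball assms by blast
  obtain f g where f: "bilipschitz f g" "f x = x + v" "\<And>z. \<exists>c. f z = z + c *\<^sub>R v"
    "\<And>z. f z \<noteq> z \<Longrightarrow> \<exists>y\<in>closed_segment x (x + v). p (z - y) < 1"
    using push [OF p(1)] by blast
  have "supp f \<subseteq> set_cball d (closed_segment x (x + v)) r"
    unfolding supp_def in_set_cball [abs_def] using f(4) p(2) by (force simp: in_set_cball)
  then have "basic_homeo d f x v r"
    using f assms bilipschitz_homeo_group by (auto simp: basic_homeo_def)
  then show ?thesis using that f by blast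
qed

lemma bilipschitz_supp: "\<lbrakk>bilipschitz f g; z \<in> supp f\<rbrakk> \<Longrightarrow> f z \<in> supp f"
  by (simp add: bilipschitz_def supp_def) metis

lemma bilipschitz_supp_inverse: "bilipschitz f g \<Longrightarrow> supp g = supp f"
  by (simp add: bilipschitz_def supp_def set_eq_iff) metis

lemma exists_polygonal:
  fixes xs :: "nat \<Rightarrow> 'a"
  assumes "n \<ge> 1" "r > 0"
  defines "S \<equiv> (\<Union>i<n. set_cball d (closed_segment (xs i) (xs (Suc i))) r)"
  obtains f g where "bilipschitz f g" "polygonal d f S" "f (xs 0) = xs n" "supp f \<subseteq> S"
proof -
  have "\<exists>f g. bilipschitz f g \<and> basic_homeo d f (xs i) (xs (Suc i) - xs i) r" for i
    using exists_basic_homeo \<open>r > 0\<close> by metis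
  then obtain ks gs where ks: "\<And>i. bilipschitz (ks i) (gs i)"
    "\<And>i. basic_homeo d (ks i) (xs i) (xs (Suc i) - xs i) r" by metis
  have ks_sub: "supp (ks i) \<subseteq> set_cball d (closed_segment (xs i) (xs (Suc i))) r"
    "ks i (xs i) = xs (Suc i)" for i
    using ks(2) [of i] by (auto simp: basic_homeo_def)
  define F where "F m = fold (\<circ>) (map ks [0..<m]) id" for m
  have F_Suc: "F (Suc m) = ks m \<circ> F m" for m by (simp add: F_def)
  have "\<exists>g. bilipschitz (F m) g \<and> F m (xs 0) = xs m \<and>
      supp (F m) \<subseteq> (\<Union>i<m. set_cball d (closed_segment (xs i) (xs (Suc i))) r)" for m
  proof (induction m)
    case 0
    show ?case by (rule exI [of _ id]) (simp add: F_def bilipschitz_id supp_def flip: id_def)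
  next
    case (Suc m)
    then obtain g where g: "bilipschitz (F m) g" "F m (xs 0) = xs m"
      "supp (F m) \<subseteq> (\<Union>i<m. set_cball d (closed_segment (xs i) (xs (Suc i))) r)" by blast
    have "bilipschitz (F (Suc m)) (g \<circ> gs m)" unfolding F_Suc by (rule bilipschitz_comp [OF ks(1) g(1)])
    moreover have "F (Suc m) (xs 0) = xs (Suc m)" by (simp add: F_Suc g ks_sub)
    moreover have "supp (F (Suc m)) \<subseteq> supp (ks m) \<union> supp (F m)" by (auto simp: supp_def F_Suc)
    then have "supp (F (Suc m)) \<subseteq> (\<Union>i<Suc m. set_cball d (closed_segment (xs i) (xs (Suc i))) r)"
      using g(3) ks_sub(1) [of m] by (simp add: lessThan_Suc) blast
    ultimately show ?case by blast
  qed
  then obtain g where "bilipschitz (F n) g" "F n (xs 0) = xs n" "supp (F n) \<subseteq> S"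
    unfolding S_def by blast
  moreover have "polygonal d (F n) S"
    unfolding polygonal_def S_def F_def using assms(1,2) ks(2)
    by (intro exI [of _ n] exI [of _ xs] exI [of _ ks] exI [of _ r]) simp
  ultimately show ?thesis using that by blast
qed

lemma bilipschitz_image_uniformly_continuous:
  assumes f: "bilipschitz f g" and h: "bij h" "\<And>z. z \<in> U \<Longrightarrow> h z = f z"
  shows "group_uniformly_continuous_on (mtop d) U h"
    "group_uniformly_continuous_on (mtop d) (h ` U) (inv_into UNIV h)"
proof -
  have "group_uniformly_continuous_on (mtop d) U f"
    using f seminorm_lipschitz_uniformly_continuous by (simp add: bilipschitz_def)
  then show "group_uniformly_continuous_on (mtop d) U h"
    unfolding group_uniformly_continuous_on_def using h(2) by simp
  have "inv_into UNIV h y = g y" if "y \<in> h ` U" for y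
  proof -
    obtain x where x: "x \<in> U" "y = h x" using \<open>y \<in> h ` U\<close> by blast
    then have "inv_into UNIV h y = x" using h(1) by (simp add: bij_def)
    then show ?thesis using x f h(2) by (simp add: bilipschitz_def)
  qed
  moreover have "group_uniformly_continuous_on (mtop d) (h ` U) g"
    using f seminorm_lipschitz_uniformly_continuous by (simp add: bilipschitz_def)
  ultimately show "group_uniformly_continuous_on (mtop d) (h ` U) (inv_into UNIV h)"
    unfolding group_uniformly_continuous_on_def by simp
qed

lemma bilipschitz_bij: "bilipschitz f g \<Longrightarrow> bij f"
  unfolding bilipschitz_def by (metis bijI')

lemma bilipschitz_locally_bi_uc: "bilipschitz f g \<Longrightarrow> locally_bi_uc (mtop d) UNIV f"
  unfolding locally_bi_uc_def
  using bilipschitz_image_uniformly_continuous [of f g f UNIV] bilipschitz_bij [of f g]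
    openin_topspace [of "mtop d"]
  by (auto intro!: exI [of _ UNIV])

section \<open>Infinite products over separated families of tubes\<close>

definition separated :: "(nat \<Rightarrow> 'a set) \<Rightarrow> bool" where
  "separated S \<longleftrightarrow> (\<forall>x. \<exists>U. openin (mtop d) U \<and> x \<in> U \<and>
     (\<forall>i j. S i \<inter> U \<noteq> {} \<and> S j \<inter> U \<noteq> {} \<longrightarrow> i = j))"

lemma separated_disjoint: 
  assumes "separated S" "z \<in> S i" "z \<in> S j" shows "i = j"
  using assms unfolding separated_def by blast

lemma separated_comp: "\<lbrakk>separated S; inj \<sigma>\<rbrakk> \<Longrightarrow> separated (S \<circ> \<sigma>)"
  unfolding separated_def o_def inj_def by metis

text \<open>\<open>separated\<close> counts indices where \<open>discrete_family\<close> compares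
  sets, so the sets are disjoint and the factor active at a point is determined. Near every point
  the product coincides with one single factor and inherits its local properties.\<close>

lemma separated_product:
  assumes f: "\<And>i. bilipschitz (f i) (g i)" "\<And>i. supp (f i) \<subseteq> S i" and S: "separated S"
  obtains h where "h \<in> carrier (homeo_group (mtop d))" "locally_bi_uc (mtop d) UNIV h"
    "\<And>i z. z \<in> S i \<Longrightarrow> h z = f i z" "\<And>z. z \<notin> (\<Union>i. S i) \<Longrightarrow> h z = z"
proof -
  define glue where "glue k z = (if \<exists>i. z \<in> S i then k (THE i. z \<in> S i) z else z)"
    for k :: "nat \<Rightarrow> 'a \<Rightarrow> 'a" and z
  have in_S: "glue k z = k i z" if "z \<in> S i" for k i z
  proof -
    have "(THE j. z \<in> S j) = i" using that separated_disjoint [OF S] by blast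
    then show ?thesis using that by (auto simp: glue_def)
  qed
  have local: "\<exists>U i. openin (mtop d) U \<and> x \<in> U \<and> (\<forall>z\<in>U. glue k z = k i z)"
    if k: "\<And>i. supp (k i) \<subseteq> S i" for k x
  proof -
    obtain U where U: "openin (mtop d) U" "x \<in> U" "\<And>i j. \<lbrakk>S i \<inter> U \<noteq> {}; S j \<inter> U \<noteq> {}\<rbrakk> \<Longrightarrow> i = j"
      using S unfolding separated_def by meson
    \<comment> \<open>If \<open>U\<close> meets none of the sets, any \<open>i\<close> will do,
      since every factor is the identity on \<open>U\<close>.\<close>
    obtain i where i: "\<And>j. S j \<inter> U \<noteq> {} \<Longrightarrow> j = i" using U(3) by metis
    have "glue k z = k i z" if z: "z \<in> U" for z
    proof (cases "\<exists>j. z \<in> S j")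
      case True
      then obtain j where "z \<in> S j" by blast
      then have "j = i" using i z by blast
      then show ?thesis using in_S \<open>z \<in> S j\<close> by blast
    next
      case False
      then have "k i z = z" using k [of i] by (auto simp: supp_def)
      then show ?thesis using False by (simp add: glue_def)
    qed
    then show ?thesis using U by blast
  qed
  have gS: "supp (g i) \<subseteq> S i" for i using bilipschitz_supp_inverse f by metis
  have inverse: "glue k' (glue k z) = z"
    if k: "\<And>i. bilipschitz (k i) (k' i)" "\<And>i. supp (k i) \<subseteq> S i" for k k' z
  proof (cases "\<exists>i. z \<in> S i")
    case True
    then obtain i where i: "z \<in> S i" by blast
    have "k i z \<in> S i"
    proof (cases "k i z = z")
      case False
      then have "z \<in> supp (k i)" by (simp add: supp_def)
      then show ?thesis using bilipschitz_supp [OF k(1)] k(2) by blast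
    qed (use i in simp)
    then show ?thesis using in_S [OF i] in_S k(1) [of i] by (simp add: bilipschitz_def)
  qed (simp add: glue_def)
  have fg: "glue g (glue f z) = z" "glue f (glue g z) = z" for z
    using inverse [of f g] inverse [of g f] f gS bilipschitz_sym by blast+
  then have bij: "bij (glue f)" by (metis bijI')
  have cont: "continuous_map (mtop d) (mtop d) (glue k)"
    if k: "\<And>i. bilipschitz (k i) (k' i)" "\<And>i. supp (k i) \<subseteq> S i" for k k'
  proof (rule locally_uniformly_continuous_continuous)
    fix x
    obtain U i where U: "openin (mtop d) U" "x \<in> U" "\<forall>z\<in>U. glue k z = k i z" 
      using local [OF k(2)] by blast
    have "group_uniformly_continuous_on (mtop d) U (k i)"
      using k(1) [of i] seminorm_lipschitz_uniformly_continuous by (simp add: bilipschitz_def)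
    then have "group_uniformly_continuous_on (mtop d) U (glue k)"
      unfolding group_uniformly_continuous_on_def using U(3) by simp
    then show "\<exists>U. openin (mtop d) U \<and> x \<in> U \<and> group_uniformly_continuous_on (mtop d) U (glue k)"
      using U by blast
  qed
  have "homeomorphic_maps (mtop d) (mtop d) (glue f) (glue g)"
    using cont [OF f] cont [OF bilipschitz_sym [OF f(1)] gS] fg by (simp add: homeomorphic_maps_def)
  then have 1: "glue f \<in> carrier (homeo_group (mtop d))" by (rule homeo_groupI) auto
  have 2: "locally_bi_uc (mtop d) UNIV (glue f)"
    unfolding locally_bi_uc_def subtopology_UNIV
  proof
    fix x
    obtain U i where U: "openin (mtop d) U" "x \<in> U" "\<forall>z\<in>U. glue f z = f i z" 
      using local [OF f(2)] by blast
    moreover have "group_uniformly_continuous_on (mtop d) U (glue f)"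
      "group_uniformly_continuous_on (mtop d) (glue f ` U) (inv_into UNIV (glue f))"
      using bilipschitz_image_uniformly_continuous [OF f(1) bij, of U i] U(3) by blast+
    ultimately show "\<exists>U. openin (mtop d) U \<and> x \<in> U \<and> group_uniformly_continuous_on (mtop d) U (glue f) \<and>
        group_uniformly_continuous_on (mtop d) (glue f ` U) (inv_into UNIV (glue f))"
      by blast
  qed
  have 3: "glue f z = z" if "z \<notin> (\<Union>i. S i)" for z using that by (auto simp: glue_def)
  show ?thesis using that [OF 1 2 in_S 3] by blast
qed

text \<open>Two demands on the radii: a fraction of the clearance \<open>e n\<close> of
  \<open>P n\<close> from the other sets keeps tubes apart, and the bound \<open>1 / (n + 1)\<close>
  makes late tubes so thin that local finiteness passes from the cores to the tubes.\<close>

lemma separated_tubes: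
  fixes P :: "nat \<Rightarrow> 'a set"
  assumes comp: "\<And>n. compactin (mtop d) (P n)"
    and lf: "\<And>x. \<exists>U. openin (mtop d) U \<and> x \<in> U \<and> finite {n. P n \<inter> U \<noteq> {}}"
    and dj: "\<And>m n. m \<noteq> n \<Longrightarrow> P m \<inter> P n = {}"
    and Q: "openin (mtop d) Q" "\<And>n. P n \<subseteq> Q"
  obtains \<rho> where "\<And>n. \<rho> n > 0" "separated (\<lambda>n. set_cball d (P n) (\<rho> n))"
    "\<And>n. set_cball d (P n) (\<rho> n) \<subseteq> Q"
proof -
  have "\<exists>e>0. \<forall>x y. x \<in> P n \<and> d x y < e \<longrightarrow> y \<in> Q \<and> (\<forall>m. m \<noteq> n \<longrightarrow> y \<notin> P m)" for n
  proof -
    let ?Q = "Q - (\<Union>m\<in>-{n}. P m)"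
    have "openin (mtop d) ?Q"
    proof (subst openin_subopen, clarify)
      fix x assume x: "x \<in> Q" "x \<notin> (\<Union>m\<in>-{n}. P m)"
      obtain U where U: "openin (mtop d) U" "x \<in> U" "finite {n. P n \<inter> U \<noteq> {}}" using lf by blast
      \<comment> \<open>Within \<open>U\<close> only finitely many of the other compact sets occur,
        so there their union behaves as a closed set.\<close>
      let ?F = "{m. P m \<inter> U \<noteq> {}} - {n}"
      have "closedin (mtop d) (\<Union>m\<in>?F. P m)"
        using U comp compactin_imp_closedin [OF Hausdorff_space_mtopology] by (intro closedin_Union) auto
      then have "openin (mtop d) ((U \<inter> Q) - (\<Union>m\<in>?F. P m))" using U Q by (intro openin_diff) auto
      then show "\<exists>V. openin (mtop d) V \<and> x \<in> V \<and> V \<subseteq> ?Q"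
        using x U by (intro exI [of _ "(U \<inter> Q) - (\<Union>m\<in>?F. P m)"]) blast
    qed
    moreover have "P n \<subseteq> ?Q" using Q dj by blast
    ultimately obtain e where "e > 0" "\<And>x y. \<lbrakk>x \<in> P n; d x y < e\<rbrakk> \<Longrightarrow> y \<in> ?Q"
      using tube_in_open comp by metis
    then show ?thesis by (intro exI [of _ e]) auto
  qed
  then obtain e where e: "\<And>n. e n > 0"
    "\<And>n x y. \<lbrakk>x \<in> P n; d x y < e n\<rbrakk> \<Longrightarrow> y \<in> Q \<and> (\<forall>m. m \<noteq> n \<longrightarrow> y \<notin> P m)" by metis
  define \<rho> where "\<rho> n = min (e n / 3) (1 / real (Suc n))" for n
  define Tb where "Tb n = set_cball d (P n) (\<rho> n)" for n
  have \<rho>: "\<rho> n > 0" "\<rho> n \<le> e n / 3" "\<rho> n \<le> 1 / real (Suc n)" for n using e by (auto simp: \<rho>_def)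
  have near: "\<exists>x\<in>P n. d x z \<le> \<rho> n" if "z \<in> Tb n" for z n
    using that by (simp add: Tb_def in_set_cball)
  have "Tb n \<subseteq> Q" for n
  proof
    fix z assume "z \<in> Tb n"
    then obtain x where x: "x \<in> P n" "d x z \<le> \<rho> n" using near by blast
    then have "d x z < e n" using \<rho>(2) [of n] e(1) [of n] by simp
    then show "z \<in> Q" using x e(2) by blast
  qed
  moreover have "separated Tb"
    unfolding separated_def
  proof
    fix x
    obtain U where U: "openin (mtop d) U" "x \<in> U" "finite {n. P n \<inter> U \<noteq> {}}" using lf by blast
    obtain \<epsilon> where \<epsilon>: "\<epsilon> > 0" "mball x \<epsilon> \<subseteq> U" using U unfolding openin_mtopology by blast
    obtain N where N: "1 / real (Suc N) < \<epsilon> / 2" using \<epsilon> nat_approx_posE [of "\<epsilon> / 2"] by auto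
    \<comment> \<open>The indices up to \<open>N\<close> are added because their tubes may reach the
      ball around \<open>x\<close> although their cores miss \<open>U\<close>. They also make
      \<open>F\<close> nonempty, as \<open>Min\<close> requires.\<close>
    define F where "F = {n. P n \<inter> U \<noteq> {}} \<union> {..N}"
    have F: "finite F" "F \<noteq> {}" using U by (auto simp: F_def)
    have inF: "n \<in> F" if z: "z \<in> Tb n" "d x z < \<epsilon> / 2" for n z
    proof (rule ccontr)
      assume n: "n \<notin> F"
      then have "1 / real (Suc n) \<le> 1 / real (Suc N)" by (simp add: F_def frac_le)
      moreover obtain y where y: "y \<in> P n" "d y z \<le> \<rho> n" using near z by blast
      moreover have "d x y \<le> d x z + d z y" by (rule triangle) auto
      ultimately have "d x y < \<epsilon>" using z N \<rho>(3) [of n] commute [of z y] by linarith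
      then have "y \<in> U" using \<epsilon> by auto
      then show False using y n by (auto simp: F_def)
    qed
    \<comment> \<open>If tubes \<open>i\<close> and \<open>j\<close> both met the
      \<open>\<delta>\<close>-ball and \<open>e j \<le> e i\<close>, their cores would come closer
      than \<open>e i / 3 + e j / 3 + 2 * (e i / 6) \<le> e i\<close>.\<close>
    define \<delta> where "\<delta> = Min ((\<lambda>n. e n / 6) ` F)"
    have "\<delta> > 0" using F e by (simp add: \<delta>_def)
    have \<delta>: "\<delta> \<le> e n / 6" if "n \<in> F" for n
      unfolding \<delta>_def by (rule Min_le) (use F that in auto)
    define V where "V = mball x (min (\<epsilon> / 2) \<delta>)"
    have meets: "i = j" if ab: "a \<in> Tb i" "a \<in> V" "b \<in> Tb j" "b \<in> V" and le: "e i \<ge> e j" for i j a b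
    proof (rule ccontr)
      assume ne: "i \<noteq> j"
      have "i \<in> F" using ab inF by (auto simp: V_def)
      then have "\<delta> \<le> e i / 6" by (rule \<delta>)
      obtain y z where yz: "y \<in> P i" "d y a \<le> \<rho> i" "z \<in> P j" "d z b \<le> \<rho> j" using near ab by blast
      have "d y z \<le> d y a + d a z" "d a z \<le> d a x + d x z" "d x z \<le> d x b + d b z"
        by (rule triangle; simp)+
      moreover have "d a x < \<delta>" "d x b < \<delta>" using ab commute [of a x] by (auto simp: V_def)
      ultimately have "d y z < e i"
        using yz \<rho>(2) [of i] \<rho>(2) [of j] le \<open>\<delta> \<le> e i / 6\<close> commute [of b z] by linarith
      then show False using e(2) [OF yz(1)] yz(3) ne by metis
    qed
    have "i = j" if "Tb i \<inter> V \<noteq> {}" "Tb j \<inter> V \<noteq> {}" for i j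
    proof -
      obtain a b where "a \<in> Tb i" "a \<in> V" "b \<in> Tb j" "b \<in> V" using \<open>Tb i \<inter> V \<noteq> {}\<close> \<open>Tb j \<inter> V \<noteq> {}\<close> by blast
      then show ?thesis using meets [of a i b j] meets [of b j a i] by (cases "e i \<ge> e j") auto
    qed
    moreover have "openin (mtop d) V" "x \<in> V" using \<epsilon> \<open>\<delta> > 0\<close> by (auto simp: V_def)
    ultimately show "\<exists>U. openin (mtop d) U \<and> x \<in> U \<and> (\<forall>i j. Tb i \<inter> U \<noteq> {} \<and> Tb j \<inter> U \<noteq> {} \<longrightarrow> i = j)"
      by blast
  qed
  ultimately show ?thesis using that [of \<rho>] \<rho>(1) by (simp add: Tb_def [abs_def])
qed

lemma locally_finite_compact:
  fixes P :: "nat \<Rightarrow> 'a set"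
  assumes K: "compactin (mtop d) K"
    and lf: "\<And>x. \<exists>U. openin (mtop d) U \<and> x \<in> U \<and> finite {n. P n \<inter> U \<noteq> {}}"
  shows "finite {n. P n \<inter> K \<noteq> {}}"
proof -
  obtain U where U: "\<And>x. openin (mtop d) (U x)" "\<And>x. x \<in> U x" "\<And>x. finite {n. P n \<inter> U x \<noteq> {}}"
    using lf by metis
  have "\<exists>\<F>. finite \<F> \<and> \<F> \<subseteq> range U \<and> K \<subseteq> \<Union>\<F>"
    by (rule compactinD [OF K]) (use U in auto)
  then obtain \<F> where \<F>: "finite \<F>" "\<F> \<subseteq> range U" "K \<subseteq> \<Union>\<F>" by blast
  have "{n. P n \<inter> K \<noteq> {}} \<subseteq> (\<Union>V\<in>\<F>. {n. P n \<inter> V \<noteq> {}})" using \<F>(3) by blast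
  moreover have "finite {n. P n \<inter> V \<noteq> {}}" if "V \<in> \<F>" for V using \<F>(2) U(3) that by auto
  then have "finite (\<Union>V\<in>\<F>. {n. P n \<inter> V \<noteq> {}})" using \<F>(1) by simp
  ultimately show ?thesis using finite_subset by blast
qed

text \<open>A compact set meets only finitely many members of the family, so a greedy choice works:
  the next index exceeds a bound valid for all indices up to the current one.\<close>

lemma disjoint_subsequence:
  fixes P :: "nat \<Rightarrow> 'a set"
  assumes comp: "\<And>n. compactin (mtop d) (P n)"
    and lf: "\<And>x. \<exists>U. openin (mtop d) U \<and> x \<in> U \<and> finite {n. P n \<inter> U \<noteq> {}}"
  obtains \<sigma> :: "nat \<Rightarrow> nat"
  where "strict_mono \<sigma>" "\<And>m n. m \<noteq> n \<Longrightarrow> P (\<sigma> m) \<inter> P (\<sigma> n) = {}"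
proof -
  have "\<exists>b. \<forall>j\<le>n. \<forall>m\<ge>b. P j \<inter> P m = {}" for n
  proof -
    have "finite (\<Union>j\<le>n. {m. P m \<inter> P j \<noteq> {}})" using locally_finite_compact [OF comp lf] by blast
    then obtain b where "\<forall>m\<in>(\<Union>j\<le>n. {m. P m \<inter> P j \<noteq> {}}). m < b"
      unfolding finite_nat_set_iff_bounded by blast
    then show ?thesis by (intro exI [of _ b]) fastforce
  qed
  then obtain b where b: "\<And>n j m. \<lbrakk>j \<le> n; m \<ge> b n\<rbrakk> \<Longrightarrow> P j \<inter> P m = {}" by metis
  define \<sigma> where "\<sigma> = rec_nat 0 (\<lambda>_ k. max (Suc k) (b k))"
  have \<sigma>: "\<sigma> (Suc k) = max (Suc (\<sigma> k)) (b (\<sigma> k))" for k by (simp add: \<sigma>_def)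
  have sm: "strict_mono \<sigma>" by (simp add: strict_mono_Suc_iff \<sigma> less_max_iff_disj)
  have lt: "P (\<sigma> m) \<inter> P (\<sigma> n) = {}" if "m < n" for m n
  proof -
    obtain k where k: "n = Suc k" "m \<le> k" using \<open>m < n\<close> by (cases n) auto
    then have "\<sigma> m \<le> \<sigma> k" using sm strict_mono_less_eq by blast
    moreover have "\<sigma> n \<ge> b (\<sigma> k)" using \<sigma> k by simp
    ultimately show ?thesis using b by blast
  qed
  have dj: "P (\<sigma> m) \<inter> P (\<sigma> n) = {}" if "m \<noteq> n" for m n
    using lt [of m n] lt [of n m] that by (cases "m < n") (auto simp: Int_commute)
  show ?thesis by (rule that [OF sm]) (rule dj)
qed

end

section \<open>Restricting supported homeomorphisms to a subspace\<close>

lemma homeo_group_restrict: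
  assumes fg: "homeomorphic_maps T T f g" and X: "X \<subseteq> topspace T"
    and f: "\<And>x. x \<in> topspace T - X \<Longrightarrow> f x = x"
  shows "homeomorphic_maps (subtopology T X) (subtopology T X) (restrict f X) (restrict g X)"
    "\<And>x. x \<in> topspace T - X \<Longrightarrow> g x = x"
proof -
  have gf: "\<And>x. x \<in> topspace T \<Longrightarrow> g (f x) = x" "\<And>x. x \<in> topspace T \<Longrightarrow> f (g x) = x"
    and c: "continuous_map T T f" "continuous_map T T g"
    using fg by (auto simp: homeomorphic_maps_def)
  show g: "g x = x" if "x \<in> topspace T - X" for x using gf(1) [of x] f [OF that] that by auto
  have tp: "f x \<in> topspace T" "g x \<in> topspace T" if "x \<in> topspace T" for x
    using c that by (auto simp: continuous_map_def)
  \<comment> \<open>A value outside \<open>X\<close> would be fixed by \<open>f\<close>, and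
    injectivity would give \<open>f x = x\<close>.\<close>
  have "f x \<in> X" if x: "x \<in> X" for x
  proof (rule ccontr)
    assume "f x \<notin> X"
    then have "f (f x) = f x" using f tp x X by blast
    then have "f x = x" using gf(1) tp x X by (metis subsetD)
    then show False using \<open>f x \<notin> X\<close> x by simp
  qed
  moreover have "g x \<in> X" if x: "x \<in> X" for x
  proof (rule ccontr)
    assume "g x \<notin> X"
    then have "g (g x) = g x" using g tp x X by blast
    then have "g x = x" using gf(2) tp x X by (metis subsetD)
    then show False using \<open>g x \<notin> X\<close> x by simp
  qed
  moreover have "continuous_map (subtopology T X) T (restrict f X)"
    "continuous_map (subtopology T X) T (restrict g X)"
    using c by (auto intro: continuous_map_eq [OF continuous_map_from_subtopology])
  ultimately show "homeomorphic_maps (subtopology T X) (subtopology T X) (restrict f X) (restrict g X)"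
    using X gf by (auto simp: homeomorphic_maps_def continuous_map_in_subtopology image_subset_iff subset_iff)
qed

lemma inv_homeo_group:
  assumes "f \<in> carrier (homeo_group X)" "homeomorphic_maps X X f g"
  shows "inv\<^bsub>homeo_group X\<^esub> f = restrict g (topspace X)"
proof -
  interpret group "homeo_group X" by (rule group_homeo_group)
  have hm: "homeomorphic_maps X X f (restrict g (topspace X))"
    by (rule homeomorphic_maps_eq [OF assms(2)]) auto
  then have g: "restrict g (topspace X) \<in> carrier (homeo_group X)"
    by (meson homeo_groupI homeomorphic_maps_sym restrict_extensional)
  have "restrict g (topspace X) \<otimes>\<^bsub>homeo_group X\<^esub> f = \<one>\<^bsub>homeo_group X\<^esub>"
    using hm homeo_group_mult [OF g assms(1)]
    by (simp add: homeo_group_one compose_def homeomorphic_maps_def cong: restrict_cong)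
  then show ?thesis using inv_equality assms(1) g by simp
qed

text \<open>The general form of \<open>P_open\<close>: that the restrictions form a group depends on
  supports only, not on polygonal maps.\<close>

definition supported_restrictions :: "'a topology \<Rightarrow> ('a \<Rightarrow> 'a) set \<Rightarrow> 'a set \<Rightarrow> ('a \<Rightarrow> 'a) set" where
  "supported_restrictions T G X = {restrict g X |g. g \<in> G \<and> (\<forall>x\<in>topspace T - X. g x = x)}"

lemma subgroup_supported_restrictions:
  assumes G: "subgroup G (homeo_group T)" and X: "X \<subseteq> topspace T"
  shows "subgroup (supported_restrictions T G X) (homeo_group (subtopology T X))"
proof -
  interpret T: group "homeo_group T" by (rule group_homeo_group)
  interpret S: group "homeo_group (subtopology T X)" by (rule group_homeo_group)
  interpret G: subgroup G "homeo_group T" by fact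
  let ?R = "supported_restrictions T G X"
  have tX: "topspace (subtopology T X) = X" using X by auto
  have inverse: "restrict g X \<in> carrier (homeo_group (subtopology T X)) \<and>
      inv\<^bsub>homeo_group (subtopology T X)\<^esub> (restrict g X) \<in> ?R"
    if g: "g \<in> G" "\<And>x. x \<in> topspace T - X \<Longrightarrow> g x = x" for g
  proof -
    obtain k where k: "homeomorphic_maps T T g k"
      using homeo_group_inverse G.subset g(1) by blast
    have hm: "homeomorphic_maps (subtopology T X) (subtopology T X) (restrict g X) (restrict k X)"
      and kX: "\<And>x. x \<in> topspace T - X \<Longrightarrow> k x = x"
      using homeo_group_restrict [OF k X g(2)] by auto
    have c: "restrict g X \<in> carrier (homeo_group (subtopology T X))"
      using homeo_groupI [OF hm] tX by simp
    have "inv\<^bsub>homeo_group T\<^esub> g = restrict k (topspace T)"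
      using inv_homeo_group k g G.subset by blast
    then have "restrict k (topspace T) \<in> G" using G.m_inv_closed [OF g(1)] by simp
    moreover have "inv\<^bsub>homeo_group (subtopology T X)\<^esub> (restrict g X) = restrict (restrict k (topspace T)) X"
      using inv_homeo_group [OF c hm] tX X by (simp add: Int_absorb1 Int_absorb2)
    ultimately have "inv\<^bsub>homeo_group (subtopology T X)\<^esub> (restrict g X) \<in> ?R"
      unfolding supported_restrictions_def
      by (intro CollectI exI [of _ "restrict k (topspace T)"]) (use kX in auto)
    then show ?thesis using c by blast
  qed
  show ?thesis
  proof (rule S.subgroupI)
    show "?R \<subseteq> carrier (homeo_group (subtopology T X))"
      using inverse by (auto simp: supported_restrictions_def)
    have "restrict \<one>\<^bsub>homeo_group T\<^esub> X \<in> ?R"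
      unfolding supported_restrictions_def
      by (intro CollectI exI [of _ "\<one>\<^bsub>homeo_group T\<^esub>"])
        (use G.one_closed in \<open>auto simp: homeo_group_one\<close>)
    then show "?R \<noteq> {}" by blast
  next
    fix a assume "a \<in> ?R"
    then show "inv\<^bsub>homeo_group (subtopology T X)\<^esub> a \<in> ?R"
      using inverse by (auto simp: supported_restrictions_def)
  next
    fix a b assume "a \<in> ?R" "b \<in> ?R"
    then obtain g h where gh: "g \<in> G" "h \<in> G" "a = restrict g X" "b = restrict h X"
      "\<And>x. x \<in> topspace T - X \<Longrightarrow> g x = x" "\<And>x. x \<in> topspace T - X \<Longrightarrow> h x = x"
      unfolding supported_restrictions_def by blast
    have ab: "a \<in> carrier (homeo_group (subtopology T X))" "b \<in> carrier (homeo_group (subtopology T X))"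
      using inverse gh by auto
    have m: "g \<otimes>\<^bsub>homeo_group T\<^esub> h = compose (topspace T) g h"
      using homeo_group_mult gh(1,2) G.subset by blast
    have "h x \<in> X" if "x \<in> X" for x
      using ab(2) that gh(4) Bij_imp_funcset tX by (force simp: homeo_group_carrier)
    then have "a \<otimes>\<^bsub>homeo_group (subtopology T X)\<^esub> b = restrict (g \<otimes>\<^bsub>homeo_group T\<^esub> h) X"
      unfolding m homeo_group_mult [OF ab] tX using gh X by (auto simp: compose_def fun_eq_iff)
    moreover have "(g \<otimes>\<^bsub>homeo_group T\<^esub> h) x = x" if "x \<in> topspace T - X" for x
      using gh that by (simp add: m compose_eq)
    ultimately show "a \<otimes>\<^bsub>homeo_group (subtopology T X)\<^esub> b \<in> ?R"
      using G.m_closed [OF gh(1,2)] unfolding supported_restrictions_def by blast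
  qed
qed

lemma convex_seminorm_ball:
  assumes p: "continuous_seminorm T p" shows "convex {z. p (z - x) < r}"
proof (rule convexI, clarify)
  fix y z :: 'a and u v :: real
  assume *: "p (y - x) < r" "p (z - x) < r" "0 \<le> u" "0 \<le> v" "u + v = 1"
  have "u *\<^sub>R y + v *\<^sub>R z - x = u *\<^sub>R y + v *\<^sub>R z - (u + v) *\<^sub>R x" using * by simp
  also have "\<dots> = u *\<^sub>R (y - x) + v *\<^sub>R (z - x)" by (simp add: algebra_simps)
  finally have "p (u *\<^sub>R y + v *\<^sub>R z - x) \<le> u * p (y - x) + v * p (z - x)"
    using seminorm_add [OF p, of "u *\<^sub>R (y - x)" "v *\<^sub>R (z - x)"] * by (simp add: seminorm_scale [OF p])
  also have "\<dots> < r" using convex_bound_lt * by blast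
  finally show "p (u *\<^sub>R y + v *\<^sub>R z - x) < r" .
qed

section \<open>(P2) and (P3) for the polygonal group\<close>

context metric_locally_convex
begin

text \<open>A single polygonal map enters \<open>P_hat\<close> as a constant family; discreteness
  compares sets, so repeating one set under all indices is harmless.\<close>

lemma P_hat_polygonal:
  assumes "bilipschitz f g" "polygonal d f S" "supp f \<subseteq> S" "S \<subseteq> mball c r"
  shows "f \<in> P_hat d"
proof -
  have "mbounded (supp f)" using assms mbounded_mball mbounded_subset by (meson order_trans)
  moreover have "discrete_family (mtop d) (range (\<lambda>_::nat. S))"
    unfolding discrete_family_def by (auto intro: openin_topspace)
  ultimately show ?thesis
    unfolding P_hat_def
    using assms bilipschitz_homeo_group bilipschitz_locally_bi_uc
    by (intro CollectI conjI exI [of _ "\<lambda>_. f"] exI [of _ "\<lambda>_. S"]) (auto simp: supp_def)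
qed

lemma P_hat_separated:
  assumes f: "\<And>i. bilipschitz (f i) (g i)" "\<And>i. supp (f i) \<subseteq> S i" "\<And>i. polygonal d (f i) (S i)"
    and S: "separated S" "\<And>i. S i \<subseteq> mball c r"
  obtains h where "h \<in> P_hat d" "\<And>i z. z \<in> S i \<Longrightarrow> h z = f i z" "\<And>z. z \<notin> (\<Union>i. S i) \<Longrightarrow> h z = z"
proof -
  obtain h where h: "h \<in> carrier (homeo_group (mtop d))" "locally_bi_uc (mtop d) UNIV h"
    "\<And>i z. z \<in> S i \<Longrightarrow> h z = f i z" "\<And>z. z \<notin> (\<Union>i. S i) \<Longrightarrow> h z = z"
    using separated_product [OF f(1,2) S(1)] by blast
  have "supp h \<subseteq> (\<Union>i. S i)" using h(4) by (auto simp: supp_def)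
  also have "\<dots> \<subseteq> mball c r" using S(2) by (rule UN_least)
  finally have "mbounded (supp h)" using mbounded_mball mbounded_subset by blast
  moreover have "discrete_family (mtop d) (range S)"
    unfolding discrete_family_def
  proof
    fix x
    obtain U where "openin (mtop d) U" "x \<in> U" "\<And>i j. \<lbrakk>S i \<inter> U \<noteq> {}; S j \<inter> U \<noteq> {}\<rbrakk> \<Longrightarrow> i = j"
      using S(1) unfolding separated_def by meson
    then show "\<exists>U. openin (mtop d) U \<and> x \<in> U \<and>
        (\<forall>A\<in>range S. \<forall>B\<in>range S. A \<inter> U \<noteq> {} \<and> B \<inter> U \<noteq> {} \<longrightarrow> A = B)"
      by (intro exI [of _ U]) fast
  qed
  ultimately have "h \<in> P_hat d"
    unfolding P_hat_def using h f(3)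
    by (intro CollectI conjI exI [of _ f] exI [of _ S]) auto
  then show ?thesis using that h by blast
qed

lemma subgroup_P_space: "subgroup (P_space d) (homeo_group (mtop d))"
  unfolding P_space_def
  by (rule group.generate_is_subgroup [OF group_homeo_group]) (auto simp: P_hat_def)

lemma P_open_eq: "P_open d X = supported_restrictions (mtop d) (P_space d) X"
  by (auto simp: P_open_def supported_restrictions_def)

lemma subgroup_P_open: "subgroup (P_open d X) (homeo_group (subtopology (mtop d) X))"
  unfolding P_open_eq by (rule subgroup_supported_restrictions [OF subgroup_P_space]) simp

lemma P_open_if_P_hat: "\<lbrakk>h \<in> P_hat d; supp h \<subseteq> X\<rbrakk> \<Longrightarrow> restrict h X \<in> P_open d X"
  unfolding P_open_def P_space_def supp_def by (blast intro: generate.incl)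

text \<open>A polygon with one edge, with a tube thin enough to stay in \<open>Q\<close>; the metric
  ball around \<open>Q\<close> supplies the bounded support that \<open>P_hat\<close>
  demands.\<close>

lemma P_open_push:
  assumes Q: "openin (mtop d) Q" "Q \<subseteq> X" "Q \<subseteq> mball c r" "closed_segment x y \<subseteq> Q"
  obtains h where "h \<in> P_open d X" "h x = y" "\<And>z. z \<in> X - Q \<Longrightarrow> h z = z"
proof -
  obtain e where e: "e > 0" "\<And>a b. \<lbrakk>a \<in> closed_segment x y; d a b < e\<rbrakk> \<Longrightarrow> b \<in> Q"
    using tube_in_open [OF compactin_segment Q(1,4)] by blast
  define xs where "xs i = (if i = 0 then x else y)" for i :: nat
  define S where "S = set_cball d (closed_segment x y) (e / 2)"
  have S_eq: "(\<Union>i<1. set_cball d (closed_segment (xs i) (xs (Suc i))) (e / 2)) = S"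
    by (simp add: xs_def S_def lessThan_Suc)
  obtain f g where f: "bilipschitz f g" "polygonal d f S" "f (xs 0) = xs 1" "supp f \<subseteq> S"
    using exists_polygonal [of 1 "e / 2" xs] e unfolding S_eq by auto
  then have "f x = y" by (simp add: xs_def)
  have SQ: "S \<subseteq> Q"
  proof
    fix z assume "z \<in> S"
    then obtain a where "a \<in> closed_segment x y" "d a z \<le> e / 2" by (auto simp: S_def in_set_cball)
    then show "z \<in> Q" using e by auto
  qed
  have "f \<in> P_hat d" using P_hat_polygonal [OF f(1,2,4)] SQ Q(3) by blast
  then have "restrict f X \<in> P_open d X" using P_open_if_P_hat f(4) SQ Q(2) by blast
  moreover have "f z = z" if "z \<notin> Q" for z using that SQ f(4) by (auto simp: supp_def)
  moreover have "x \<in> X" using Q by auto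
  ultimately show ?thesis using that [of "restrict f X"] \<open>f x = y\<close> by auto
qed

lemma exists_seminorm_small:
  assumes U: "openin (mtop d) U" "x \<in> U" and r: "r > 0"
  obtains p where "continuous_seminorm (mtop d) p" "{z. p (z - x) < 1} \<subseteq> U" "{z. p (z - x) < 1} \<subseteq> mball x r"
proof -
  have "openin (mtop d) (U \<inter> mball x r)" "x \<in> U \<inter> mball x r" using U r by auto
  then show ?thesis using exists_seminorm that by (metis le_inf_iff)
qed

lemma P_open_moving:
  assumes nz: "(UNIV :: 'a set) \<noteq> {0}" and U: "openin (mtop d) U" "U \<noteq> {}" "U \<subseteq> X"
  shows "\<exists>g\<in>P_open d X. g \<noteq> \<one>\<^bsub>homeo_group (subtopology (mtop d) X)\<^esub> \<and> (\<forall>x\<in>X - U. g x = x)"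
proof -
  obtain x where x: "x \<in> U" using U by blast
  obtain p where p: "continuous_seminorm (mtop d) p" "{z. p (z - x) < 1} \<subseteq> U" "{z. p (z - x) < 1} \<subseteq> mball x 1"
    using exists_seminorm_small [OF U(1) x, of 1] by auto
  obtain v :: 'a where v: "v \<noteq> 0" using nz by blast
  define c where "c = 1 / (p v + 1)"
  have pv: "p v \<ge> 0" using seminorm_nonneg [OF p(1)] by simp
  then have c: "c > 0" "p (c *\<^sub>R v) < 1" by (auto simp: c_def seminorm_scale [OF p(1)])
  let ?Q = "{z. p (z - x) < 1}"
  have "closed_segment x (x + c *\<^sub>R v) \<subseteq> ?Q"
    using c seminorm_zero [OF p(1)] by (intro closed_segment_subset convex_seminorm_ball [OF p(1)]) auto
  moreover have "?Q \<subseteq> X" using p(2) U(3) by blast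
  ultimately obtain h where h: "h \<in> P_open d X" "h x = x + c *\<^sub>R v" "\<And>z. z \<in> X - ?Q \<Longrightarrow> h z = z"
    using P_open_push [OF seminorm_open [OF p(1)] _ p(3)] by blast
  have "h x \<noteq> x" "x \<in> X" using h(2) c v x U by auto
  then have "h \<noteq> \<one>\<^bsub>homeo_group (subtopology (mtop d) X)\<^esub>" by (auto simp: homeo_group_one)
  moreover have "\<forall>z\<in>X - U. h z = z" using h(3) p(2) by blast
  ultimately show ?thesis using h(1) by blast
qed

text \<open>A whole convex ball around \<open>x\<close> is reached, since the segment from
  \<open>x\<close> to any of its points stays inside. Half the distance to \<open>y\<close> as
  radius leaves a neighbourhood of \<open>y\<close> unmoved.\<close>

lemma P_open_dense_orbits:
  assumes X: "openin (mtop d) X" "x \<in> X" "y \<in> X" "x \<noteq> y"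
  shows "somewhere_dense (subtopology (mtop d) X)
    {g x |g. g \<in> P_open d X \<and> locally_identity (subtopology (mtop d) X) g y}" (is "somewhere_dense ?T ?A")
proof -
  define \<rho> where "\<rho> = d x y / 2"
  have \<rho>: "\<rho> > 0" using X(4) by (simp add: \<rho>_def)
  obtain p where p: "continuous_seminorm (mtop d) p" "{z. p (z - x) < 1} \<subseteq> X" "{z. p (z - x) < 1} \<subseteq> mball x \<rho>"
    using exists_seminorm_small [OF X(1,2) \<rho>] by blast
  let ?Q = "{z. p (z - x) < 1}"
  have "?Q \<subseteq> ?A"
  proof
    fix w assume w: "w \<in> ?Q"
    have "closed_segment x w \<subseteq> ?Q"
      using w seminorm_zero [OF p(1)] by (intro closed_segment_subset convex_seminorm_ball [OF p(1)]) auto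
    then obtain h where h: "h \<in> P_open d X" "h x = w" "\<And>z. z \<in> X - ?Q \<Longrightarrow> h z = z"
      using P_open_push [OF seminorm_open [OF p(1)] p(2,3)] by blast
    let ?S = "X \<inter> mball y \<rho>"
    have "z \<notin> ?Q" if "z \<in> ?S" for z
    proof
      assume "z \<in> ?Q"
      then have "d x z < \<rho>" "d y z < \<rho>" using p(3) that by auto
      moreover have "d x y \<le> d x z + d z y" by (rule triangle) auto
      ultimately show False using commute [of y z] by (simp add: \<rho>_def)
    qed
    then have "\<forall>s\<in>?S. h s = s" using h(3) by blast
    moreover have "openin ?T ?S" by (intro openin_subtopology_Int2) simp
    ultimately have "locally_identity ?T h y" unfolding locally_identity_def using X \<rho> by (intro exI [of _ ?S]) auto
    then show "w \<in> ?A" using h by blast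
  qed
  moreover have oQ: "openin ?T ?Q"
    using seminorm_open [OF p(1)] p(2) X(1) by (simp add: openin_open_subtopology)
  ultimately have "?Q \<subseteq> ?T interior_of (?T closure_of ?A)"
    by (intro interior_of_maximal) (meson closure_of_mono closure_of_subset openin_subset order_trans)
  moreover have "x \<in> ?Q" using seminorm_zero [OF p(1)] by simp
  ultimately show ?thesis unfolding somewhere_dense_def by blast
qed

section \<open>Dissecting discrete sets\<close>

lemma seminorm_tendsto_zero:
  assumes p: "continuous_seminorm (mtop d) p" and z: "\<And>k. d x (z k) < 1 / real (Suc k)"
  shows "(\<lambda>k. p (z k - x)) \<longlonglongrightarrow> 0"
proof (rule LIMSEQ_I)
  fix e :: real assume "e > 0"
  then obtain r where r: "r > 0" "\<And>x y. d x y < r \<Longrightarrow> p (y - x) < e" using seminorm_ball p by blast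
  obtain N where N: "1 / real (Suc N) < r" using nat_approx_posE r by blast
  have "p (z k - x) < e" if "k \<ge> N" for k
  proof (rule r(2))
    have "1 / real (Suc k) \<le> 1 / real (Suc N)" using that by (simp add: frac_le)
    then show "d x (z k) < r" using z [of k] N by linarith
  qed
  then show "\<exists>N. \<forall>k\<ge>N. norm (p (z k - x) - 0) < e"
    using seminorm_nonneg [OF p] by (intro exI [of _ N]) auto
qed

text \<open>A limit of points \<open>x0 + s (a n - x0) + s' u\<close> with \<open>s\<close> bounded away from \<open>0\<close> would yield
  an accumulation point of the sequence \<open>a\<close>.\<close>

lemma scaled_locally_finite:
  fixes a :: "nat \<Rightarrow> 'a" and x0 u x :: 'a and t :: real
  assumes a: "\<And>y. \<exists>N. openin (mtop d) N \<and> y \<in> N \<and> finite {n. a n \<in> N}" and t: "0 < t"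
  defines "R \<equiv> \<lambda>n. {x0 + s *\<^sub>R (a n - x0) + s' *\<^sub>R u |s s'. t \<le> s \<and> s \<le> 1 \<and> 0 \<le> s' \<and> s' \<le> 1}"
  shows "\<exists>N. openin (mtop d) N \<and> x \<in> N \<and> finite {n. R n \<inter> N \<noteq> {}}"
proof (rule ccontr)
  assume no: "\<not> ?thesis"
  have "infinite {n. R n \<inter> mball x (1 / real (Suc k)) \<noteq> {}}" for k
    using no openin_mball [of x "1 / real (Suc k)"] by auto
  then obtain \<nu> where \<nu>: "strict_mono \<nu>" "\<And>k. R (\<nu> k) \<inter> mball x (1 / real (Suc k)) \<noteq> {}"
    using strict_mono_choice [of "\<lambda>k n. R n \<inter> mball x (1 / real (Suc k)) \<noteq> {}"] by blast
  have "\<exists>s s'. t \<le> s \<and> s \<le> 1 \<and> 0 \<le> s' \<and> s' \<le> 1 \<and>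
      d x (x0 + s *\<^sub>R (a (\<nu> k) - x0) + s' *\<^sub>R u) < 1 / real (Suc k)" for k
    using \<nu>(2) [of k] unfolding R_def by auto
  then obtain s s' where s: "\<And>k. t \<le> s k \<and> s k \<le> 1 \<and> 0 \<le> s' k \<and> s' k \<le> (1::real)"
    and near: "\<And>k. d x (x0 + s k *\<^sub>R (a (\<nu> k) - x0) + s' k *\<^sub>R u) < 1 / real (Suc k)" by metis
  define z where "z k = x0 + s k *\<^sub>R (a (\<nu> k) - x0) + s' k *\<^sub>R u" for k
  have "seq_compact ({t..1} \<times> {0..1::real})" by (intro compact_imp_seq_compact compact_Times compact_Icc)
  then obtain l r where l: "l \<in> {t..1} \<times> {0..1}" "strict_mono r" "((\<lambda>k. (s k, s' k)) \<circ> r) \<longlonglongrightarrow> l"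
    using s by (elim seq_compactE [where f = "\<lambda>k. (s k, s' k)"]) auto
  obtain l1 l2 where l12: "l = (l1, l2)" by force
  have l1: "l1 > 0" using l l12 t by auto
  have lims: "(\<lambda>k. s (r k)) \<longlonglongrightarrow> l1" "(\<lambda>k. s' (r k)) \<longlonglongrightarrow> l2"
    using tendsto_fst [OF l(3)] tendsto_snd [OF l(3)] by (simp_all add: l12 o_def)
  have sr: "s (r k) > 0" for k using s [of "r k"] t by linarith
  \<comment> \<open>The solution of \<open>x = x0 + l1 (y - x0) + l2 u\<close>, which exists as
    \<open>l1 \<ge> t > 0\<close>; the points \<open>a (\<nu> (r k))\<close> must approach
    it.\<close>
  define y where "y = x0 + (1 / l1) *\<^sub>R (x - x0 - l2 *\<^sub>R u)"
  obtain N where N: "openin (mtop d) N" "y \<in> N" "finite {n. a n \<in> N}" using a by blast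
  then obtain q where q: "continuous_seminorm (mtop d) q" "{w. q (w - y) < 1} \<subseteq> N" using exists_seminorm by blast
  \<comment> \<open>The three terms account separately for the errors in \<open>z\<close>, in the
    factor \<open>s\<close> and in the coefficient \<open>s'\<close>.\<close>
  define \<eta> where "\<eta> k = (1 / s (r k)) * q (z (r k) - x) + \<bar>1 / s (r k) - 1 / l1\<bar> * q (x - x0)
      + \<bar>s' (r k) / s (r k) - l2 / l1\<bar> * q u" for k
  have le: "q (a (\<nu> (r k)) - y) \<le> \<eta> k" for k
  proof -
    have "a (\<nu> (r k)) - x0 = (1 / s (r k)) *\<^sub>R (z (r k) - x0 - s' (r k) *\<^sub>R u)"
      using sr [of k] by (simp add: z_def)
    then have "a (\<nu> (r k)) - y = (1 / s (r k)) *\<^sub>R (z (r k) - x0 - s' (r k) *\<^sub>R u) - (1 / l1) *\<^sub>R (x - x0 - l2 *\<^sub>R u)"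
      by (simp add: y_def algebra_simps)
    also have "\<dots> = (1 / s (r k)) *\<^sub>R (z (r k) - x) + (1 / s (r k) - 1 / l1) *\<^sub>R (x - x0)
        - (s' (r k) / s (r k) - l2 / l1) *\<^sub>R u"
      by (simp add: scaleR_right_diff_distrib scaleR_left_diff_distrib)
    finally have eq: "a (\<nu> (r k)) - y = \<dots>" .
    show ?thesis
      unfolding eq \<eta>_def
      using seminorm_diff [OF q(1), of "(1 / s (r k)) *\<^sub>R (z (r k) - x) + (1 / s (r k) - 1 / l1) *\<^sub>R (x - x0)"
          "(s' (r k) / s (r k) - l2 / l1) *\<^sub>R u"]
        seminorm_add [OF q(1), of "(1 / s (r k)) *\<^sub>R (z (r k) - x)" "(1 / s (r k) - 1 / l1) *\<^sub>R (x - x0)"] sr [of k]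
      by (simp add: seminorm_scale [OF q(1)])
  qed
  have zq: "(\<lambda>k. q (z (r k) - x)) \<longlonglongrightarrow> 0"
    using LIMSEQ_subseq_LIMSEQ [OF seminorm_tendsto_zero [OF q(1)] l(2), of x z] near
    by (simp add: o_def z_def)
  have "\<eta> \<longlonglongrightarrow> (1 / l1) * 0 + \<bar>1 / l1 - 1 / l1\<bar> * q (x - x0) + \<bar>l2 / l1 - l2 / l1\<bar> * q u"
    unfolding \<eta>_def using l1 by (intro tendsto_intros lims zq) auto
  then have "\<eta> \<longlonglongrightarrow> 0" by simp
  then have "\<forall>\<^sub>F k in sequentially. \<eta> k < 1" by (rule order_tendstoD) simp
  then have "\<forall>\<^sub>F k in sequentially. a (\<nu> (r k)) \<in> N"
    by (rule eventually_mono) (use le q(2) in \<open>fastforce intro: le_less_trans\<close>)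
  then obtain K where K: "\<And>k. k \<ge> K \<Longrightarrow> a (\<nu> (r k)) \<in> N" unfolding eventually_sequentially by blast
  have "inj (\<nu> \<circ> r)" using strict_mono_o [OF \<nu>(1) l(2)] strict_mono_imp_inj_on by blast
  then have "infinite ((\<nu> \<circ> r) ` {K..})"
    by (metis finite_imageD infinite_Ici inj_on_subset subset_UNIV)
  moreover have "(\<nu> \<circ> r) ` {K..} \<subseteq> {n. a n \<in> N}" using K by auto
  ultimately show False using N(3) finite_subset by blast
qed

text \<open>A vector violating domination with the constant \<open>2 * R' / e\<close> is rescaled to
  \<open>p\<close>-size \<open>e / 2\<close>; if \<open>p\<close> vanishes on it, it may be scaled
  to any \<open>q\<close>-size.\<close>

lemma escaping_point:
  assumes p: "continuous_seminorm (mtop d) p" and q: "continuous_seminorm (mtop d) q"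
    and un: "\<not> (\<exists>K. \<forall>z. q z \<le> K * p z)" and e: "e > 0"
  obtains c where "p c < e" "q c > R"
proof -
  define R' where "R' = max R 0 + 1"
  have R': "R' > 0" "R' > R" by (auto simp: R'_def)
  obtain z where z: "q z > (2 * R' / e) * p z" using un by (metis not_le)
  show ?thesis
  proof (cases "p z = 0")
    case True
    then have "q z > 0" using z by simp
    then show ?thesis
      using that [of "(R' / q z) *\<^sub>R z"] True e R' by (simp add: seminorm_scale [OF p] seminorm_scale [OF q])
  next
    case False
    then have pz: "p z > 0" using seminorm_nonneg [OF p, of z] by simp
    define k where "k = e / (2 * p z)"
    have k: "k > 0" using pz e by (simp add: k_def)
    have "p (k *\<^sub>R z) = e / 2" using k pz by (simp add: seminorm_scale [OF p]) (simp add: k_def)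
    moreover have "k * ((2 * R' / e) * p z) < k * q z" using z k by (rule mult_strict_left_mono)
    then have "q (k *\<^sub>R z) > R'" using pz e k by (simp add: seminorm_scale [OF q]) (simp add: k_def)
    ultimately show ?thesis using that [of "k *\<^sub>R z"] e R' by simp
  qed
qed

text \<open>The path from \<open>a n = x0 + b\<close> into \<open>W\<close> has the vertices \<open>x0 + b\<close>, \<open>x0 + b + c\<close>,
  \<open>x0 + t b + c\<close> and \<open>x0 + t b + c + u\<close>. If a continuous seminorm \<open>m\<close> with a ball inside \<open>W\<close> is bounded
  on infinitely many of the points, \<open>c = 0\<close> and a constant \<open>t\<close> do. Otherwise the
  space is not normable, and \<open>c\<close> is small but so large in another seminorm that
  the paths escape to infinity.\<close>

definition path_set :: "'a \<Rightarrow> 'a \<Rightarrow> 'a \<Rightarrow> real \<Rightarrow> 'a \<Rightarrow> 'a set" where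
  "path_set x0 b c t u = {x0 + b + s *\<^sub>R c |s. 0 \<le> s \<and> s \<le> 1} \<union>
     {x0 + s *\<^sub>R b + c |s. t \<le> s \<and> s \<le> 1} \<union> {x0 + t *\<^sub>R b + c + s *\<^sub>R u |s. 0 \<le> s \<and> s \<le> 1}"

lemma segments_in_path_set:
  assumes "0 < t" "t \<le> 1"
  shows "closed_segment (x0 + b) (x0 + b + c) \<subseteq> path_set x0 b c t u"
    "closed_segment (x0 + b + c) (x0 + t *\<^sub>R b + c) \<subseteq> path_set x0 b c t u"
    "closed_segment (x0 + t *\<^sub>R b + c) (x0 + t *\<^sub>R b + c + u) \<subseteq> path_set x0 b c t u"
proof -
  show "closed_segment (x0 + b) (x0 + b + c) \<subseteq> path_set x0 b c t u"
  proof
    fix z assume "z \<in> closed_segment (x0 + b) (x0 + b + c)"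
    then obtain s where "0 \<le> s" "s \<le> 1" "z = (1 - s) *\<^sub>R (x0 + b) + s *\<^sub>R (x0 + b + c)" by (auto simp: in_segment)
    moreover from this have "z = x0 + b + s *\<^sub>R c" by (simp add: algebra_simps)
    ultimately show "z \<in> path_set x0 b c t u" unfolding path_set_def by blast
  qed
  show "closed_segment (x0 + b + c) (x0 + t *\<^sub>R b + c) \<subseteq> path_set x0 b c t u"
  proof
    fix z assume "z \<in> closed_segment (x0 + b + c) (x0 + t *\<^sub>R b + c)"
    then obtain s where s: "0 \<le> s" "s \<le> 1" "z = (1 - s) *\<^sub>R (x0 + b + c) + s *\<^sub>R (x0 + t *\<^sub>R b + c)" by (auto simp: in_segment)
    then have "z = x0 + (1 - s * (1 - t)) *\<^sub>R b + c" by (simp add: algebra_simps)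
    moreover have "s * (1 - t) \<le> 1 * (1 - t)" using s assms by (intro mult_right_mono) auto
    moreover have "0 \<le> s * (1 - t)" using s assms by simp
    ultimately have "z = x0 + (1 - s * (1 - t)) *\<^sub>R b + c \<and> t \<le> 1 - s * (1 - t) \<and> 1 - s * (1 - t) \<le> 1" by simp
    then show "z \<in> path_set x0 b c t u" unfolding path_set_def by blast
  qed
  show "closed_segment (x0 + t *\<^sub>R b + c) (x0 + t *\<^sub>R b + c + u) \<subseteq> path_set x0 b c t u"
  proof
    fix z assume "z \<in> closed_segment (x0 + t *\<^sub>R b + c) (x0 + t *\<^sub>R b + c + u)"
    then obtain s where "0 \<le> s" "s \<le> 1" "z = (1 - s) *\<^sub>R (x0 + t *\<^sub>R b + c) + s *\<^sub>R (x0 + t *\<^sub>R b + c + u)" by (auto simp: in_segment)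
    moreover from this have "z = x0 + t *\<^sub>R b + c + s *\<^sub>R u" by (simp add: algebra_simps)
    ultimately show "z \<in> path_set x0 b c t u" unfolding path_set_def by blast
  qed
qed

text \<open>A point of the path minus \<open>x0\<close> combines \<open>b\<close>, \<open>c\<close>
  and \<open>u\<close> with coefficients in \<open>[0, 1]\<close>, and three contributions below 1/4
  stay below 1. Hence the radius 1/4 of the flexible set inside \<open>Q\<close>.\<close>

lemma path_set_bound:
  assumes p: "continuous_seminorm (mtop d) p" and t: "0 < t" "t \<le> 1"
    and b: "p b < 1/4" and c: "p c < 1/4" and u: "p u < 1/4"
  shows "path_set x0 b c t u \<subseteq> {z. p (z - x0) < 1}"
proof
  fix z assume "z \<in> path_set x0 b c t u"
  moreover have "p (\<alpha> *\<^sub>R b + \<beta> *\<^sub>R c + \<gamma> *\<^sub>R u) < 1"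
    if "0 \<le> \<alpha>" "\<alpha> \<le> 1" "0 \<le> \<beta>" "\<beta> \<le> 1" "0 \<le> \<gamma>" "\<gamma> \<le> 1" for \<alpha> \<beta> \<gamma>
  proof -
    have "p (\<alpha> *\<^sub>R b + \<beta> *\<^sub>R c + \<gamma> *\<^sub>R u) \<le> \<alpha> * p b + \<beta> * p c + \<gamma> * p u"
      using seminorm_add [OF p, of "\<alpha> *\<^sub>R b + \<beta> *\<^sub>R c" "\<gamma> *\<^sub>R u"] seminorm_add [OF p, of "\<alpha> *\<^sub>R b" "\<beta> *\<^sub>R c"] that
      by (simp add: seminorm_scale [OF p])
    moreover have "\<alpha> * p b \<le> p b" "\<beta> * p c \<le> p c" "\<gamma> * p u \<le> p u"
      using that seminorm_nonneg [OF p] by (auto intro: mult_left_le_one_le)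
    ultimately show ?thesis using b c u by linarith
  qed
  ultimately obtain \<alpha> \<beta> \<gamma> :: real where "0 \<le> \<alpha>" "\<alpha> \<le> 1" "0 \<le> \<beta>" "\<beta> \<le> 1" "0 \<le> \<gamma>" "\<gamma> \<le> 1"
    "z - x0 = \<alpha> *\<^sub>R b + \<beta> *\<^sub>R c + \<gamma> *\<^sub>R u"
  proof -
    consider s where "0 \<le> s" "s \<le> 1" "z = x0 + b + s *\<^sub>R c" | s where "t \<le> s" "s \<le> 1" "z = x0 + s *\<^sub>R b + c"
      | s where "0 \<le> s" "s \<le> 1" "z = x0 + t *\<^sub>R b + c + s *\<^sub>R u"
      using \<open>z \<in> path_set x0 b c t u\<close> unfolding path_set_def by blast
    then show ?thesis
    proof cases
      case (1 s) then show ?thesis using that [of 1 s 0] by simp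
    next
      case (2 s) then show ?thesis using that [of s 1 0] t by simp
    next
      case (3 s) then show ?thesis using that [of t 1 s] t by simp
    qed
  qed
  then show "z \<in> {z. p (z - x0) < 1}"
    using \<open>\<And>\<alpha> \<beta> \<gamma>. _ \<Longrightarrow> _ \<Longrightarrow> _ \<Longrightarrow> _ \<Longrightarrow> _ \<Longrightarrow> _ \<Longrightarrow> p (\<alpha> *\<^sub>R b + \<beta> *\<^sub>R c + \<gamma> *\<^sub>R u) < 1\<close> by simp
qed

text \<open>By \<open>dichotomy\<close>, either \<open>p\<close> dominates every continuous seminorm
  or no continuous seminorm dominates them all. The second alternative provides the extra seminorm
  that measures the detour.\<close>

lemma exists_paths:
  fixes a0 :: "nat \<Rightarrow> 'a"
  assumes a0: "inj a0" "\<And>n. p (a0 n - x0) < 1/4"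
    "\<And>y. \<exists>N. openin (mtop d) N \<and> y \<in> N \<and> finite {n. a0 n \<in> N}"
    and p: "continuous_seminorm (mtop d) p"
    and dichotomy: "(\<forall>q. continuous_seminorm (mtop d) q \<longrightarrow> (\<exists>K. \<forall>z. q z \<le> K * p z)) \<or>
      (\<forall>q. continuous_seminorm (mtop d) q \<longrightarrow> (\<exists>q'. continuous_seminorm (mtop d) q' \<and> \<not> (\<exists>K. \<forall>z. q' z \<le> K * q z)))"
    and W: "openin (mtop d) W" "x0 + u \<in> W" "p u < 1/4"
  obtains \<sigma> c t where "strict_mono \<sigma>" "\<And>n. 0 < t n \<and> t n \<le> 1" "\<And>n::nat. p (c n) < 1/4"
    "\<And>n. x0 + t n *\<^sub>R (a0 (\<sigma> n) - x0) + c n + u \<in> W"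
    "\<And>x. \<exists>N. openin (mtop d) N \<and> x \<in> N \<and> finite {n. path_set x0 (a0 (\<sigma> n) - x0) (c n) (t n) u \<inter> N \<noteq> {}}"
proof -
  obtain m where m: "continuous_seminorm (mtop d) m" "{z. m (z - (x0 + u)) < 1} \<subseteq> W"
    using exists_seminorm W by blast
  have m0: "m z \<ge> 0" for z using seminorm_nonneg [OF m(1)] .
  have in_W: "x0 + y + u \<in> W" if "m y < 1" for y
    using that m(2) by (intro subsetD [OF m(2)]) (simp add: algebra_simps)
  show ?thesis
  proof (cases "\<exists>K. infinite {n. m (a0 n - x0) \<le> K}")
    case True
    then obtain K0 where K0: "infinite {n. m (a0 n - x0) \<le> K0}" by blast
    define K where "K = max K0 0"
    define I where "I = {n. m (a0 n - x0) \<le> K}"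
    have I: "infinite I" unfolding I_def K_def
      by (rule infinite_super [OF _ K0]) auto
    define \<sigma> where "\<sigma> = enumerate I"
    have \<sigma>: "strict_mono \<sigma>" "\<And>n. \<sigma> n \<in> I" using I strict_mono_enumerate enumerate_in_set by (auto simp: \<sigma>_def)
    \<comment> \<open>As \<open>\<tau> * K < 1\<close>, this one factor brings all selected points
      into the unit \<open>m\<close>-ball; a common positive factor is what
      \<open>scaled_locally_finite\<close> needs.\<close>
    define \<tau> where "\<tau> = 1 / (K + 1)"
    have K1: "K \<ge> 0" by (simp add: K_def)
    then have \<tau>: "0 < \<tau>" "\<tau> \<le> 1" "\<tau> * K < 1" by (auto simp: \<tau>_def field_simps)
    have inW: "x0 + \<tau> *\<^sub>R (a0 (\<sigma> n) - x0) + 0 + u \<in> W" for n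
    proof -
      have "m (\<tau> *\<^sub>R (a0 (\<sigma> n) - x0)) = \<tau> * m (a0 (\<sigma> n) - x0)" using \<tau> by (simp add: seminorm_scale [OF m(1)])
      also have "\<dots> \<le> \<tau> * K" using \<sigma>(2) [of n] \<tau> by (intro mult_left_mono) (auto simp: I_def)
      finally show ?thesis using \<tau> in_W by simp
    qed
    have acc: "\<exists>N. openin (mtop d) N \<and> y \<in> N \<and> finite {n. a0 (\<sigma> n) \<in> N}" for y
    proof -
      obtain N where N: "openin (mtop d) N" "y \<in> N" "finite {n. a0 n \<in> N}" using a0(3) by blast
      have "finite {n. a0 (\<sigma> n) \<in> N}"
        using finite_vimageI [OF N(3), of \<sigma>] strict_mono_imp_inj_on [OF \<sigma>(1)] by (simp add: vimage_def)
      then show ?thesis using N by blast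
    qed
    have sub: "path_set x0 (a0 (\<sigma> n) - x0) 0 \<tau> u \<subseteq>
        {x0 + s *\<^sub>R (a0 (\<sigma> n) - x0) + s' *\<^sub>R u |s s'. \<tau> \<le> s \<and> s \<le> 1 \<and> 0 \<le> s' \<and> s' \<le> 1}" for n
    proof -
      have "\<exists>s s'. x0 + (a0 (\<sigma> n) - x0) = x0 + s *\<^sub>R (a0 (\<sigma> n) - x0) + s' *\<^sub>R u \<and> \<tau> \<le> s \<and> s \<le> 1 \<and> 0 \<le> s' \<and> s' \<le> 1"
        using \<tau> by (intro exI [of _ 1] exI [of _ 0]) simp
      moreover have "\<exists>s s'. x0 + r *\<^sub>R (a0 (\<sigma> n) - x0) = x0 + s *\<^sub>R (a0 (\<sigma> n) - x0) + s' *\<^sub>R u \<and> \<tau> \<le> s \<and> s \<le> 1 \<and> 0 \<le> s' \<and> s' \<le> 1"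
        if "\<tau> \<le> r" "r \<le> 1" for r
        using that by (intro exI [of _ r] exI [of _ 0]) simp
      moreover have "\<exists>s s'. x0 + \<tau> *\<^sub>R (a0 (\<sigma> n) - x0) + r *\<^sub>R u = x0 + s *\<^sub>R (a0 (\<sigma> n) - x0) + s' *\<^sub>R u \<and> \<tau> \<le> s \<and> s \<le> 1 \<and> 0 \<le> s' \<and> s' \<le> 1"
        if "0 \<le> r" "r \<le> 1" for r
        using that \<tau> by (intro exI [of _ \<tau>] exI [of _ r]) simp
      ultimately show ?thesis unfolding path_set_def by (intro Un_least subsetI; clarsimp)
    qed
    have lf: "\<exists>N. openin (mtop d) N \<and> x \<in> N \<and> finite {n. path_set x0 (a0 (\<sigma> n) - x0) 0 \<tau> u \<inter> N \<noteq> {}}" for x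
    proof -
      obtain N where N: "openin (mtop d) N" "x \<in> N"
        "finite {n. {x0 + s *\<^sub>R (a0 (\<sigma> n) - x0) + s' *\<^sub>R u |s s'. \<tau> \<le> s \<and> s \<le> 1 \<and> 0 \<le> s' \<and> s' \<le> 1} \<inter> N \<noteq> {}}"
        using scaled_locally_finite [OF acc \<tau>(1), of x x0 u] by blast
      have "finite {n. path_set x0 (a0 (\<sigma> n) - x0) 0 \<tau> u \<inter> N \<noteq> {}}"
        by (rule finite_subset [OF _ N(3)]) (use sub in blast)
      then show ?thesis using N by blast
    qed
    show ?thesis
      by (rule that [of \<sigma> "\<lambda>_. \<tau>" "\<lambda>_. 0"]) (use \<sigma>(1) \<tau> inW lf seminorm_zero [OF p] in auto)
  next
    case False
    \<comment> \<open>The points satisfy \<open>p < 1/4\<close>, so domination of \<open>m\<close>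
      by \<open>p\<close> would bound \<open>m\<close> on them. The second alternative of
      \<open>dichotomy\<close> must therefore hold.\<close>
    have "\<not> (\<exists>K. \<forall>z. m z \<le> K * p z)"
    proof
      assume "\<exists>K. \<forall>z. m z \<le> K * p z"
      then obtain K where K: "\<And>z. m z \<le> K * p z" by blast
      have "m (a0 n - x0) \<le> \<bar>K\<bar>" for n
      proof -
        have "m (a0 n - x0) \<le> \<bar>K\<bar> * p (a0 n - x0)"
          using K [of "a0 n - x0"] seminorm_nonneg [OF p] by (meson abs_ge_self mult_right_mono order_trans)
        also have "\<dots> \<le> \<bar>K\<bar>" using a0(2) [of n] seminorm_nonneg [OF p, of "a0 n - x0"] by (simp add: mult_left_le)
        finally show ?thesis .
      qed
      then have "{n. m (a0 n - x0) \<le> \<bar>K\<bar>} = UNIV" by blast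
      then show False using False by (metis infinite_UNIV_nat)
    qed
    then have nonnormable: "\<forall>q. continuous_seminorm (mtop d) q \<longrightarrow>
        (\<exists>q'. continuous_seminorm (mtop d) q' \<and> \<not> (\<exists>K. \<forall>z. q' z \<le> K * q z))"
      using dichotomy m(1) by blast
    have pm: "continuous_seminorm (mtop d) (\<lambda>z. p z + m z)" using continuous_seminorm_add p m by blast
    then obtain q where q: "continuous_seminorm (mtop d) q" "\<not> (\<exists>K. \<forall>z. q z \<le> K * (p z + m z))"
      using nonnormable by blast
    \<comment> \<open>The \<open>q\<close>-size of the detour outweighs any multiples of
      \<open>b\<close> and \<open>u\<close> with coefficients in \<open>[0, 1]\<close> and still
      leaves \<open>n\<close>.\<close>
    have "\<exists>c. p c + m c < 1/4 \<and> q c > real n + q (a0 n - x0) + q u" for n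
      using escaping_point [OF pm q, of "1/4"] by (metis zero_less_divide_1_iff zero_less_numeral)
    then obtain c where c: "\<And>n. p (c n) + m (c n) < 1/4" "\<And>n. q (c n) > real n + q (a0 n - x0) + q u" by metis
    have c': "p (c n) < 1/4" "m (c n) < 1/4" for n
      using c(1) [of n] seminorm_nonneg [OF p, of "c n"] m0 [of "c n"] by auto
    \<comment> \<open>The unit \<open>m\<close>-ball is shared out: at most 1/2 for the contracted
      point and less than 1/4 for the detour.\<close>
    define t where "t n = 1 / (2 * (m (a0 n - x0) + 1))" for n
    have t: "0 < t n" "t n \<le> 1" "t n * m (a0 n - x0) \<le> 1/2" for n
      using m0 [of "a0 n - x0"] by (auto simp: t_def field_simps)
    have inW: "x0 + t n *\<^sub>R (a0 n - x0) + c n + u \<in> W" for n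
    proof -
      have "m (t n *\<^sub>R (a0 n - x0) + c n) \<le> t n * m (a0 n - x0) + m (c n)"
        using seminorm_add [OF m(1), of "t n *\<^sub>R (a0 n - x0)" "c n"] t(1) [of n] by (simp add: seminorm_scale [OF m(1)])
      then have "m (t n *\<^sub>R (a0 n - x0) + c n) < 1" using t(3) [of n] c'(2) [of n] by linarith
      then show ?thesis using in_W [of "t n *\<^sub>R (a0 n - x0) + c n"] by (simp add: add.assoc)
    qed
    \<comment> \<open>On the first edge \<open>c n\<close> is only partly added, but
      \<open>m\<close> stays close to its value at the starting point, and these values tend to
      infinity. On the other edges \<open>c n\<close> is present in full and forces \<open>q\<close>
      to be at least \<open>n\<close>.\<close>
    have far: "real n \<le> q (z - x0) \<or> m (a0 n - x0) - 1/4 \<le> m (z - x0)"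
      if z: "z \<in> path_set x0 (a0 n - x0) (c n) (t n) u" for n z
    proof -
      define b where "b = a0 n - x0"
      have q_far: "real n \<le> q (c n + \<alpha> *\<^sub>R b + \<beta> *\<^sub>R u)" if "0 \<le> \<alpha>" "\<alpha> \<le> 1" "0 \<le> \<beta>" "\<beta> \<le> 1" for \<alpha> \<beta>
      proof -
        have "q (c n) = q ((c n + \<alpha> *\<^sub>R b + \<beta> *\<^sub>R u) - (\<alpha> *\<^sub>R b + \<beta> *\<^sub>R u))" by (simp add: algebra_simps)
        also have "\<dots> \<le> q (c n + \<alpha> *\<^sub>R b + \<beta> *\<^sub>R u) + q (\<alpha> *\<^sub>R b + \<beta> *\<^sub>R u)" by (rule seminorm_diff [OF q(1)])
        also have "q (\<alpha> *\<^sub>R b + \<beta> *\<^sub>R u) \<le> \<alpha> * q b + \<beta> * q u"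
          using seminorm_add [OF q(1), of "\<alpha> *\<^sub>R b" "\<beta> *\<^sub>R u"] that by (simp add: seminorm_scale [OF q(1)])
        also have "\<dots> \<le> q b + q u"
          using that seminorm_nonneg [OF q(1)] by (intro add_mono mult_left_le_one_le) auto
        finally show ?thesis using c(2) [of n] by (simp add: b_def)
      qed
      consider s where "0 \<le> s" "s \<le> 1" "z = x0 + b + s *\<^sub>R c n" | s where "t n \<le> s" "s \<le> 1" "z = x0 + s *\<^sub>R b + c n"
        | s where "0 \<le> s" "s \<le> 1" "z = x0 + t n *\<^sub>R b + c n + s *\<^sub>R u"
        using z unfolding path_set_def b_def by blast
      then show ?thesis
      proof cases
        case s: (1 s)
        then have "m b \<le> m (z - x0) + m (s *\<^sub>R c n)"
          using seminorm_diff [OF m(1), of "z - x0" "s *\<^sub>R c n"] by simp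
        moreover have "m (s *\<^sub>R c n) \<le> m (c n)"
          using s m0 [of "c n"] by (simp add: seminorm_scale [OF m(1)] mult_left_le_one_le)
        ultimately show ?thesis using c'(2) [of n] by (simp add: b_def)
      next
        case (2 s)
        then have "z - x0 = c n + s *\<^sub>R b + 0 *\<^sub>R u" by simp
        moreover have "real n \<le> q (c n + s *\<^sub>R b + 0 *\<^sub>R u)"
          by (rule q_far) (use 2 t(1) [of n] in auto)
        ultimately show ?thesis by metis
      next
        case (3 s)
        then have "z - x0 = c n + t n *\<^sub>R b + s *\<^sub>R u" by simp
        moreover have "real n \<le> q (c n + t n *\<^sub>R b + s *\<^sub>R u)"
          by (rule q_far) (use 3 t(1,2) [of n] in auto)
        ultimately show ?thesis by metis
      qed
    qed
    have lf: "\<exists>N. openin (mtop d) N \<and> x \<in> N \<and> finite {n. path_set x0 (a0 n - x0) (c n) (t n) u \<inter> N \<noteq> {}}" for x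
    proof -
      let ?N = "{z. m (z - x) < 1} \<inter> {z. q (z - x) < 1}"
      have "{n. path_set x0 (a0 n - x0) (c n) (t n) u \<inter> ?N \<noteq> {}} \<subseteq>
          {n. real n \<le> 1 + q (x - x0)} \<union> {n. m (a0 n - x0) \<le> 2 + m (x - x0)}"
      proof
        fix n assume "n \<in> {n. path_set x0 (a0 n - x0) (c n) (t n) u \<inter> ?N \<noteq> {}}"
        then obtain z where z: "z \<in> path_set x0 (a0 n - x0) (c n) (t n) u" "m (z - x) < 1" "q (z - x) < 1" by blast
        have "q (z - x0) \<le> q (z - x) + q (x - x0)" "m (z - x0) \<le> m (z - x) + m (x - x0)"
          by (rule seminorm_triangle [OF q(1)], rule seminorm_triangle [OF m(1)])
        then show "n \<in> {n. real n \<le> 1 + q (x - x0)} \<union> {n. m (a0 n - x0) \<le> 2 + m (x - x0)}"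
          using far [OF z(1)] z(2,3) by auto
      qed
      moreover have "finite {n. real n \<le> 1 + q (x - x0)}"
        by (rule finite_subset [of _ "{..nat \<lfloor>1 + q (x - x0)\<rfloor>}"]) (blast intro: le_nat_floor, rule finite_atMost)
      moreover have "finite {n. m (a0 n - x0) \<le> 2 + m (x - x0)}" using False by blast
      ultimately have "finite {n. path_set x0 (a0 n - x0) (c n) (t n) u \<inter> ?N \<noteq> {}}"
        by (meson finite_UnI finite_subset)
      moreover have "openin (mtop d) ?N" using seminorm_open [OF m(1)] seminorm_open [OF q(1)] by blast
      moreover have "x \<in> ?N" by (simp add: seminorm_zero [OF m(1)] seminorm_zero [OF q(1)])
      ultimately show ?thesis by blast
    qed
    show ?thesis
      by (rule that [of id t c]) (use t c' inW lf in \<open>auto simp: strict_mono_def\<close>)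
  qed
qed

lemma compactin_polygon: "compactin (mtop d) (\<Union>i<(n::nat). closed_segment (xs i) (xs (Suc i)))"
  by (intro compactin_Union) (auto intro: compactin_segment)

lemma set_cball_UN: "set_cball d (\<Union>i\<in>I. A i) r = (\<Union>i\<in>I. set_cball d (A i) r)"
  by (auto simp: set_cball_def)

text \<open>Only the points with even index are moved; the tubes around the remaining paths keep the
  points with odd index away from the support.\<close>

lemma P_open_dissects:
  fixes a :: "nat \<Rightarrow> 'a" and xs :: "nat \<Rightarrow> nat \<Rightarrow> 'a"
  assumes X: "openin (mtop d) X" and Q: "openin (mtop d) Q" "Q \<subseteq> X" "Q \<subseteq> mball c r"
    and xs: "\<And>n. xs n 0 = a n" "\<And>n. xs n k \<in> W" "k \<ge> 1" and inj: "inj a"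
  defines "P \<equiv> \<lambda>n. \<Union>i<k. closed_segment (xs n i) (xs n (Suc i))"
  assumes PQ: "\<And>n. P n \<subseteq> Q"
    and lf: "\<And>x. \<exists>U. openin (mtop d) U \<and> x \<in> U \<and> finite {n. P n \<inter> U \<noteq> {}}"
  shows "\<exists>g\<in>P_open d X. infinite {b \<in> range a. g b \<in> W} \<and>
    infinite {b \<in> range a. locally_identity (subtopology (mtop d) X) g b}"
proof -
  have comp: "compactin (mtop d) (P n)" for n unfolding P_def by (rule compactin_polygon)
  \<comment> \<open>Paths of the family may cross; a pairwise disjoint subsequence still starts at
    infinitely many of the points.\<close>
  obtain \<sigma> :: "nat \<Rightarrow> nat" where \<sigma>: "strict_mono \<sigma>" "\<And>m n. m \<noteq> n \<Longrightarrow> P (\<sigma> m) \<inter> P (\<sigma> n) = {}"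
    using disjoint_subsequence [of P, OF comp lf] by blast
  have inj\<sigma>: "inj \<sigma>" using \<sigma>(1) strict_mono_imp_inj_on by blast
  have lf\<sigma>: "\<exists>U. openin (mtop d) U \<and> x \<in> U \<and> finite {n. P (\<sigma> n) \<inter> U \<noteq> {}}" for x
  proof -
    obtain U where U: "openin (mtop d) U" "x \<in> U" "finite {n. P n \<inter> U \<noteq> {}}" using lf by blast
    have "finite {n. P (\<sigma> n) \<inter> U \<noteq> {}}"
      using finite_vimageI [OF U(3) inj\<sigma>] by (simp add: vimage_def)
    then show ?thesis using U by blast
  qed
  obtain \<rho> where \<rho>: "\<And>n. \<rho> n > 0" "separated (\<lambda>n. set_cball d (P (\<sigma> n)) (\<rho> n))"
    "\<And>n. set_cball d (P (\<sigma> n)) (\<rho> n) \<subseteq> Q"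
    by (rule separated_tubes [of "\<lambda>n. P (\<sigma> n)", OF comp lf\<sigma> \<sigma>(2) Q(1) PQ]) (assumption, rule that)
  define S where "S n = set_cball d (P (\<sigma> n)) (\<rho> n)" for n
  have sep: "separated S" using \<rho>(2) by (simp add: S_def [abs_def])
  have SQ: "S n \<subseteq> Q" for n using \<rho>(3) by (simp add: S_def)
  have a_in: "a (\<sigma> n) \<in> S n" for n
  proof -
    have "a (\<sigma> n) \<in> P (\<sigma> n)"
      unfolding P_def by (rule UN_I [of 0]) (use xs(1) [of "\<sigma> n"] xs(3) in auto)
    then show ?thesis unfolding S_def in_set_cball using \<rho>(1) [of n] by (intro bexI [of _ "a (\<sigma> n)"]) (auto simp: less_imp_le)
  qed
  have "\<exists>f g. bilipschitz f g \<and> polygonal d f (S n) \<and> f (a (\<sigma> n)) \<in> W \<and> supp f \<subseteq> S n" for n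
  proof -
    have "S n = (\<Union>i<k. set_cball d (closed_segment (xs (\<sigma> n) i) (xs (\<sigma> n) (Suc i))) (\<rho> n))"
      by (simp add: S_def P_def set_cball_UN)
    then show ?thesis using exists_polygonal [OF xs(3) \<rho>(1), of "xs (\<sigma> n)" n] xs(1,2) by metis
  qed
  then obtain f g where f: "\<And>n. bilipschitz (f n) (g n)" "\<And>n. polygonal d (f n) (S n)"
    "\<And>n. f n (a (\<sigma> n)) \<in> W" "\<And>n. supp (f n) \<subseteq> S n" by metis
  define S2 where "S2 n = S (2 * n)" for n
  have sep2: "separated S2"
    using separated_comp [OF sep, of "\<lambda>n. 2 * n"] by (simp add: S2_def [abs_def] o_def inj_def)
  have sub2: "S2 n \<subseteq> mball c r" for n using SQ Q(3) unfolding S2_def by blast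
  have f2: "bilipschitz (f (2 * n)) (g (2 * n))" "supp (f (2 * n)) \<subseteq> S2 n" "polygonal d (f (2 * n)) (S2 n)" for n
    using f by (simp_all add: S2_def)
  obtain h where h: "h \<in> P_hat d" "\<And>n z. z \<in> S2 n \<Longrightarrow> h z = f (2 * n) z"
    "\<And>z. z \<notin> (\<Union>n. S2 n) \<Longrightarrow> h z = z"
    by (rule P_hat_separated [OF f2 sep2 sub2]) (rule that)
  have "supp h \<subseteq> (\<Union>n. S2 n)" using h(3) by (auto simp: supp_def)
  also have "\<dots> \<subseteq> X" unfolding S2_def using SQ Q(2) by blast
  finally have hP: "restrict h X \<in> P_open d X" using P_open_if_P_hat h(1) by blast
  have aX: "a (\<sigma> n) \<in> X" for n using a_in SQ Q(2) by blast
  have inj2: "inj (\<lambda>n. a (\<sigma> (2 * n)))" "inj (\<lambda>n. a (\<sigma> (Suc (2 * n))))"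
    using inj inj\<sigma> by (auto intro!: injI dest!: injD)
  have "(restrict h X) (a (\<sigma> (2 * n))) \<in> W" for n
    using h(2) [of "a (\<sigma> (2 * n))" n] a_in [of "2 * n"] f(3) [of "2 * n"] aX by (simp add: S2_def)
  then have "range (\<lambda>n. a (\<sigma> (2 * n))) \<subseteq> {b \<in> range a. (restrict h X) b \<in> W}" by blast
  then have 1: "infinite {b \<in> range a. (restrict h X) b \<in> W}"
    using range_inj_infinite [OF inj2(1)] infinite_super by blast
  have "locally_identity (subtopology (mtop d) X) (restrict h X) (a (\<sigma> (Suc (2 * n))))" (is "locally_identity _ _ ?b") for n
  proof -
    obtain U where U: "openin (mtop d) U" "?b \<in> U" "\<And>i j. \<lbrakk>S i \<inter> U \<noteq> {}; S j \<inter> U \<noteq> {}\<rbrakk> \<Longrightarrow> i = j"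
      using sep unfolding separated_def by meson
    have "S2 m \<inter> U = {}" for m
    proof (rule ccontr)
      assume "S2 m \<inter> U \<noteq> {}"
      moreover have "S (Suc (2 * n)) \<inter> U \<noteq> {}" using a_in [of "Suc (2 * n)"] U(2) by blast
      ultimately have "2 * m = Suc (2 * n)" unfolding S2_def by (rule U(3))
      then show False by presburger
    qed
    then have "s \<notin> (\<Union>m. S2 m)" if "s \<in> U" for s using that by blast
    then have "\<forall>s\<in>X \<inter> U. restrict h X s = s" using h(3) by simp
    moreover have "openin (subtopology (mtop d) X) (X \<inter> U)" using U(1) by (rule openin_subtopology_Int2)
    moreover have "?b \<in> X \<inter> U" using aX U(2) by blast
    ultimately show ?thesis unfolding locally_identity_def by blast
  qed
  then have "range (\<lambda>n. a (\<sigma> (Suc (2 * n)))) \<subseteq>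
      {b \<in> range a. locally_identity (subtopology (mtop d) X) (restrict h X) b}" by blast
  then have 2: "infinite {b \<in> range a. locally_identity (subtopology (mtop d) X) (restrict h X) b}"
    using range_inj_infinite [OF inj2(2)] infinite_super by blast
  show ?thesis using hP 1 2 by blast
qed

text \<open>The seminorm that measures the flexible set must be fixed before any target is known. In
  the normable case a dominating seminorm is therefore added to \<open>p\<close> in advance.\<close>

lemma normable_dichotomy:
  assumes p: "continuous_seminorm (mtop d) p"
  obtains p' where "continuous_seminorm (mtop d) p'" "\<And>z. p z \<le> p' z"
    "(\<forall>q. continuous_seminorm (mtop d) q \<longrightarrow> (\<exists>K. \<forall>z. q z \<le> K * p' z)) \<or>
      (\<forall>q. continuous_seminorm (mtop d) q \<longrightarrow> (\<exists>q'. continuous_seminorm (mtop d) q' \<and> \<not> (\<exists>K. \<forall>z. q' z \<le> K * q z)))"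
proof (cases "\<exists>n. continuous_seminorm (mtop d) n \<and>
    (\<forall>q. continuous_seminorm (mtop d) q \<longrightarrow> (\<exists>K. \<forall>z. q z \<le> K * n z))")
  case True
  then obtain n where n: "continuous_seminorm (mtop d) n"
    "\<And>q. continuous_seminorm (mtop d) q \<Longrightarrow> \<exists>K. \<forall>z. q z \<le> K * n z" by blast
  have "\<exists>K. \<forall>z. q z \<le> K * (p z + n z)" if q: "continuous_seminorm (mtop d) q" for q
  proof -
    obtain K where K: "\<And>z. q z \<le> K * n z" using n(2) [OF q] by blast
    have "q z \<le> \<bar>K\<bar> * (p z + n z)" for z
    proof -
      have "q z \<le> \<bar>K\<bar> * n z"
        using K [of z] seminorm_nonneg [OF n(1), of z] by (meson abs_ge_self mult_right_mono order_trans)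
      also have "\<dots> \<le> \<bar>K\<bar> * (p z + n z)" using seminorm_nonneg [OF p, of z] by (intro mult_left_mono) auto
      finally show ?thesis .
    qed
    then show ?thesis by blast
  qed
  then show ?thesis
    using continuous_seminorm_add [OF p n(1)] seminorm_nonneg [OF n(1)] by (intro that [of "\<lambda>z. p z + n z"]) auto
next
  case False
  show ?thesis by (rule that [OF p]) (use False in auto)
qed

text \<open>The ball \<open>U\<close> plays three parts: flexible set, its own dense subset, and the
  open set that dissects.\<close>

lemma P_open_flexible:
  assumes X: "openin (mtop d) X" "x0 \<in> X"
  shows "\<exists>U. flexible (subtopology (mtop d) X) (P_open d X) U \<and> x0 \<in> U"
proof -
  let ?T = "subtopology (mtop d) X"
  obtain p1 where p1: "continuous_seminorm (mtop d) p1" "{z. p1 (z - x0) < 1} \<subseteq> X" "{z. p1 (z - x0) < 1} \<subseteq> mball x0 1"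
    using exists_seminorm_small [OF X, of 1] by auto
  obtain p where p: "continuous_seminorm (mtop d) p" "\<And>z. p1 z \<le> p z" and dichotomy:
    "(\<forall>q. continuous_seminorm (mtop d) q \<longrightarrow> (\<exists>K. \<forall>z. q z \<le> K * p z)) \<or>
      (\<forall>q. continuous_seminorm (mtop d) q \<longrightarrow> (\<exists>q'. continuous_seminorm (mtop d) q' \<and> \<not> (\<exists>K. \<forall>z. q' z \<le> K * q z)))"
    by (rule normable_dichotomy [OF p1(1)]) (rule that)
  define Q where "Q = {z. p (z - x0) < 1}"
  have "Q \<subseteq> {z. p1 (z - x0) < 1}" unfolding Q_def using p(2) le_less_trans by blast
  then have Q: "openin (mtop d) Q" "Q \<subseteq> X" "Q \<subseteq> mball x0 1"
    using seminorm_open [OF p(1)] p1 by (auto simp: Q_def)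
  define U where "U = {z. p (z - x0) < 1/4}"
  have UQ: "U \<subseteq> Q" by (auto simp: U_def Q_def)
  have oU: "openin (mtop d) U" unfolding U_def by (rule seminorm_open [OF p(1)])
  have oTU: "openin ?T U" using oU UQ Q(2) X(1) by (simp add: openin_open_subtopology)
  have x0U: "x0 \<in> U" by (simp add: U_def seminorm_zero [OF p(1)])
  have dis: "dissectable ?T (P_open d X) A"
    if A: "A \<subseteq> U" "infinite A" "?T derived_set_of A = {}" for A
    unfolding dissectable_def dissects_def
  proof (intro exI [of _ U] conjI allI impI)
    show "openin ?T U" by (rule oTU)
    show "U \<noteq> {}" using x0U by blast
    fix W assume W: "openin ?T W \<and> W \<noteq> {} \<and> W \<subseteq> U"
    then have oW: "openin (mtop d) W" using X(1) by (simp add: openin_open_subtopology)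
    obtain w where w: "w \<in> W" using W by blast
    define u where "u = w - x0"
    have u: "x0 + u \<in> W" "p u < 1/4" using w W by (auto simp: u_def U_def)
    obtain a0 :: "nat \<Rightarrow> 'a" where a0: "inj a0" "range a0 \<subseteq> A"
      using infinite_countable_subset A(2) by blast
    have a0U: "p (a0 n - x0) < 1/4" for n using a0(2) A(1) by (auto simp: U_def)
    have acc: "\<exists>N. openin (mtop d) N \<and> y \<in> N \<and> finite {n. a0 n \<in> N}" for y
    proof (cases "y \<in> X")
      case True
      have "y \<notin> ?T derived_set_of A" using A(3) by simp
      then obtain N where N: "openin ?T N" "y \<in> N" "\<And>z. \<lbrakk>z \<in> A; z \<in> N\<rbrakk> \<Longrightarrow> z = y"
        using True unfolding in_derived_set_of by auto
      have "{n. a0 n \<in> N} \<subseteq> {n. a0 n = y}" using N(3) a0(2) by blast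
      also have "\<dots> = a0 -` {y}" by auto
      finally have "finite {n. a0 n \<in> N}" using finite_vimageI [of "{y}" a0] a0(1) finite_subset by blast
      moreover have "openin (mtop d) N" using N(1) X(1) by (simp add: openin_open_subtopology)
      ultimately show ?thesis using N(2) by blast
    next
      case False
      \<comment> \<open>A closed discrete subset of \<open>X\<close> could accumulate at a point
        outside \<open>X\<close>. Not here: such a \<open>y\<close> has
        \<open>p (y - x0) \<ge> 1\<close>, while the points lie within 1/4 of
        \<open>x0\<close>.\<close>
      let ?N = "{z. p (z - y) < 1/2}"
      have "y \<notin> Q" using False Q(2) by blast
      then have "p (y - x0) \<ge> 1" by (simp add: Q_def)
      have "a0 n \<notin> ?N" for n
      proof
        assume "a0 n \<in> ?N"
        then have "p (y - a0 n) < 1/2" using seminorm_diff_commute [OF p(1)] by simp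
        then show False
          using seminorm_triangle [OF p(1), of y x0 "a0 n"] a0U [of n] \<open>p (y - x0) \<ge> 1\<close> by linarith
      qed
      then have "{n. a0 n \<in> ?N} = {}" by blast
      then have "finite {n. a0 n \<in> ?N}" by (metis finite.emptyI)
      moreover have "openin (mtop d) ?N" "y \<in> ?N" by (rule seminorm_open [OF p(1)], simp add: seminorm_zero [OF p(1)])
      ultimately show ?thesis by blast
    qed
    obtain \<sigma> c t where \<sigma>: "strict_mono \<sigma>" "\<And>n::nat. 0 < t n \<and> t n \<le> 1" "\<And>n. p (c n) < 1/4"
      and inW: "\<And>n. x0 + t n *\<^sub>R (a0 (\<sigma> n) - x0) + c n + u \<in> W"
      and lf: "\<And>x. \<exists>N. openin (mtop d) N \<and> x \<in> N \<and> finite {n. path_set x0 (a0 (\<sigma> n) - x0) (c n) (t n) u \<inter> N \<noteq> {}}"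
      by (rule exists_paths [OF a0(1) a0U acc p(1) dichotomy oW u]) (rule that)
    define b where "b n = a0 (\<sigma> n) - x0" for n
    \<comment> \<open>From index 3 on the end point is repeated; \<open>P\<close> uses just the
      three edges leading to it.\<close>
    define xs where "xs n i = (if i = 0 then x0 + b n else if i = 1 then x0 + b n + c n
        else if i = 2 then x0 + t n *\<^sub>R b n + c n else x0 + t n *\<^sub>R b n + c n + u)" for n and i :: nat
    define P where "P n = (\<Union>i<3. closed_segment (xs n i) (xs n (Suc i)))" for n
    have sub: "P n \<subseteq> path_set x0 (b n) (c n) (t n) u" for n
      unfolding P_def numeral_3_eq_3 lessThan_Suc xs_def
      using segments_in_path_set [of "t n" x0 "b n" "c n" u] \<sigma>(2) [of n] by (simp add: numeral_2_eq_2)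
    have PQ: "P n \<subseteq> Q" for n
      using sub [of n] path_set_bound [OF p(1), of "t n" "b n" "c n" u x0] \<sigma>(2,3) [of n] a0U u(2)
      unfolding Q_def b_def by blast
    have lfP: "\<exists>N. openin (mtop d) N \<and> x \<in> N \<and> finite {n. P n \<inter> N \<noteq> {}}" for x
    proof -
      obtain N where N: "openin (mtop d) N" "x \<in> N" "finite {n. path_set x0 (b n) (c n) (t n) u \<inter> N \<noteq> {}}"
        using lf [of x] unfolding b_def by blast
      have "finite {n. P n \<inter> N \<noteq> {}}" by (rule finite_subset [OF _ N(3)]) (use sub in blast)
      then show ?thesis using N by blast
    qed
    have inj: "inj (\<lambda>n. a0 (\<sigma> n))"
      using a0(1) strict_mono_imp_inj_on [OF \<sigma>(1)] by (auto intro!: injI dest!: injD)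
    have ex: "\<exists>g\<in>P_open d X. infinite {b \<in> range (\<lambda>n. a0 (\<sigma> n)). g b \<in> W} \<and>
        infinite {b \<in> range (\<lambda>n. a0 (\<sigma> n)). locally_identity ?T g b}"
    proof (rule P_open_dissects [OF X(1) Q, of xs _ 3])
      show "xs n 0 = a0 (\<sigma> n)" "xs n 3 \<in> W" for n using inW [of n] by (simp_all add: xs_def b_def)
    qed (use inj PQ lfP in \<open>simp_all add: P_def\<close>)
    have sub_A: "range (\<lambda>n. a0 (\<sigma> n)) \<subseteq> A" using a0(2) by blast
    have mono: "infinite {b \<in> A. R b}" if "infinite {b \<in> range (\<lambda>n. a0 (\<sigma> n)). R b}" for R
      by (rule infinite_super [OF _ that]) (use sub_A in blast)
    obtain g where "g \<in> P_open d X" "infinite {b \<in> range (\<lambda>n. a0 (\<sigma> n)). g b \<in> W}"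
      "infinite {b \<in> range (\<lambda>n. a0 (\<sigma> n)). locally_identity ?T g b}"
      using ex by blast
    then show "\<exists>g\<in>P_open d X. infinite {a \<in> A. g a \<in> W} \<and> infinite {a \<in> A. locally_identity ?T g a}"
      using mono [of "\<lambda>b. g b \<in> W"] mono [of "locally_identity ?T g"] by blast
  qed
  have "U \<subseteq> ?T closure_of U" using oTU by (intro closure_of_subset openin_subset)
  then have "flexible ?T (P_open d X) U"
    unfolding flexible_def using oTU by (intro conjI exI [of _ U] allI impI dis) auto
  then show ?thesis using x0U by blast
qed

text \<open>The zero space is excluded because of (P2): its only homeomorphism is the
  identity.\<close>

theorem P_open_in_K1:
  assumes nz: "(UNIV :: 'a set) \<noteq> {0}" and X: "openin (mtop d) X"
  shows "(subtopology (mtop d) X, P_open d X) \<in> K1"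
proof -
  let ?T = "subtopology (mtop d) X"
  have mz: "metrizable_space ?T" by (simp add: metrizable_space_mtopology metrizable_space_subtopology)
  have "\<exists>g\<in>P_open d X. g \<noteq> \<one>\<^bsub>homeo_group ?T\<^esub> \<and> (\<forall>x \<in> topspace ?T - U. g x = x)"
    if "openin ?T U" "U \<noteq> {}" for U
    using P_open_moving [OF nz, of U X] that X by (simp add: openin_open_subtopology)
  moreover have "somewhere_dense ?T {g x |g. g \<in> P_open d X \<and> locally_identity ?T g y}"
    if "x \<in> topspace ?T" "y \<in> topspace ?T" "x \<noteq> y" for x y
    using P_open_dense_orbits [OF X] that by simp
  moreover have "topspace ?T \<subseteq> \<Union>{U. flexible ?T (P_open d X) U}"
    using P_open_flexible [OF X] by auto
  ultimately show ?thesis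
    unfolding K1_def space_group_pair_def
    using subgroup_P_open metrizable_imp_regular_space [OF mz] metrizable_imp_Hausdorff_space [OF mz]
      metrizable_imp_first_countable [OF mz]
    by simp
qed

end

section \<open>Faithfulness\<close>

lemma faithful_mono: "\<lbrakk>faithful K' L'; K \<subseteq> K'; L \<subseteq> L'\<rbrakk> \<Longrightarrow> faithful K L"
  unfolding faithful_def by (meson subsetD)

text \<open>(P2), (P3) and (P4) ask only for the existence of group elements, so it suffices to
  verify them for the smallest group allowed in \<open>KP\<close>.\<close>

lemma K1_mono:
  assumes XG: "(X, G) \<in> K1" and G: "G \<subseteq> G'" "space_group_pair X G'"
  shows "(X, G') \<in> K1"
proof -
  have "\<exists>g\<in>G'. g \<noteq> \<one>\<^bsub>homeo_group X\<^esub> \<and> (\<forall>x \<in> topspace X - U. g x = x)"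
    if "openin X U" "U \<noteq> {}" for U
    using XG that G(1) unfolding K1_def by (auto dest!: spec [of _ U])
  moreover have "somewhere_dense X {g x |g. g \<in> G' \<and> locally_identity X g y}"
    if "x \<in> topspace X" "y \<in> topspace X" "x \<noteq> y" for x y
  proof -
    have "somewhere_dense X {g x |g. g \<in> G \<and> locally_identity X g y}"
      using XG that unfolding K1_def by simp
    moreover have "{g x |g. g \<in> G \<and> locally_identity X g y} \<subseteq> {g x |g. g \<in> G' \<and> locally_identity X g y}"
      using G(1) by blast
    then have "X interior_of (X closure_of {g x |g. g \<in> G \<and> locally_identity X g y}) \<subseteq>
        X interior_of (X closure_of {g x |g. g \<in> G' \<and> locally_identity X g y})"
      by (intro interior_of_mono closure_of_mono)
    ultimately show ?thesis unfolding somewhere_dense_def by blast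
  qed
  moreover have "topspace X \<subseteq> \<Union>{U. flexible X G' U}"
  proof -
    have dis: "dissectable X G' A" if "dissectable X G A" for A
      using that G(1) unfolding dissectable_def dissects_def by (meson subsetD)
    have "flexible X G' U" if U: "flexible X G U" for U
    proof -
      obtain D where "openin X U" "D \<subseteq> U" "U \<subseteq> X closure_of D"
        "\<And>A. \<lbrakk>A \<subseteq> D; infinite A; X derived_set_of A = {}\<rbrakk> \<Longrightarrow> dissectable X G A"
        using U unfolding flexible_def by metis
      then show ?thesis using dis unfolding flexible_def by (intro conjI exI [of _ D]) auto
    qed
    moreover have "topspace X \<subseteq> \<Union>{U. flexible X G U}" using XG unfolding K1_def by simp
    ultimately show ?thesis by blast
  qed
  ultimately show ?thesis using XG G(2) unfolding K1_def by simp
qed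

text \<open>The one-point spaces have to be treated apart: they satisfy (P2) for no group. They arise
  from the zero space \<open>E = 0\<close>.\<close>

lemma one_point_group:
  assumes G: "subgroup G (homeo_group X)" and X: "topspace X = {x}"
  shows "G = {\<one>\<^bsub>homeo_group X\<^esub>}"
proof -
  have "g = \<one>\<^bsub>homeo_group X\<^esub>" if "g \<in> G" for g
  proof (rule homeo_group_cong)
    show "g \<in> carrier (homeo_group X)" using that G subgroup.subset by blast
    then show "g y = \<one>\<^bsub>homeo_group X\<^esub> y" if "y \<in> topspace X" for y
      using that X Bij_imp_funcset [of g "topspace X"] by (auto simp: homeo_group_carrier homeo_group_one)
    show "\<one>\<^bsub>homeo_group X\<^esub> \<in> carrier (homeo_group X)"
      using group_homeo_group group.is_monoid monoid.one_closed by blast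
  qed
  then show ?thesis using subgroup.one_closed [OF G] by blast
qed

text \<open>The group of a one-point space is trivial, that of a nonempty member of
  \<open>K1\<close> is not, by (P2); an isomorphism never pairs the two kinds.\<close>

lemma faithful_K1_or_point:
  fixes K :: "('a topology \<times> ('a \<Rightarrow> 'a) set) set" and L :: "('b topology \<times> ('b \<Rightarrow> 'b) set) set"
  assumes K: "\<And>X G. (X, G) \<in> K \<Longrightarrow> space_group_pair X G \<and> topspace X \<noteq> {} \<and> ((X, G) \<in> K1 \<or> (\<exists>x. topspace X = {x}))"
    and L: "\<And>Y H. (Y, H) \<in> L \<Longrightarrow> space_group_pair Y H \<and> topspace Y \<noteq> {} \<and> ((Y, H) \<in> K1 \<or> (\<exists>y. topspace Y = {y}))"
  shows "faithful K L"
  unfolding faithful_def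
proof (intro allI impI, elim conjE)
  fix X G Y H \<phi>
  assume X: "(X, G) \<in> K" and Y: "(Y, H) \<in> L" and \<phi>: "\<phi> \<in> iso (group_on X G) (group_on Y H)"
  have sg: "subgroup G (homeo_group X)" "subgroup H (homeo_group Y)"
    using K [OF X] L [OF Y] by (auto simp: space_group_pair_def)
  have bij: "bij_betw \<phi> G H" using \<phi> by (simp add: iso_def)
  have nontriv: "\<exists>g\<in>G. g \<noteq> \<one>\<^bsub>homeo_group X\<^esub>" if "(X, G) \<in> K1"
    using that K [OF X] unfolding K1_def by (auto dest!: spec [of _ "topspace X"])
  have nontriv': "\<exists>h\<in>H. h \<noteq> \<one>\<^bsub>homeo_group Y\<^esub>" if "(Y, H) \<in> K1"
    using that L [OF Y] unfolding K1_def by (auto dest!: spec [of _ "topspace Y"])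
  have one: "\<one>\<^bsub>homeo_group X\<^esub> \<in> G" "\<one>\<^bsub>homeo_group Y\<^esub> \<in> H"
    by (rule subgroup.one_closed [OF sg(1)], rule subgroup.one_closed [OF sg(2)])
  have not1: "\<not> (\<exists>y. topspace Y = {y})" if "(X, G) \<in> K1"
  proof
    assume "\<exists>y. topspace Y = {y}"
    then have H: "H = {\<one>\<^bsub>homeo_group Y\<^esub>}" using one_point_group [OF sg(2)] by auto
    obtain g where g: "g \<in> G" "g \<noteq> \<one>\<^bsub>homeo_group X\<^esub>" using nontriv \<open>(X, G) \<in> K1\<close> by blast
    have "\<phi> g \<in> H" "\<phi> \<one>\<^bsub>homeo_group X\<^esub> \<in> H" using bij g(1) one(1) by (auto simp: bij_betw_def)
    then have "\<phi> g = \<phi> \<one>\<^bsub>homeo_group X\<^esub>" using H by simp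
    then show False using bij_betw_imp_inj_on [OF bij] g one(1) by (auto dest: inj_onD)
  qed
  have not2: "\<not> (\<exists>x. topspace X = {x})" if "(Y, H) \<in> K1"
  proof
    assume "\<exists>x. topspace X = {x}"
    then have "G = {\<one>\<^bsub>homeo_group X\<^esub>}" using one_point_group [OF sg(1)] by auto
    then have "H = {\<phi> \<one>\<^bsub>homeo_group X\<^esub>}" using bij_betw_imp_surj_on [OF bij] by simp
    then have "H = {\<one>\<^bsub>homeo_group Y\<^esub>}" using one(2) by simp
    then show False using nontriv' \<open>(Y, H) \<in> K1\<close> by blast
  qed
  show "\<exists>\<tau> \<sigma>. homeomorphic_maps X Y \<tau> \<sigma> \<and> (\<forall>g\<in>G. \<phi> g = restrict (\<tau> \<circ> g \<circ> \<sigma>) (topspace Y))"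
  proof (cases "(X, G) \<in> K1 \<and> (Y, H) \<in> K1")
    case True
    then show ?thesis
      using faithful_K1 [unfolded faithful_def, rule_format, of X G Y H \<phi>] \<phi> by simp
  next
    case False
    then obtain x y where xy: "topspace X = {x}" "topspace Y = {y}" using K [OF X] L [OF Y] not1 not2 by blast
    have "homeomorphic_maps X Y (\<lambda>_. y) (\<lambda>_. x)" using xy by (simp add: homeomorphic_maps_def)
    moreover have "\<phi> g = restrict ((\<lambda>_. y) \<circ> g \<circ> (\<lambda>_. x)) (topspace Y)" if "g \<in> G" for g
    proof -
      have "\<phi> g \<in> H" using bij that by (auto simp: bij_betw_def)
      then have "\<phi> g = \<one>\<^bsub>homeo_group Y\<^esub>" using one_point_group [OF sg(2) xy(2)] by blast
      then show ?thesis using xy by (auto simp: homeo_group_one)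
    qed
    ultimately show ?thesis by blast
  qed
qed

lemma KP_cases:
  fixes X :: "'a::real_vector topology"
  assumes "(X, G) \<in> KP"
  shows "space_group_pair X G \<and> topspace X \<noteq> {} \<and> ((X, G) \<in> K1 \<or> (\<exists>x. topspace X = {x}))"
proof -
  obtain d S where d: "metric_lcs d" "openin (mtop d) S" "S \<noteq> {}" "X = subtopology (mtop d) S"
    "space_group_pair X G" "P_open d S \<subseteq> G"
    using assms by (auto simp: KP_def)
  interpret metric_locally_convex d by unfold_locales (rule d)
  have tX: "topspace X = S" by (simp add: d(4))
  show ?thesis
  proof (cases "(UNIV :: 'a set) = {0}")
    case True
    then have "topspace X = {0}" using d(3) tX by (metis UNIV_I empty_subsetI singletonD subsetI subset_singletonD)
    then show ?thesis using d(5) by simp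
  next
    case False
    then have "(subtopology (mtop d) S, P_open d S) \<in> K1" using d(2) by (rule P_open_in_K1)
    then have "(X, G) \<in> K1" using K1_mono d(4,5,6) by metis
    then show ?thesis using d(3,5) tX by simp
  qed
qed

theorem faithful_KP: "faithful KP KP"
  by (rule faithful_K1_or_point) (rule KP_cases, assumption)+

section \<open>Metrization by seminorms\<close>

context locally_convex
begin

lemma countable_seminorms:
  assumes "first_countable T"
  obtains p :: "nat \<Rightarrow> 'a \<Rightarrow> real" where "\<And>n. continuous_seminorm T (p n)"
    "\<And>U x. \<lbrakk>openin T U; x \<in> U\<rbrakk> \<Longrightarrow> \<exists>n. {y. p n (y - x) < 1} \<subseteq> U"
proof -
  obtain B where B: "countable B" "\<And>V. V \<in> B \<Longrightarrow> openin T V"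
    "\<And>U. \<lbrakk>openin T U; 0 \<in> U\<rbrakk> \<Longrightarrow> \<exists>V\<in>B. 0 \<in> V \<and> V \<subseteq> U"
    using assms unfolding first_countable_def by (metis UNIV_I topspace_UNIV)
  define C where "C = {V \<in> B. 0 \<in> V}"
  have C: "countable C" "C \<noteq> {}" using B(1) B(3) [of UNIV] openin_topspace [of T] by (auto simp: C_def)
  have fC: "openin T (from_nat_into C n) \<and> 0 \<in> from_nat_into C n" for n
    using from_nat_into [OF C(2), of n] B(2) by (simp add: C_def)
  then have "\<exists>p. continuous_seminorm T p \<and> {z. p z < 1} \<subseteq> from_nat_into C n" for n
    using exists_seminorm_zero by metis
  then obtain p where p: "\<And>n. continuous_seminorm T (p n)" "\<And>n. {z. p n z < 1} \<subseteq> from_nat_into C n" by metis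
  have "\<exists>n. {y. p n (y - x) < 1} \<subseteq> U" if U: "openin T U" "x \<in> U" for U x
  proof -
    have "openin T {z. z + x \<in> U}" "0 \<in> {z. z + x \<in> U}" using open_translate U by auto
    then obtain V where V: "V \<in> B" "0 \<in> V" "V \<subseteq> {z. z + x \<in> U}" using B(3) by meson
    then have "V \<in> C" by (simp add: C_def)
    then obtain n where "V = from_nat_into C n" using from_nat_into_surj [OF C(1)] by metis
    then have sub: "{z. p n z < 1} \<subseteq> {z. z + x \<in> U}" using p(2) [of n] V(3) by simp
    have "y \<in> U" if "p n (y - x) < 1" for y using subsetD [OF sub, of "y - x"] that by simp
    then show ?thesis by blast
  qed
  then show ?thesis using that p(1) by blast
qed

text \<open>A supremum of seminorms cut off at \<open>1 / (n + 1)\<close>: the cut-offs tend to 0,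
  so finitely many seminorms control a ball, and invariance is immediate as only
  \<open>y - x\<close> enters.\<close>

lemma metrization:
  assumes "metrizable_space T"
  obtains d where "metric_lcs d" "mtop d = T"
proof -
  have haus: "Hausdorff_space T" and fc: "first_countable T"
    using assms metrizable_imp_Hausdorff_space metrizable_imp_first_countable by blast+
  obtain p :: "nat \<Rightarrow> 'a \<Rightarrow> real" where p: "\<And>n. continuous_seminorm T (p n)"
    "\<And>U x. \<lbrakk>openin T U; x \<in> U\<rbrakk> \<Longrightarrow> \<exists>n. {y. p n (y - x) < 1} \<subseteq> U"
    using countable_seminorms fc by blast
  define \<delta> where "\<delta> n z = min (1 / real (Suc n)) (p n z)" for n z
  define d where "d x y = (SUP n. \<delta> n (y - x))" for x y
  have \<delta>0: "0 \<le> \<delta> n z" "\<delta> n z \<le> 1" for n z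
    using seminorm_nonneg [OF p(1)] by (auto simp: \<delta>_def min_le_iff_disj)
  have bdd: "bdd_above (range (\<lambda>n. \<delta> n z))" for z by (rule bdd_aboveI [of _ 1]) (use \<delta>0 in auto)
  have le: "\<delta> n (y - x) \<le> d x y" for n x y
    unfolding d_def by (rule cSUP_upper [OF _ bdd]) simp
  have least: "d x y \<le> r" if "\<And>n. \<delta> n (y - x) \<le> r" for x y r
    unfolding d_def by (rule cSUP_least) (use that in auto)
  have sym: "d x y = d y x" for x y
    unfolding d_def \<delta>_def using seminorm_diff_commute [OF p(1)] by metis
  have pos: "0 \<le> d x y" for x y using le [of 0 y x] \<delta>0(1) [of 0 "y - x"] by linarith
  have zero: "x = y" if "d x y = 0" for x y
  proof (rule ccontr)
    assume "x \<noteq> y"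
    then obtain U where "openin T U" "x \<in> U" "y \<notin> U"
      using haus unfolding Hausdorff_space_def disjnt_def topspace_UNIV by (metis Int_iff UNIV_I empty_iff)
    then obtain n where "{z. p n (z - x) < 1} \<subseteq> U" using p(2) by blast
    then have "p n (y - x) \<ge> 1" using \<open>y \<notin> U\<close> by force
    moreover have "1 / real (Suc n) \<le> 1" by simp
    ultimately have "\<delta> n (y - x) = 1 / real (Suc n)" unfolding \<delta>_def by (intro min_absorb1) linarith
    then show False using le [of n y x] that by simp
  qed
  have refl: "d x x = 0" for x unfolding d_def by (simp add: \<delta>_def seminorm_zero [OF p(1)])
  have tri: "d x z \<le> d x y + d y z" for x y z
  proof (rule least)
    fix n
    have "p n (z - x) \<le> p n (z - y) + p n (y - x)" by (rule seminorm_triangle [OF p(1)])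
    moreover have "min c a \<le> min c b + min c b'" if "a \<le> b + b'" "0 \<le> b" "0 \<le> b'" "0 \<le> c" for a b b' c :: real
      using that by linarith
    ultimately have "\<delta> n (z - x) \<le> \<delta> n (z - y) + \<delta> n (y - x)"
      unfolding \<delta>_def using seminorm_nonneg [OF p(1)] by simp
    then show "\<delta> n (z - x) \<le> d x y + d y z" using le [of n z y] le [of n y x] by linarith
  qed
  interpret M: Metric_space UNIV d
  proof
    fix x y z
    show "0 \<le> d x y" by (rule pos)
    show "d x y = d y x" by (rule sym)
    show "d x y = 0 \<longleftrightarrow> x = y" using zero refl by metis
    show "d x z \<le> d x y + d y z" by (rule tri)
  qed
  have "openin (mtop d) U \<longleftrightarrow> openin T U" for U
  proof
    assume U: "openin T U"
    show "openin (mtop d) U"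
      unfolding M.openin_mtopology
    proof (intro conjI allI impI)
      fix x assume "x \<in> U"
      then obtain n where n: "{y. p n (y - x) < 1} \<subseteq> U" using p(2) U by blast
      have "y \<in> U" if "d x y < 1 / real (Suc n)" for y
      proof -
        have "\<delta> n (y - x) < 1 / real (Suc n)" using le [of n y x] that by linarith
        then have "p n (y - x) < 1 / real (Suc n)" by (auto simp: \<delta>_def min_def split: if_splits)
        moreover have "1 / real (Suc n) \<le> 1" by simp
        ultimately have "p n (y - x) < 1" by linarith
        then show ?thesis using n by blast
      qed
      then show "\<exists>r>0. M.mball x r \<subseteq> U" by (intro exI [of _ "1 / real (Suc n)"]) auto
    qed simp
  next
    assume U: "openin (mtop d) U"
    show "openin T U"
    proof (subst openin_subopen, clarify)
      fix x assume "x \<in> U"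
      then obtain r where r: "r > 0" "M.mball x r \<subseteq> U" using U unfolding M.openin_mtopology by blast
      \<comment> \<open>Beyond \<open>N\<close> the cut-off alone keeps a term below
        \<open>r / 2\<close>; the radius is halved since a supremum yields only a weak
        inequality.\<close>
      obtain N where N: "1 / real (Suc N) < r / 2" using nat_approx_posE [of "r / 2"] r by auto
      let ?V = "\<Inter>n\<le>N. {y. p n (y - x) < r / 2}"
      have "openin T ?V" by (rule openin_INT2, simp, simp, rule seminorm_open [OF p(1)])
      moreover have "x \<in> ?V" using r by (simp add: seminorm_zero [OF p(1)])
      moreover have "y \<in> U" if y: "y \<in> ?V" for y
      proof -
        have "d x y \<le> r / 2"
        proof (rule least)
          fix n
          show "\<delta> n (y - x) \<le> r / 2"
          proof (cases "n \<le> N")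
            case True
            then have "p n (y - x) < r / 2" using y by auto
            then show ?thesis by (simp add: \<delta>_def min_le_iff_disj)
          next
            case False
            then have "1 / real (Suc n) \<le> 1 / real (Suc N)" by (simp add: frac_le)
            then have "1 / real (Suc n) \<le> r / 2" using N by linarith
            then show ?thesis by (simp add: \<delta>_def min_le_iff_disj)
          qed
        qed
        then show ?thesis using r by auto
      qed
      ultimately show "\<exists>V. openin T V \<and> x \<in> V \<and> V \<subseteq> U" by blast
    qed
  qed
  then have top: "mtop d = T" by (simp add: topology_eq)
  have "d (x + z) (y + z) = d x y" for x y z by (simp add: d_def)
  then have "metric_lcs d" unfolding metric_lcs_def using M.Metric_space_axioms top lcs by simp
  then show ?thesis using that top by blast
qed

section \<open>Local bi-uniform continuity under group operations\<close>

lemma group_uniformly_continuous_on_cong: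
  "\<lbrakk>group_uniformly_continuous_on T S f; \<And>x. x \<in> S \<Longrightarrow> f x = g x\<rbrakk> \<Longrightarrow> group_uniformly_continuous_on T S g"
  unfolding group_uniformly_continuous_on_def by simp

lemma group_uniformly_continuous_on_subset:
  "\<lbrakk>group_uniformly_continuous_on T S f; S' \<subseteq> S\<rbrakk> \<Longrightarrow> group_uniformly_continuous_on T S' f"
  unfolding group_uniformly_continuous_on_def by (meson subsetD)

lemma group_uniformly_continuous_on_comp:
  assumes g: "group_uniformly_continuous_on T S g" and f: "group_uniformly_continuous_on T (g ` S) f"
  shows "group_uniformly_continuous_on T S (f \<circ> g)"
  unfolding group_uniformly_continuous_on_def
proof (intro allI impI)
  fix V assume "openin T V \<and> 0 \<in> V"
  then obtain U where U: "openin T U" "0 \<in> U" "\<forall>x\<in>g ` S. \<forall>y\<in>g ` S. x - y \<in> U \<longrightarrow> f x - f y \<in> V"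
    using f unfolding group_uniformly_continuous_on_def by meson
  then obtain W where W: "openin T W" "0 \<in> W" "\<forall>x\<in>S. \<forall>y\<in>S. x - y \<in> W \<longrightarrow> g x - g y \<in> U"
    using g unfolding group_uniformly_continuous_on_def by meson
  then show "\<exists>U. openin T U \<and> 0 \<in> U \<and> (\<forall>x\<in>S. \<forall>y\<in>S. x - y \<in> U \<longrightarrow> (f \<circ> g) x - (f \<circ> g) y \<in> V)"
    using U(3) by (intro exI [of _ W]) auto
qed

text \<open>\<open>locally_bi_uc\<close> speaks of \<open>inv_into\<close>; carrying the inverse as
  an argument makes composition and inversion symmetric.\<close>

definition bi_uniform :: "('a \<Rightarrow> 'a) \<Rightarrow> ('a \<Rightarrow> 'a) \<Rightarrow> bool" where
  "bi_uniform f g \<longleftrightarrow> homeomorphic_maps T T f g \<and>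
     (\<forall>x. \<exists>U. openin T U \<and> x \<in> U \<and> group_uniformly_continuous_on T U f \<and>
        group_uniformly_continuous_on T (f ` U) g)"

lemma bi_uniform_inverse: "bi_uniform f g \<Longrightarrow> g (f x) = x \<and> f (g x) = x"
  by (simp add: bi_uniform_def homeomorphic_maps_def)

lemma bi_uniform_if_locally_bi_uc:
  assumes f: "homeomorphic_maps T T f g" "locally_bi_uc T UNIV f"
  shows "bi_uniform f g"
proof -
  have gf: "g (f x) = x" for x using f(1) by (simp add: homeomorphic_maps_def)
  then have "inj f" by (metis injI)
  then have inv: "inv_into UNIV f y = g y" if "y \<in> range f" for y using that gf by (auto simp: inv_f_f)
  have "\<exists>U. openin T U \<and> x \<in> U \<and> group_uniformly_continuous_on T U f \<and>
        group_uniformly_continuous_on T (f ` U) g" for x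
  proof -
    obtain U where U: "openin T U" "x \<in> U" "group_uniformly_continuous_on T U f"
      "group_uniformly_continuous_on T (f ` U) (inv_into UNIV f)"
      using f(2) unfolding locally_bi_uc_def subtopology_UNIV by blast
    have "group_uniformly_continuous_on T (f ` U) g"
      by (rule group_uniformly_continuous_on_cong [OF U(4)]) (auto simp: inv)
    then show ?thesis using U by blast
  qed
  then show ?thesis using f(1) by (simp add: bi_uniform_def)
qed

lemma bi_uniform_sym:
  assumes f: "bi_uniform f g" shows "bi_uniform g f"
proof -
  have hm: "homeomorphic_maps T T g f" using f homeomorphic_maps_sym by (auto simp: bi_uniform_def)
  have "\<exists>U. openin T U \<and> y \<in> U \<and> group_uniformly_continuous_on T U g \<and>
        group_uniformly_continuous_on T (g ` U) f" for y
  proof -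
    obtain U where U: "openin T U" "g y \<in> U" "group_uniformly_continuous_on T U f"
      "group_uniformly_continuous_on T (f ` U) g"
      using f unfolding bi_uniform_def by blast
    have "f ` U = {z \<in> topspace T. g z \<in> U}"
      using bi_uniform_inverse [OF f] by (auto intro: image_eqI [of _ _ "g _"])
    then have "openin T (f ` U)"
      using hm U(1) openin_continuous_map_preimage by (metis homeomorphic_maps_def)
    moreover have "y \<in> f ` U" using U(2) bi_uniform_inverse [OF f] by (metis image_eqI)
    moreover have "g ` f ` U = U" using bi_uniform_inverse [OF f] by (simp add: image_image)
    ultimately show ?thesis using U by metis
  qed
  then show ?thesis using hm by (simp add: bi_uniform_def)
qed

lemma bi_uniform_comp:
  assumes f: "bi_uniform f g" and f': "bi_uniform f' g'" shows "bi_uniform (f \<circ> f') (g' \<circ> g)"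
proof -
  have hm: "homeomorphic_maps T T (f \<circ> f') (g' \<circ> g)"
    using f f' homeomorphic_maps_compose [of T T f' g' T f g] by (simp add: bi_uniform_def)
  have "\<exists>U. openin T U \<and> x \<in> U \<and> group_uniformly_continuous_on T U (f \<circ> f') \<and>
        group_uniformly_continuous_on T ((f \<circ> f') ` U) (g' \<circ> g)" for x
  proof -
    obtain U where U: "openin T U" "x \<in> U" "group_uniformly_continuous_on T U f'"
      "group_uniformly_continuous_on T (f' ` U) g'"
      using f' unfolding bi_uniform_def by blast
    obtain V where V: "openin T V" "f' x \<in> V" "group_uniformly_continuous_on T V f"
      "group_uniformly_continuous_on T (f ` V) g"
      using f unfolding bi_uniform_def by blast
    define W where "W = U \<inter> {z. f' z \<in> V}"
    have "continuous_map T T f'" using f' by (simp add: bi_uniform_def homeomorphic_maps_def)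
    then have "openin T W"
      unfolding W_def using openin_continuous_map_preimage [OF _ V(1), of T f'] U(1) by auto
    moreover have "x \<in> W" using U V by (simp add: W_def)
    moreover have "group_uniformly_continuous_on T W (f \<circ> f')"
      by (rule group_uniformly_continuous_on_comp)
        (rule group_uniformly_continuous_on_subset [OF U(3)] group_uniformly_continuous_on_subset [OF V(3)];
          auto simp: W_def)+
    moreover have "g ` (f \<circ> f') ` W = f' ` W"
      using bi_uniform_inverse [OF f] by (simp add: image_image)
    then have "group_uniformly_continuous_on T ((f \<circ> f') ` W) (g' \<circ> g)"
      by (intro group_uniformly_continuous_on_comp)
        (rule group_uniformly_continuous_on_subset [OF V(4)], force simp: W_def,
         simp, rule group_uniformly_continuous_on_subset [OF U(4)], auto simp: W_def)
    ultimately show ?thesis by blast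
  qed
  then show ?thesis using hm by (simp add: bi_uniform_def)
qed

lemma locally_bi_uc_restrict:
  assumes f: "bi_uniform f g" and X: "openin T X"
  shows "locally_bi_uc T X (restrict f X)"
  unfolding locally_bi_uc_def
proof
  fix x assume x: "x \<in> X"
  obtain U where U: "openin T U" "x \<in> U" "group_uniformly_continuous_on T U f"
    "group_uniformly_continuous_on T (f ` U) g"
    using f unfolding bi_uniform_def by blast
  let ?V = "X \<inter> U"
  have inj: "inj_on (restrict f X) X" using bi_uniform_inverse [OF f] by (intro inj_onI) (simp, metis)
  have "group_uniformly_continuous_on T ?V (restrict f X)"
    by (rule group_uniformly_continuous_on_cong [OF group_uniformly_continuous_on_subset [OF U(3)]]) auto
  moreover have "group_uniformly_continuous_on T (restrict f X ` ?V) (inv_into X (restrict f X))"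
  proof (rule group_uniformly_continuous_on_cong [OF group_uniformly_continuous_on_subset [OF U(4)]])
    show "restrict f X ` ?V \<subseteq> f ` U" by auto
    fix y assume "y \<in> restrict f X ` ?V"
    then obtain z where z: "z \<in> ?V" "y = restrict f X z" by blast
    then have "inv_into X (restrict f X) y = z" using inv_into_f_f [OF inj, of z] by simp
    then show "g y = inv_into X (restrict f X) y" using z bi_uniform_inverse [OF f] by auto
  qed
  moreover have "openin (subtopology T X) ?V" using U(1) by (rule openin_subtopology_Int2)
  ultimately show "\<exists>U. openin (subtopology T X) U \<and> x \<in> U \<and>
      group_uniformly_continuous_on T U (restrict f X) \<and>
      group_uniformly_continuous_on T (restrict f X ` U) (inv_into X (restrict f X))"
    using x U(2) by blast
qed

end

context metric_locally_convex
begin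

text \<open>Local bi-uniform continuity is demanded of the generators only; it passes to the
  generated group by stability under inverses and composition.\<close>

lemma P_space_bi_uniform:
  assumes "h \<in> P_space d"
  shows "\<exists>k. bi_uniform h k"
  using assms unfolding P_space_def
proof (induction rule: generate.induct)
  case one
  have "homeomorphic_maps (mtop d) (mtop d) id id" by (simp add: homeomorphic_maps_id)
  moreover have "locally_bi_uc (mtop d) UNIV id" using bilipschitz_locally_bi_uc bilipschitz_id by blast
  moreover have "\<one>\<^bsub>homeo_group (mtop d)\<^esub> = id" by (auto simp: homeo_group_one)
  ultimately show ?case using bi_uniform_if_locally_bi_uc by metis
next
  case (incl h)
  then have h: "h \<in> carrier (homeo_group (mtop d))" "locally_bi_uc (mtop d) UNIV h" by (auto simp: P_hat_def)
  then obtain k where "homeomorphic_maps (mtop d) (mtop d) h k" using homeo_group_inverse by blast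
  then show ?case using h(2) bi_uniform_if_locally_bi_uc by blast
next
  case (inv h)
  then have h: "h \<in> carrier (homeo_group (mtop d))" "locally_bi_uc (mtop d) UNIV h" by (auto simp: P_hat_def)
  then obtain k where k: "homeomorphic_maps (mtop d) (mtop d) h k" using homeo_group_inverse by blast
  have "inv\<^bsub>homeo_group (mtop d)\<^esub> h = k"
    using inv_homeo_group [OF h(1) k] by (simp add: restrict_def)
  then show ?case using bi_uniform_sym bi_uniform_if_locally_bi_uc [OF k h(2)] by blast
next
  case (eng h1 h2)
  interpret H: group "homeo_group (mtop d)" by (rule group_homeo_group)
  have "generate (homeo_group (mtop d)) (P_hat d) \<subseteq> carrier (homeo_group (mtop d))"
    using subgroup_P_space subgroup.subset unfolding P_space_def by blast
  then have "h1 \<in> carrier (homeo_group (mtop d))" "h2 \<in> carrier (homeo_group (mtop d))"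
    using eng.hyps by auto
  then have "h1 \<otimes>\<^bsub>homeo_group (mtop d)\<^esub> h2 = h1 \<circ> h2"
    by (simp add: homeo_group_mult compose_def restrict_def o_def)
  then show ?case using eng.IH bi_uniform_comp by metis
qed

lemma P_open_locally_bi_uc:
  assumes X: "openin (mtop d) X" and h: "h \<in> P_open d X"
  shows "h \<in> carrier (homeo_group (subtopology (mtop d) X)) \<and> locally_bi_uc (mtop d) X h"
proof -
  obtain g where g: "g \<in> P_space d" "h = restrict g X" using h by (auto simp: P_open_def)
  obtain k where "bi_uniform g k" using P_space_bi_uniform g(1) by blast
  then have "locally_bi_uc (mtop d) X h" using locally_bi_uc_restrict X g(2) by blast
  then show ?thesis using h subgroup_P_open subgroup.subset by blast
qed

end

text \<open>After metrization, every element of \<open>P_open\<close> is locally bi-uniformly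
  continuous, so a group containing all such maps contains \<open>P_open\<close>. Thus (a) becomes a
  case of (c).\<close>

theorem KM_subset_KP: "KM \<subseteq> KP"
proof clarify
  fix X :: "'a topology" and G assume "(X, G) \<in> KM"
  then obtain T S where T: "locally_convex_tvs T" "metrizable_space T" "openin T S" "S \<noteq> {}"
    "X = subtopology T S" "space_group_pair X G"
    "{h \<in> carrier (homeo_group X). locally_bi_uc T S h} \<subseteq> G"
    by (auto simp: KM_def)
  obtain d where d: "metric_lcs d" "mtop d = T"
    by (rule locally_convex.metrization [OF locally_convex.intro [OF T(1)] T(2)])
  interpret metric_locally_convex d by unfold_locales (rule d)
  have "h \<in> G" if "h \<in> P_open d S" for h
    using P_open_locally_bi_uc [of S h] that T(3,5,7) d(2) by auto
  then have "P_open d S \<subseteq> G" by blast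
  then show "(X, G) \<in> KP" using d T by (auto simp: KP_def)
qed

text \<open>Two independent types let members over different vector spaces be compared. The zero
  space, for which (P2) fails, is left out of (b) but belongs to the classes in (a) and (c), where
  its group is trivial.\<close>

theorem theorem4p9:
  shows "faithful (KM :: ('a::real_vector topology \<times> ('a \<Rightarrow> 'a) set) set)
                  (KM :: ('b::real_vector topology \<times> ('b \<Rightarrow> 'b) set) set)
    \<and> (\<forall>(d :: 'a \<Rightarrow> 'a \<Rightarrow> real) X.
          metric_lcs d \<and> (UNIV :: 'a set) \<noteq> {0} \<and> openin (mtop d) X \<and> X \<noteq> {} \<longrightarrow>
          (subtopology (mtop d) X, P_open d X) \<in> K1)
    \<and> faithful (KP :: ('a topology \<times> ('a \<Rightarrow> 'a) set) set)
               (KP :: ('b topology \<times> ('b \<Rightarrow> 'b) set) set)"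
proof (intro conjI allI impI)
  show "faithful (KM :: ('a topology \<times> ('a \<Rightarrow> 'a) set) set) (KM :: ('b topology \<times> ('b \<Rightarrow> 'b) set) set)"
    by (rule faithful_mono [OF faithful_KP KM_subset_KP KM_subset_KP])
  show "faithful (KP :: ('a topology \<times> ('a \<Rightarrow> 'a) set) set) (KP :: ('b topology \<times> ('b \<Rightarrow> 'b) set) set)"
    by (rule faithful_KP)
  fix d :: "'a \<Rightarrow> 'a \<Rightarrow> real" and X
  assume "metric_lcs d \<and> (UNIV :: 'a set) \<noteq> {0} \<and> openin (mtop d) X \<and> X \<noteq> {}"
  then show "(subtopology (mtop d) X, P_open d X) \<in> K1"
    using metric_locally_convex.P_open_in_K1 [OF metric_locally_convex.intro] by blast
qed

end
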